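(* Let $n$ and $m$ be odd integers with $n\geq m\geq 3$, and let $\alpha$ be an integer with $0\leq\alpha\leq n$. Then $(\alpha,\beta)\in\mathrm{HWP}(C_m[n];m,n)$ if and only if $\beta=n-\alpha$, except possibly when $\alpha\in\{2,4\}$, or $\beta\in\{1,3\}$, or $(m,n,\alpha)\in\{(3,11,6),(3,13,8),(3,15,8)\}$.
   Context: $C_m[n]$ denotes the lexicographic product of the $m$-cycle $C_m$ with the empty graph on $n$ vertices: its vertex set is $\mathbb{Z}_m\times\mathbb{Z}_n$, and $(x,i)$ is adjacent to $(y,j)$ if and only if $x$ and $y$ are adjacent in the cycle $(0,1,\ldots,m-1)$ (i.e. $y=x\pm1$), for any $i,j\in\mathbb{Z}_n$. For $k\ge3$, a $C_k$-factor of a graph $G$ is a spanning subgraph of $G$ all of whose components are $k$-cycles. An $\mathrm{HW}(G;m,n;\alpha,\beta)$ is a partition of the edge set of $G$ into $\alpha$ $C_m$-factors and $\beta$ $C_n$-factors; $\mathrm{HWP}(G;m,n)$ is the set of pairs $(\alpha,\beta)$ for which one exists. *)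

theory Defs
  imports "Graph_Theory.Graph_Theory" "HOL-Library.Disjoint_Sets"
begin

text \<open>
  Finite simple graphs are represented as in the AFP entry Graph_Theory: a graph is a
  \<^locale>\<open>pair_graph\<close>, that is, a finite loopless digraph with a symmetric arc relation, in
  which the undirected edge \<open>{u, v}\<close> is the pair of arcs \<open>(u, v)\<close>, \<open>(v, u)\<close>.
  Residues modulo \<open>k\<close> are represented by \<open>{..<k}\<close>.
\<close>

text \<open>The cycle \<open>(0, 1, \<dots>, k - 1)\<close>; it is a simple graph for \<open>k \<ge> 3\<close> only.\<close>

definition cycle_graph :: "nat \<Rightarrow> nat pair_pre_digraph" where
  "cycle_graph k = \<lparr> pverts = {..<k},
     parcs = {(x, y). x < k \<and> y < k \<and> (y = (x + 1) mod k \<or> x = (y + 1) mod k)} \<rparr>"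

definition lex_cycle_graph :: "nat \<Rightarrow> nat \<Rightarrow> (nat \<times> nat) pair_pre_digraph" where
  "lex_cycle_graph m n = \<lparr> pverts = {..<m} \<times> {..<n},
     parcs = {((x, i), (y, j)). (x, y) \<in> parcs (cycle_graph m) \<and> i < n \<and> j < n} \<rparr>"

text \<open>
  Since \<open>H\<close> is required to be symmetric, its strongly connected components
  (\<^const>\<open>pre_digraph.sccs\<close>) are its connected components as an undirected graph.
\<close>

definition cycle_factor :: "nat \<Rightarrow> 'a pair_pre_digraph \<Rightarrow> 'a pair_pre_digraph \<Rightarrow> bool" where
  "cycle_factor k H G \<longleftrightarrow> pair_graph H \<and> spanning (with_proj H) (with_proj G) \<and>
     (\<forall>C \<in> pre_digraph.sccs (with_proj H). digraph_iso (with_proj (cycle_graph k)) C)"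

text \<open>
  \<open>A\<close> and \<open>B\<close> are the sets of (symmetric) edge sets of the \<open>C\<^sub>m\<close>-factors and of the
  \<open>C\<^sub>n\<close>-factors. They are kept disjoint so that for \<open>m = n\<close> no factor is counted twice.
  All classes being symmetric, partitioning the arcs amounts to partitioning the edges.
\<close>

definition is_HW :: "'a pair_pre_digraph \<Rightarrow> nat \<Rightarrow> nat \<Rightarrow> nat \<Rightarrow> nat \<Rightarrow>
    'a rel set \<Rightarrow> 'a rel set \<Rightarrow> bool" where
  "is_HW G m n \<alpha> \<beta> A B \<longleftrightarrow>
     partition_on (parcs G) (A \<union> B) \<and> A \<inter> B = {} \<and>
     finite A \<and> card A = \<alpha> \<and> finite B \<and> card B = \<beta> \<and>
     (\<forall>E \<in> A. cycle_factor m \<lparr> pverts = pverts G, parcs = E \<rparr> G) \<and>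
     (\<forall>E \<in> B. cycle_factor n \<lparr> pverts = pverts G, parcs = E \<rparr> G)"

definition HWP :: "'a pair_pre_digraph \<Rightarrow> nat \<Rightarrow> nat \<Rightarrow> (nat \<times> nat) set" where
  "HWP G m n = {(\<alpha>, \<beta>). \<exists>A B. is_HW G m n \<alpha> \<beta> A B}"

end

theory Submission
  imports Defs
begin

text \<open>
  The edges between two consecutive layers of \<open>C\<^sub>m[n]\<close> are classified by the residue \<open>j - i\<close> modulo
  \<open>n\<close> of an edge \<open>(x, i)(x + 1, j)\<close>. Each factor has \<open>m * n\<close> edges, so \<open>n\<close> factors whose union is the
  whole edge set form a partition; hence \<open>\<alpha> + \<beta> = n\<close> is necessary, and for sufficiency it is enough to
  cover all residues in all \<open>m\<close> gaps between layers.

  Three kinds of factors are used. Using the residue \<open>0\<close> in every gap gives a \<open>C\<^sub>m\<close>-factor. A Hamilton cycle of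
  \<open>\<int>\<^sub>n\<close> in which each step goes up or down one layer, with net climb divisible by \<open>m\<close>, closes up to
  an \<open>n\<close>-cycle, and its \<open>m\<close> rotations form a \<open>C\<^sub>n\<close>-factor; together with the opposite signs it
  covers the residues \<open>g\<close> and \<open>- g\<close> in every gap whenever \<open>g\<close> is a unit. Finally the residues \<open>-2, \<dots>, 2\<close> are
  covered by five \<open>C\<^sub>n\<close>-factors, two rotational ones and three obtained by extending \<open>m\<close> cycles of length
  \<open>m\<close> through the remaining rows. Relabelling the layers translates the residues in gap \<open>x\<close> by \<open>c x\<close>
  for any \<open>c\<close> whose sum vanishes modulo \<open>n\<close>. It remains to tile \<open>\<int>\<^sub>n\<close> by singletons, pairs and
  five-element blocks simultaneously in all gaps with vanishing sums of centres. The residues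
  around \<open>n / 2\<close> are tiled by an odd number of pairs, those around \<open>0\<close> by the other blocks.
\<close>

section \<open>Cycle factors and their arcs\<close>

text \<open>Pairs supply \<open>C_n\<close>-factors two at a time, so an odd \<beta> needs a block
  with an odd number of them; the block used has five, which leaves \<beta> = 1 and \<beta> = 3
  open. Two kinds of pairs exist for every odd \<open>n\<close>, whatever its divisors: radius 1,
  and radius \<open>(n + 1) div 2\<close>, a unit because twice it is 1 modulo \<open>n\<close>. If
  \<open>L\<close> pairs of the second kind tile the \<open>2 * L\<close> residues around
  \<open>n / 2\<close>, their centres are \<open>-L + 1, -L + 3, ..., L - 1\<close>. For even
  \<open>L\<close> these are odd, and an odd number of odd integers never has the integer sum 0.
  Hence the number of outer pairs is kept odd or zero, by moving one or more pairs of radius 1 into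
  the interval \<open>{-N..N}\<close> around 0 when necessary. One five-element block and \<alpha>
  singletons fill \<open>{-N..N}\<close> with \<open>N = \<alpha> div 2 + 2\<close>. Such tilings
  are given for \<open>N = 2\<close> and all \<open>N \<ge> 7\<close>. The gap between these ranges
  leaves \<alpha> = 2 and \<alpha> = 4 open and makes \<alpha> = 6 and \<alpha> = 8 special. Three
  of the special cases are settled with five freely chosen gaps, which exist only for
  \<open>m \<ge> 5\<close>; this is the origin of the excluded triples with
  \<open>m = 3\<close>.\<close>

definition cycle_arcs :: "nat \<Rightarrow> 'c set \<Rightarrow> ('c \<Rightarrow> nat \<Rightarrow> 'a) \<Rightarrow> 'a rel" where
  "cycle_arcs k C f = {(f c p, f c (Suc p mod k)) |c p. c \<in> C \<and> p < k} \<union>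
     {(f c (Suc p mod k), f c p) |c p. c \<in> C \<and> p < k}"

lemma cycle_graph_arcs:
  assumes "3 \<le> k"
  shows "parcs (cycle_graph k) = {(p, Suc p mod k) |p. p < k} \<union> {(Suc p mod k, p) |p. p < k}"
  using assms by (auto simp: cycle_graph_def)

text \<open>By injectivity a vertex determines its cycle, and both kinds of arcs in
  \<open>cycle_arcs\<close> lead to a neighbouring position of that same cycle. This yields
  closedness of a cycle under reachability as well as its isomorphism type.\<close>

lemma cycle_arcs_cases:
  assumes bij: "bij_betw (\<lambda>(c, p). f c p) (C \<times> {..<k}) V" and k: "3 \<le> k"
    and c: "c \<in> C" "p < k" and e: "(f c p, v) \<in> cycle_arcs k C f"
  shows "\<exists>q<k. v = f c q \<and> (p, q) \<in> parcs (cycle_graph k)"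
proof -
  have inj: "\<And>c p c' p'. c \<in> C \<Longrightarrow> c' \<in> C \<Longrightarrow> p < k \<Longrightarrow> p' < k \<Longrightarrow> f c p = f c' p' \<Longrightarrow> c = c' \<and> p = p'"
    using bij unfolding bij_betw_def inj_on_def by auto
  have m: "\<And>p. Suc p mod k < k" using k by simp
  from e consider (a) c' p' where "c' \<in> C" "p' < k" "f c p = f c' p'" "v = f c' (Suc p' mod k)"
    | (b) c' p' where "c' \<in> C" "p' < k" "f c p = f c' (Suc p' mod k)" "v = f c' p'"
    by (auto simp: cycle_arcs_def)
  then show ?thesis
  proof cases
    case a
    then have "c' = c" "p' = p" using inj c by metis+
    then show ?thesis using a m c k by (intro exI[of _ "Suc p mod k"]) (auto simp: cycle_graph_arcs)
  next
    case b
    then have "c' = c" "Suc p' mod k = p" using inj c m by metis+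
    moreover have "Suc p' mod k < k" using m .
    ultimately show ?thesis using b k by (intro exI[of _ p']) (auto simp: cycle_graph_arcs)
  qed
qed

text \<open>Walking along \<open>f c\<close> connects its positions in both directions and no arc
  leaves it, so the strong components are exactly the images of the maps \<open>f c\<close>. Each
  map \<open>f c\<close> is itself the required isomorphism.\<close>

lemma cycle_factor_cycle_arcs:
  fixes G :: "'a pair_pre_digraph"
  assumes bij: "bij_betw (\<lambda>(c, p). f c p) (C \<times> {..<k}) (pverts G)" and k: "3 \<le> k"
    and G: "wf_digraph (with_proj G)" and fin: "finite (pverts G)" and sub: "cycle_arcs k C f \<subseteq> parcs G"
  shows "cycle_factor k \<lparr>pverts = pverts G, parcs = cycle_arcs k C f\<rparr> G"
proof -
  define H where "H = \<lparr>pverts = pverts G, parcs = cycle_arcs k C f\<rparr>"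
  have inj: "\<And>c p c' p'. c \<in> C \<Longrightarrow> c' \<in> C \<Longrightarrow> p < k \<Longrightarrow> p' < k \<Longrightarrow> f c p = f c' p' \<Longrightarrow> c = c' \<and> p = p'"
    using bij unfolding bij_betw_def inj_on_def by auto
  have inV: "\<And>c p. c \<in> C \<Longrightarrow> p < k \<Longrightarrow> f c p \<in> pverts G"
    using bij unfolding bij_betw_def by auto
  have m: "\<And>p. Suc p mod k < k" using k by simp
  have ne: "Suc p mod k \<noteq> p" if "p < k" for p
    using that k by (cases "Suc p = k") auto
  have arcsV: "cycle_arcs k C f \<subseteq> pverts G \<times> pverts G"
    using inV m by (auto simp: cycle_arcs_def)
  have pg: "pair_graph H"
  proof (unfold_locales, goal_cases)
    case (1 e) then show ?case using arcsV by (auto simp: H_def)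
  next
    case (2 e) then show ?case using arcsV by (auto simp: H_def)
  next
    case 3 then show ?case using fin by (simp add: H_def)
  next
    case 4 then show ?case using fin arcsV by (auto simp: H_def intro: finite_subset)
  next
    case (5 e)
    have "f c p \<noteq> f c (Suc p mod k)" if "c \<in> C" "p < k" for c p
      using inj[OF that(1) that(1) that(2) m] ne[OF that(2)] by metis
    then have "f c p \<noteq> f c (Suc p mod k)" "f c (Suc p mod k) \<noteq> f c p" if "c \<in> C" "p < k" for c p
      using that by metis+
    then show ?case using 5 by (auto simp: H_def cycle_arcs_def)
  next
    case 6 then show ?case
      by (auto simp: H_def symmetric_def cycle_arcs_def sym_def)
  qed
  then interpret H: pair_graph H .
  have wfH: "wf_digraph (with_proj H)" by unfold_locales
  have sp: "spanning (with_proj H) (with_proj G)"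
    using sub wfH G by (auto simp: spanning_def subgraph_def compatible_def H_def)
  have "digraph_iso (with_proj (cycle_graph k)) X" if X: "X \<in> pre_digraph.sccs (with_proj H)" for X
  proof -
    obtain S where S: "S \<in> pre_digraph.sccs_verts (with_proj H)" "X = with_proj H \<restriction> S"
      using X H.sccs_conv_sccs_verts by auto
    have S1: "S \<noteq> {}" and S2: "\<And>u v. u \<in> S \<Longrightarrow> v \<in> S \<Longrightarrow> u \<rightarrow>\<^sup>*\<^bsub>with_proj H\<^esub> v"
      and S3: "\<And>u v. u \<in> S \<Longrightarrow> v \<notin> S \<Longrightarrow> \<not> u \<rightarrow>\<^sup>*\<^bsub>with_proj H\<^esub> v \<or> \<not> v \<rightarrow>\<^sup>*\<^bsub>with_proj H\<^esub> u"
      using S(1) by (auto simp: H.in_sccs_verts_conv_reachable)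
    obtain u where u: "u \<in> S" using S1 by auto
    have "u \<in> verts (with_proj H)" using H.reachable_in_verts(1)[OF S2[OF u u]] by simp
    then have "u \<in> (\<lambda>(c, p). f c p) ` (C \<times> {..<k})"
      using bij_betw_imp_surj_on[OF bij] by (simp add: H_def)
    then obtain c p where cp: "c \<in> C" "p < k" "u = f c p" by auto
    define R where "R = f c ` {..<k}"
    have step: "(f c q, f c (Suc q mod k)) \<in> parcs H" "(f c (Suc q mod k), f c q) \<in> parcs H"
      if "q < k" for q
      using that cp(1) by (auto simp: H_def cycle_arcs_def)
    have from0: "f c 0 \<rightarrow>\<^sup>*\<^bsub>with_proj H\<^esub> f c q \<and> f c q \<rightarrow>\<^sup>*\<^bsub>with_proj H\<^esub> f c 0" if "q < k" for q
      using that
    proof (induction q)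
      case 0
      then have "f c 0 \<in> verts (with_proj H)" using inV[OF cp(1)] by (simp add: H_def)
      then show ?case by (simp add: H.reachable_refl)
    next
      case (Suc q)
      have "(f c q, f c (Suc q)) \<in> parcs H" "(f c (Suc q), f c q) \<in> parcs H"
        using step[of q] Suc.prems by auto
      moreover have "f c 0 \<rightarrow>\<^sup>*\<^bsub>with_proj H\<^esub> f c q" "f c q \<rightarrow>\<^sup>*\<^bsub>with_proj H\<^esub> f c 0"
        using Suc by auto
      ultimately show ?case using H.reachable_trans H.reachable_adjI by meson
    qed
    have RR: "v \<rightarrow>\<^sup>*\<^bsub>with_proj H\<^esub> w" if vw: "v \<in> R" "w \<in> R" for v w
    proof -
      obtain q where "q < k" "v = f c q" using vw(1) unfolding R_def by blast
      moreover obtain r where "r < k" "w = f c r" using vw(2) unfolding R_def by blast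
      ultimately show ?thesis using from0[of q] from0[of r] H.reachable_trans by blast
    qed
    have closed: "w \<in> R" if "v \<rightarrow>\<^sup>*\<^bsub>with_proj H\<^esub> w" "v \<in> R" for v w
      using that
    proof (induction rule: H.reachable_induct)
      case base then show ?case by simp
    next
      case (step x y)
      then obtain q where q: "q < k" "x = f c q" by (auto simp: R_def)
      have "(f c q, y) \<in> cycle_arcs k C f" using step q by (auto simp: H_def)
      from cycle_arcs_cases[OF bij k cp(1) q(1) this] show ?case by (auto simp: R_def)
    qed
    have uR: "u \<in> R" using cp by (auto simp: R_def)
    have "S = R"
    proof
      show "S \<subseteq> R" using closed S2 u uR by blast
      show "R \<subseteq> S" using S3 u uR RR by blast
    qed
    define h :: "(nat, nat \<times> nat, 'a, 'a \<times> 'a) digraph_isomorphism" where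
      "h = \<lparr>iso_verts = f c, iso_arcs = map_prod (f c) (f c), iso_head = snd, iso_tail = fst\<rparr>"
    have sv: "pverts (cycle_graph k) = {..<k}" by (simp add: cycle_graph_def)
    have sa: "parcs (cycle_graph k) \<subseteq> {..<k} \<times> {..<k}" by (auto simp: cycle_graph_def)
    have "pre_digraph.digraph_isomorphism (with_proj (cycle_graph k)) h"
      unfolding pre_digraph.digraph_isomorphism_def
    proof (intro conjI)
      show "wf_digraph (with_proj (cycle_graph k))"
        using sa by unfold_locales (auto simp: sv)
      show i: "inj_on (iso_verts h) (verts (with_proj (cycle_graph k)))"
        using inj cp by (auto simp: h_def sv inj_on_def)
      show "inj_on (iso_arcs h) (arcs (with_proj (cycle_graph k)))"
      proof -
        have "inj_on (map_prod (f c) (f c)) ({..<k} \<times> {..<k})"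
          using i by (intro map_prod_inj_on) (simp_all add: h_def sv)
        then show ?thesis using sa by (simp add: h_def inj_on_subset)
      qed
    qed (auto simp: h_def)
    moreover have "X = app_iso h (with_proj (cycle_graph k))"
    proof (rule pre_digraph.equality)
      show "verts X = verts (app_iso h (with_proj (cycle_graph k)))"
        by (simp add: S(2) \<open>S = R\<close> h_def sv R_def)
      have "{e \<in> cycle_arcs k C f. fst e \<in> R \<and> snd e \<in> R} = map_prod (f c) (f c) ` parcs (cycle_graph k)"
      proof (intro set_eqI iffI)
        fix e assume "e \<in> {e \<in> cycle_arcs k C f. fst e \<in> R \<and> snd e \<in> R}"
        then obtain q v where "q < k" "e = (f c q, v)" "e \<in> cycle_arcs k C f"
          by (cases e) (auto simp: R_def)
        with cycle_arcs_cases[OF bij k cp(1), of q v]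
        show "e \<in> map_prod (f c) (f c) ` parcs (cycle_graph k)" by force
      next
        fix e assume "e \<in> map_prod (f c) (f c) ` parcs (cycle_graph k)"
        then show "e \<in> {e \<in> cycle_arcs k C f. fst e \<in> R \<and> snd e \<in> R}"
          using cp(1) k by (auto simp: cycle_graph_arcs cycle_arcs_def R_def)
      qed
      then show "arcs X = arcs (app_iso h (with_proj (cycle_graph k)))"
        by (simp add: S(2) \<open>S = R\<close> h_def H_def)
    qed (auto simp: S(2) h_def)
    ultimately show ?thesis by (auto simp: digraph_iso_def)
  qed
  then show ?thesis using pg sp unfolding cycle_factor_def H_def by blast
qed

lemma card_cycle_graph_out_arcs:
  assumes "3 \<le> k" "p < k"
  shows "card {e \<in> parcs (cycle_graph k). fst e = p} = 2"
proof -
  define q where "q = (if p = 0 then k - 1 else p - 1)"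
  have suc: "Suc r mod k = (if Suc r = k then 0 else Suc r)" if "r < k" for r
    using that by (metis Suc_lessI mod_less mod_self)
  have q: "q < k" "Suc p mod k \<noteq> q" "p = Suc r mod k \<longleftrightarrow> r = q" if "r < k" for r
    unfolding suc[OF assms(2)] suc[OF that] q_def using assms that by (simp_all, arith+)
  have "(p, r) \<in> parcs (cycle_graph k) \<longleftrightarrow> r = Suc p mod k \<or> r = q" for r
  proof (cases "r < k")
    case True
    then show ?thesis using assms(2) q(3)[of r] by (simp add: cycle_graph_def)
  next
    case False
    then show ?thesis using assms q(1)[OF assms(2)] by (auto simp: cycle_graph_def)
  qed
  then have "{r. (p, r) \<in> parcs (cycle_graph k)} = {Suc p mod k, q}" by blast
  moreover have "{e \<in> parcs (cycle_graph k). fst e = p} = Pair p ` {r. (p, r) \<in> parcs (cycle_graph k)}"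
    by force
  ultimately show ?thesis using q(2)[OF assms(2)] by simp
qed

text \<open>Symmetry keeps every out-neighbour of a vertex in its own strong component, and the
  isomorphism with a \<open>k\<close>-cycle gives exactly two of them. Summing out-degrees then
  counts the arcs without any knowledge of the number of cycles.\<close>

lemma cycle_factor_card_arcs:
  fixes G :: "'a pair_pre_digraph"
  assumes cf: "cycle_factor k H G" and k: "3 \<le> k"
  shows "card (parcs H) = 2 * card (pverts G)"
proof -
  interpret H: pair_graph H using cf by (simp add: cycle_factor_def)
  have VG: "pverts G = pverts H" using cf by (auto simp: cycle_factor_def spanning_def)
  have out: "card {e \<in> parcs H. fst e = u} = 2" if u: "u \<in> pverts H" for u
  proof -
    define S where "S = H.scc_of u"
    define X where "X = with_proj H \<restriction> S"
    have uS: "u \<in> S" using u by (auto simp: S_def H.scc_of_def)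
    have "S \<in> H.sccs_verts" using u H.scc_of_in_sccs_verts by (simp add: S_def)
    then have "X \<in> H.sccs" by (simp add: X_def H.in_sccs_verts_conv)
    then obtain h where h: "pre_digraph.digraph_isomorphism (with_proj (cycle_graph k)) h"
        "X = app_iso h (with_proj (cycle_graph k))"
      using cf by (auto simp: cycle_factor_def digraph_iso_def)
    have sv: "pverts (cycle_graph k) = {..<k}" by (simp add: cycle_graph_def)
    have vX: "verts X = iso_verts h ` {..<k}" using h(2) by (simp add: sv)
    then obtain p where p: "p < k" "u = iso_verts h p" using uS by (auto simp: X_def)
    \<comment> \<open>\<open>X\<close> is an induced subgraph of \<open>with_proj H\<close>, so its
      tail map is \<open>fst\<close>; comparison with \<open>app_iso\<close> identifies the one
      stored in \<open>h\<close>.\<close>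
    have tl: "iso_tail h = fst"
      using arg_cong[OF h(2), of tail] by (simp add: X_def)
    have "{e \<in> parcs H. fst e = u} = {e \<in> arcs X. fst e = u}"
    proof -
      have "v \<in> S" if "(u, v) \<in> parcs H" for v
      proof -
        have "u \<rightarrow>\<^bsub>with_proj H\<^esub> v" using that by auto
        moreover have "v \<rightarrow>\<^bsub>with_proj H\<^esub> u"
          using calculation H.sym_arcs by (auto simp: symmetric_def sym_def)
        ultimately show ?thesis by (auto simp: S_def H.scc_of_def)
      qed
      then show ?thesis using uS unfolding X_def by auto
    qed
    also have "\<dots> = iso_arcs h ` {e \<in> parcs (cycle_graph k). fst e = p}"
    proof -
      have inj: "inj_on (iso_verts h) {..<k}"
        using h(1) by (auto simp: pre_digraph.digraph_isomorphism_def sv)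
      have "fst (iso_arcs h e) = iso_verts h (fst e)" if "e \<in> parcs (cycle_graph k)" for e
        using h(1) that by (simp add: pre_digraph.digraph_isomorphism_def tl)
      moreover have "fst e < k" if "e \<in> parcs (cycle_graph k)" for e
        using that by (auto simp: cycle_graph_def)
      ultimately have *: "fst (iso_arcs h e) = u \<longleftrightarrow> fst e = p" if "e \<in> parcs (cycle_graph k)" for e
        using that p inj by (simp add: inj_on_eq_iff)
      have "arcs X = iso_arcs h ` parcs (cycle_graph k)" using h(2) by simp
      then have "{e \<in> arcs X. fst e = u} = iso_arcs h ` {e \<in> parcs (cycle_graph k). fst (iso_arcs h e) = u}"
        by (simp add: Compr_image_eq)
      also have "{e \<in> parcs (cycle_graph k). fst (iso_arcs h e) = u} = {e \<in> parcs (cycle_graph k). fst e = p}"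
        by (rule Collect_cong) (simp only: * cong: conj_cong)
      finally show ?thesis .
    qed
    also have "card \<dots> = card {e \<in> parcs (cycle_graph k). fst e = p}"
    proof (rule card_image)
      have "inj_on (iso_arcs h) (parcs (cycle_graph k))"
        using h(1) by (simp add: pre_digraph.digraph_isomorphism_def)
      then show "inj_on (iso_arcs h) {e \<in> parcs (cycle_graph k). fst e = p}"
        by (rule inj_on_subset) blast
    qed
    finally show ?thesis using card_cycle_graph_out_arcs[OF k p(1)] by simp
  qed
  have "parcs H = (\<Union>u\<in>pverts H. {e \<in> parcs H. fst e = u})"
    using H.arc_fst_in_verts by fastforce
  also have "card \<dots> = (\<Sum>u\<in>pverts H. card {e \<in> parcs H. fst e = u})"
    using H.pair_finite_verts H.pair_finite_arcs by (intro card_UN_disjoint) auto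
  finally show ?thesis using out VG by simp
qed

text \<open>The triple \<open>(x, i, j)\<close> stands for the edge joining \<open>(x, i)\<close> to \<open>(x + 1, j)\<close>.\<close>

definition edge_system :: "nat \<Rightarrow> nat \<Rightarrow> nat \<Rightarrow> 'c set \<Rightarrow> ('c \<Rightarrow> nat \<Rightarrow> nat \<times> nat) \<Rightarrow> (nat \<times> nat \<times> nat) set" where
  "edge_system m n k C f = {(x, i, j). x < m \<and> (\<exists>c\<in>C. \<exists>p<k.
     f c p = (x, i) \<and> f c (Suc p mod k) = (Suc x mod m, j) \<or>
     f c (Suc p mod k) = (x, i) \<and> f c p = (Suc x mod m, j))}"

definition adjacent_layers :: "nat \<Rightarrow> nat \<Rightarrow> nat \<Rightarrow> bool" where
  "adjacent_layers m x y \<longleftrightarrow> y = Suc x mod m \<or> x = Suc y mod m"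

definition is_factor :: "nat \<Rightarrow> nat \<Rightarrow> nat \<Rightarrow> (nat \<times> nat \<times> nat) set \<Rightarrow> bool" where
  "is_factor m n k F \<longleftrightarrow> (\<exists>(C::nat set) f.
     bij_betw (\<lambda>(c, p). f c p) (C \<times> {..<k}) ({..<m} \<times> {..<n}) \<and>
     (\<forall>c\<in>C. \<forall>p<k. adjacent_layers m (fst (f c p)) (fst (f c (Suc p mod k)))) \<and>
     F = edge_system m n k C f)"

definition edge_arcs :: "nat \<Rightarrow> (nat \<times> nat \<times> nat) set \<Rightarrow> (nat \<times> nat) rel" where
  "edge_arcs m F = {((x, i), (Suc x mod m, j)) |x i j. (x, i, j) \<in> F} \<union>
     {((Suc x mod m, j), (x, i)) |x i j. (x, i, j) \<in> F}"

section \<open>Passing between sets of triples and symmetric arc sets\<close>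

lemma suc_mod_cases: "x < m \<Longrightarrow> Suc x mod m = (if Suc x = m then 0 else Suc x)"
  by (metis Suc_lessI mod_less mod_self)

text \<open>With at least three layers no two layers follow each other in both directions, so every
  edge has a unique upward direction and is represented by exactly one triple.\<close>

lemma suc_mod_neq:
  assumes "3 \<le> m" "x < m" "y < m" "y = Suc x mod m"
  shows "x \<noteq> Suc y mod m"
  using assms(1,2,4) unfolding assms(4) suc_mod_cases[OF assms(2)]
  by (cases "Suc x = m"; cases "Suc (Suc x) = m") (simp_all add: suc_mod_cases)

lemma lex_cycle_graph_arcs:
  "parcs (lex_cycle_graph m n) = edge_arcs m ({..<m} \<times> {..<n} \<times> {..<n})"
  by (auto simp: lex_cycle_graph_def cycle_graph_def edge_arcs_def)

lemma edge_arcs_mem: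
  assumes m: "3 \<le> m" and F: "F \<subseteq> {..<m} \<times> {..<n} \<times> {..<n}" and "x < m" "y < m"
  shows "((x, i), (y, j)) \<in> edge_arcs m F \<longleftrightarrow>
    y = Suc x mod m \<and> (x, i, j) \<in> F \<or> x = Suc y mod m \<and> (y, j, i) \<in> F"
  by (auto simp: edge_arcs_def)

lemma edge_arcs_disjoint:
  assumes m: "3 \<le> m" and F: "F \<subseteq> {..<m} \<times> {..<n} \<times> {..<n}" "F' \<subseteq> {..<m} \<times> {..<n} \<times> {..<n}"
    and d: "F \<inter> F' = {}"
  shows "edge_arcs m F \<inter> edge_arcs m F' = {}"
proof -
  have False if e: "e \<in> edge_arcs m F" "e \<in> edge_arcs m F'" for e
  proof -
    obtain x i y j where e': "e = ((x, i), (y, j))" by (metis surj_pair)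
    have xy: "x < m" "y < m" using e(1) F(1) m by (auto simp: e' edge_arcs_def)
    show False
      using e d suc_mod_neq[OF m xy] suc_mod_neq[OF m xy(2,1)]
      unfolding e' edge_arcs_mem[OF m F(1) xy] edge_arcs_mem[OF m F(2) xy] by blast
  qed
  then show ?thesis by blast
qed

lemma card_edge_arcs:
  assumes m: "3 \<le> m" and F: "F \<subseteq> {..<m} \<times> {..<n} \<times> {..<n}"
  shows "card (edge_arcs m F) = 2 * card F"
proof -
  define a where "a = (\<lambda>(x, i, j). ((x, i), (Suc x mod m, j :: nat)) :: (nat \<times> nat) \<times> (nat \<times> nat))"
  define b where "b = (\<lambda>(x, i, j). ((Suc x mod m, j :: nat), (x, i)) :: (nat \<times> nat) \<times> (nat \<times> nat))"
  have fin: "finite F" using F by (rule finite_subset) simp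
  have eq: "edge_arcs m F = a ` F \<union> b ` F"
    by (force simp: edge_arcs_def a_def b_def)
  have dis: "a ` F \<inter> b ` F = {}"
  proof -
    have "a (x, i, j) \<noteq> b (x', i', j')" if "(x, i, j) \<in> F" "(x', i', j') \<in> F" for x i j x' i' j'
    proof
      assume "a (x, i, j) = b (x', i', j')"
      then have "x = Suc x' mod m" "x' = Suc x mod m" by (auto simp: a_def b_def)
      moreover have "x < m" "x' < m" using that F by auto
      ultimately show False using suc_mod_neq[OF m] by blast
    qed
    note ne = this
    show ?thesis
    proof (rule equals0I)
      fix e assume "e \<in> a ` F \<inter> b ` F"
      then obtain t t' where t: "t \<in> F" "t' \<in> F" "a t = b t'" by (metis Int_iff imageE)
      obtain x i j x' i' j' where "t = (x, i, j)" "t' = (x', i', j')" by (metis surj_pair)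
      then show False using ne t by simp
    qed
  qed
  have "inj_on a F" "inj_on b F" by (auto simp: inj_on_def a_def b_def)
  then show ?thesis unfolding eq using card_Un_disjoint[OF _ _ dis] fin by (simp add: card_image)
qed

lemma edge_arcs_mono: "F \<subseteq> F' \<Longrightarrow> edge_arcs m F \<subseteq> edge_arcs m F'"
  unfolding edge_arcs_def by blast

lemma finite_edge_arcs:
  assumes "finite F"
  shows "finite (edge_arcs m F)"
proof -
  have "edge_arcs m F = (\<lambda>(x, i, j). ((x, i), (Suc x mod m, j))) ` F \<union>
      (\<lambda>(x, i, j). ((Suc x mod m, j), (x, i))) ` F"
    by (force simp: edge_arcs_def)
  then show ?thesis using assms by simp
qed

lemma edge_arcs_inj:
  assumes m: "3 \<le> m" and F: "F \<subseteq> {..<m} \<times> {..<n} \<times> {..<n}" "F' \<subseteq> {..<m} \<times> {..<n} \<times> {..<n}"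
    and e: "edge_arcs m F = edge_arcs m F'"
  shows "F = F'"
proof -
  have "(x, i, j) \<in> F \<longleftrightarrow> (x, i, j) \<in> F'" if "x < m" for x i j
  proof -
    have y: "Suc x mod m < m" using m by simp
    have "((x, i), (Suc x mod m, j)) \<in> edge_arcs m F \<longleftrightarrow> ((x, i), (Suc x mod m, j)) \<in> edge_arcs m F'"
      using e by simp
    then show ?thesis
      unfolding edge_arcs_mem[OF m F(1) that y] edge_arcs_mem[OF m F(2) that y]
      using suc_mod_neq[OF m that y refl] by blast
  qed
  then show ?thesis using F by (force)
qed

text \<open>The triples of \<open>F\<close>, read in both directions, are the arcs of the underlying
  family of cycles, whence the cycle factor. The size \<open>m * n\<close> is half of the arc count,
  which avoids showing that different steps of the cycles give different triples.\<close>

lemma is_factor_props: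
  assumes m: "3 \<le> m" and k: "3 \<le> k" and F: "is_factor m n k F"
  shows "F \<subseteq> {..<m} \<times> {..<n} \<times> {..<n}" "card F = m * n"
    "cycle_factor k \<lparr>pverts = pverts (lex_cycle_graph m n), parcs = edge_arcs m F\<rparr> (lex_cycle_graph m n)"
proof -
  obtain C :: "nat set" and f where bij: "bij_betw (\<lambda>(c, p). f c p) (C \<times> {..<k}) ({..<m} \<times> {..<n})"
    and adj: "\<And>c p. c \<in> C \<Longrightarrow> p < k \<Longrightarrow> adjacent_layers m (fst (f c p)) (fst (f c (Suc p mod k)))"
    and F: "F = edge_system m n k C f"
    using F by (auto simp: is_factor_def)
  have inV: "f c p \<in> {..<m} \<times> {..<n}" if "c \<in> C" "p < k" for c p
    using bij that unfolding bij_betw_def by auto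
  have sk: "Suc p mod k < k" for p using k by simp
  show sub: "F \<subseteq> {..<m} \<times> {..<n} \<times> {..<n}"
  proof
    fix t assume "t \<in> F"
    then obtain x i j c p where t: "t = (x, i, j)" "x < m" "c \<in> C" "p < k"
        "f c p = (x, i) \<and> f c (Suc p mod k) = (Suc x mod m, j) \<or>
         f c (Suc p mod k) = (x, i) \<and> f c p = (Suc x mod m, j)"
      unfolding F edge_system_def by blast
    then show "t \<in> {..<m} \<times> {..<n} \<times> {..<n}"
      using inV[OF t(3,4)] inV[OF t(3) sk, of p] by auto
  qed
  have arcs: "edge_arcs m F = cycle_arcs k C f"
  proof
    show "edge_arcs m F \<subseteq> cycle_arcs k C f"
    proof
      fix e assume "e \<in> edge_arcs m F"
      then obtain x i j where xij: "(x, i, j) \<in> F"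
          "e = ((x, i), (Suc x mod m, j)) \<or> e = ((Suc x mod m, j), (x, i))"
        unfolding edge_arcs_def by blast
      then obtain c p where cp: "c \<in> C" "p < k"
          "f c p = (x, i) \<and> f c (Suc p mod k) = (Suc x mod m, j) \<or>
           f c (Suc p mod k) = (x, i) \<and> f c p = (Suc x mod m, j)"
        unfolding F edge_system_def by blast
      have "(f c p, f c (Suc p mod k)) \<in> cycle_arcs k C f" "(f c (Suc p mod k), f c p) \<in> cycle_arcs k C f"
        using cp(1,2) unfolding cycle_arcs_def by blast+
      then show "e \<in> cycle_arcs k C f" using cp(3) xij(2) by auto
    qed
    show "cycle_arcs k C f \<subseteq> edge_arcs m F"
    proof -
      have "(f c p, f c (Suc p mod k)) \<in> edge_arcs m F \<and> (f c (Suc p mod k), f c p) \<in> edge_arcs m F"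
        if cp: "c \<in> C" "p < k" for c p
      proof -
        have F_I: "(x, i, j) \<in> F" if "x < m" "f c p = (x, i) \<and> f c (Suc p mod k) = (Suc x mod m, j) \<or>
            f c (Suc p mod k) = (x, i) \<and> f c p = (Suc x mod m, j)" for x i j
          unfolding F edge_system_def using that cp by blast
        obtain x i y j where xy: "f c p = (x, i)" "f c (Suc p mod k) = (y, j)" by (meson surj_pair)
        have l: "x < m" "y < m" using inV[OF cp] inV[OF cp(1) sk, of p] xy by auto
        consider "y = Suc x mod m" | "x = Suc y mod m"
          using adj[OF cp] xy by (auto simp: adjacent_layers_def)
        then show ?thesis
        proof cases
          case 1
          then have "(x, i, j) \<in> F" using l xy by (intro F_I) simp_all
          then show ?thesis unfolding xy 1 edge_arcs_def by blast
        next
          case 2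
          then have "(y, j, i) \<in> F" using l xy by (intro F_I) simp_all
          then show ?thesis unfolding xy 2 edge_arcs_def by blast
        qed
      qed
      then show ?thesis unfolding cycle_arcs_def by blast
    qed
  qed
  have sub': "cycle_arcs k C f \<subseteq> parcs (lex_cycle_graph m n)"
    unfolding arcs[symmetric] lex_cycle_graph_arcs using sub by (rule edge_arcs_mono)
  have V: "pverts (lex_cycle_graph m n) = {..<m} \<times> {..<n}" by (simp add: lex_cycle_graph_def)
  have "wf_digraph (with_proj (lex_cycle_graph m n))"
    by unfold_locales (auto simp: lex_cycle_graph_def cycle_graph_def)
  then show cf: "cycle_factor k \<lparr>pverts = pverts (lex_cycle_graph m n), parcs = edge_arcs m F\<rparr> (lex_cycle_graph m n)"
    unfolding arcs using bij k sub' by (intro cycle_factor_cycle_arcs) (simp_all add: V)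
  show "card F = m * n"
    using cycle_factor_card_arcs[OF cf k] card_edge_arcs[OF m sub] by (simp add: V)
qed

text \<open>Adding one set of size \<open>c\<close> enlarges the union by at most \<open>c\<close>.
  A union of full size forces equality at every step, that is, disjointness; as \<open>0 < c\<close>
  the sets are nonempty, so this also excludes repetitions.\<close>

lemma cover_by_counting:
  assumes "\<And>F. F \<in> set Fs \<Longrightarrow> finite F \<and> card F = c" and "0 < c"
    and "card (\<Union>(set Fs)) = length Fs * c"
  shows "distinct Fs \<and> disjoint (set Fs)"
  using assms
proof (induction Fs)
  case Nil
  then show ?case by (simp add: disjoint_def)
next
  case (Cons F Fs)
  let ?U = "\<Union>(set Fs)"
  have finU: "finite ?U" and finF: "finite F" "card F = c" using Cons.prems(1) by auto
  have "card ?U \<le> (\<Sum>F\<in>set Fs. card F)" by (rule card_Union_le_sum_card)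
  also have "\<dots> = card (set Fs) * c" using Cons.prems(1) by simp
  also have "\<dots> \<le> length Fs * c" by (simp add: card_length)
  finally have le: "card ?U \<le> length Fs * c" .
  have "card F + card ?U = card (F \<union> ?U) + card (F \<inter> ?U)"
    by (rule card_Un_Int[OF finF(1) finU])
  then have "card ?U = length Fs * c" "card (F \<inter> ?U) = 0"
    using le Cons.prems(3) finF(2) by auto
  then have IH: "distinct Fs \<and> disjoint (set Fs)" and int: "F \<inter> ?U = {}"
    using Cons.IH Cons.prems(1,2) finF by auto
  have "F \<noteq> {}" using finF Cons.prems(2) by auto
  then have "F \<notin> set Fs" using int by auto
  then show ?case using IH int by (auto simp: disjoint_def)
qed

section \<open>Covering residues by factors\<close>

text \<open>The factors are not required to be disjoint: when they cover everything, disjointness follows by counting.\<close>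

definition gap_cover :: "nat \<Rightarrow> nat \<Rightarrow> (nat \<Rightarrow> int set) \<Rightarrow> nat \<Rightarrow> nat \<Rightarrow> bool" where
  "gap_cover m n D p q \<longleftrightarrow> (\<exists>Fs Gs. length Fs = p \<and> length Gs = q \<and>
     (\<forall>F\<in>set Fs. is_factor m n m F) \<and> (\<forall>F\<in>set Gs. is_factor m n n F) \<and>
     (\<forall>x<m. \<forall>i<n. \<forall>d\<in>D x. (x, i, nat ((int i + d) mod int n)) \<in> \<Union>(set Fs \<union> set Gs)))"

lemma gap_cover_imp_HWP:
  assumes m: "3 \<le> m" and n: "3 \<le> n" and gap_cover: "gap_cover m n D \<alpha> \<beta>" and sum: "\<alpha> + \<beta> = n"
    and all: "\<And>x d. x < m \<Longrightarrow> \<exists>e\<in>D x. e mod int n = d mod int n"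
  shows "(\<alpha>, \<beta>) \<in> HWP (lex_cycle_graph m n) m n"
proof -
  let ?T = "{..<m} \<times> {..<n} \<times> {..<n}"
  obtain Fs Gs where len: "length Fs = \<alpha>" "length Gs = \<beta>"
    and fac: "\<And>F. F \<in> set Fs \<Longrightarrow> is_factor m n m F" "\<And>F. F \<in> set Gs \<Longrightarrow> is_factor m n n F"
    and cov: "\<And>x i d. x < m \<Longrightarrow> i < n \<Longrightarrow> d \<in> D x \<Longrightarrow>
      (x, i, nat ((int i + d) mod int n)) \<in> \<Union>(set Fs \<union> set Gs)"
    using gap_cover unfolding gap_cover_def by blast
  let ?Hs = "Fs @ Gs"
  have H: "F \<subseteq> ?T" "card F = m * n" if "F \<in> set ?Hs" for F
  proof -
    have "is_factor m n m F \<or> is_factor m n n F" using that fac by auto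
    then show "F \<subseteq> ?T" "card F = m * n"
      using is_factor_props(1,2)[OF m m] is_factor_props(1,2)[OF m n] by blast+
  qed
  have "(x, i, j) \<in> \<Union>(set ?Hs)" if xij: "x < m" "i < n" "j < n" for x i j
  proof -
    obtain e where e: "e \<in> D x" "e mod int n = (int j - int i) mod int n"
      using all[OF xij(1)] by blast
    have "(int i + e) mod int n = (int i + (int j - int i)) mod int n"
      using e(2) by (metis mod_add_right_eq)
    then have "nat ((int i + e) mod int n) = j" using xij by simp
    then show ?thesis using cov[OF xij(1,2) e(1)] by simp
  qed
  then have "?T \<subseteq> \<Union>(set ?Hs)" by blast
  moreover have "\<Union>(set ?Hs) \<subseteq> ?T" using H(1) by blast
  ultimately have U: "\<Union>(set ?Hs) = ?T" by blast
  have "card (\<Union>(set ?Hs)) = length ?Hs * (m * n)"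
    unfolding U using len sum by (simp add: card_cartesian_product)
  moreover have "finite F \<and> card F = m * n" if "F \<in> set ?Hs" for F
    using H[OF that] by (auto intro: finite_subset)
  ultimately have dd: "distinct ?Hs \<and> disjoint (set ?Hs)"
    using m n by (intro cover_by_counting[of _ "m * n"]) auto
  have inj: "inj_on (edge_arcs m) (set ?Hs)"
    by (intro inj_onI edge_arcs_inj[OF m]) (use H(1) in auto)
  define A B where "A = edge_arcs m ` set Fs" and "B = edge_arcs m ` set Gs"
  have "card A = \<alpha>" "card B = \<beta>"
    using dd inj len by (auto simp: A_def B_def card_image inj_on_Un distinct_card)
  \<comment> \<open>Disjointness of the two families comes from distinctness of the concatenated
    list, hence it also holds for \<open>m = n\<close>, where both consist of factors of the same
    kind.\<close>
  moreover have "A \<inter> B = {}"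
    using dd inj by (auto simp: A_def B_def inj_on_def)
  moreover have "partition_on (parcs (lex_cycle_graph m n)) (A \<union> B)"
  proof (rule partition_onI)
    show "\<Union>(A \<union> B) = parcs (lex_cycle_graph m n)"
    proof -
      have "\<Union>(A \<union> B) = edge_arcs m (\<Union>(set ?Hs))"
        by (auto simp: A_def B_def edge_arcs_def)
      then show ?thesis unfolding U lex_cycle_graph_arcs .
    qed
    show "disjnt P Q" if PQ: "P \<in> A \<union> B" "Q \<in> A \<union> B" "P \<noteq> Q" for P Q
    proof -
      obtain F F' where F: "F \<in> set ?Hs" "F' \<in> set ?Hs" "P = edge_arcs m F" "Q = edge_arcs m F'"
        using PQ by (auto simp: A_def B_def)
      have "F \<noteq> F'" using PQ(3) F(3,4) by metis
      moreover have "disjoint (set ?Hs)" using dd by (rule conjunct2)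
      ultimately have "F \<inter> F' = {}" using F(1,2) by (intro disjointD)
      then show ?thesis
        using edge_arcs_disjoint[OF m H(1)[OF F(1)] H(1)[OF F(2)]] F by (simp add: disjnt_def)
    qed
    show "{} \<notin> A \<union> B"
    proof
      assume "{} \<in> A \<union> B"
      then obtain F where F: "F \<in> set ?Hs" "edge_arcs m F = {}" by (auto simp: A_def B_def)
      then have "card F = 0" using card_edge_arcs[OF m H(1)[OF F(1)]] by simp
      then show False using H(2)[OF F(1)] m n by simp
    qed
  qed
  ultimately have "is_HW (lex_cycle_graph m n) m n \<alpha> \<beta> A B"
    using fac is_factor_props(3)[OF m m] is_factor_props(3)[OF m n]
    by (auto simp: is_HW_def A_def B_def)
  then show ?thesis by (auto simp: HWP_def)
qed

lemma HWP_imp_sum: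
  assumes m: "3 \<le> m" and n: "3 \<le> n" and HW: "(\<alpha>, \<beta>) \<in> HWP (lex_cycle_graph m n) m n"
  shows "\<alpha> + \<beta> = n"
proof -
  let ?G = "lex_cycle_graph m n"
  obtain A B where AB: "partition_on (parcs ?G) (A \<union> B)" "A \<inter> B = {}" "finite A" "card A = \<alpha>"
      "finite B" "card B = \<beta>" "\<And>E. E \<in> A \<Longrightarrow> cycle_factor m \<lparr>pverts = pverts ?G, parcs = E\<rparr> ?G"
      "\<And>E. E \<in> B \<Longrightarrow> cycle_factor n \<lparr>pverts = pverts ?G, parcs = E\<rparr> ?G"
    using HW by (auto simp: HWP_def is_HW_def)
  have V: "card (pverts ?G) = m * n" by (simp add: lex_cycle_graph_def)
  have c: "card E = 2 * (m * n)" if "E \<in> A \<union> B" for E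
    using that cycle_factor_card_arcs[OF AB(7) m] cycle_factor_card_arcs[OF AB(8) n] V by auto
  have fin: "finite (parcs ?G)"
    unfolding lex_cycle_graph_arcs by (intro finite_edge_arcs) simp
  have "2 * (m * (n * n)) = card (parcs ?G)"
    unfolding lex_cycle_graph_arcs by (subst card_edge_arcs[OF m, of _ n]) auto
  also have "\<dots> = (\<Sum>E\<in>A \<union> B. card E)"
  proof -
    have "\<Union>(A \<union> B) = parcs ?G" "disjoint (A \<union> B)" using AB(1) by (auto simp: partition_on_def)
    moreover have "finite E" if "E \<in> A \<union> B" for E
      using that fin calculation(1) by (metis Union_upper finite_subset)
    ultimately show ?thesis using card_Union_disjoint[of "A \<union> B"] by (simp add: disjoint_def pairwise_def disjnt_def)
  qed
  also have "\<dots> = card (A \<union> B) * (2 * (m * n))" using c by simp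
  also have "card (A \<union> B) = \<alpha> + \<beta>" using AB by (simp add: card_Un_disjoint)
  finally have "(2 * m * n) * n = (2 * m * n) * (\<alpha> + \<beta>)" by (simp add: algebra_simps)
  then show ?thesis using m n by simp
qed

section \<open>Union, relabelling, translation and scaling of covers\<close>

lemma gap_cover_union:
  assumes "gap_cover m n D p q" "gap_cover m n D' p' q'"
  shows "gap_cover m n (\<lambda>x. D x \<union> D' x) (p + p') (q + q')"
proof -
  obtain Fs Gs where 1: "length Fs = p" "length Gs = q" "\<forall>F\<in>set Fs. is_factor m n m F"
      "\<forall>F\<in>set Gs. is_factor m n n F"
      "\<forall>x<m. \<forall>i<n. \<forall>d\<in>D x. (x, i, nat ((int i + d) mod int n)) \<in> \<Union>(set Fs \<union> set Gs)"
    using assms(1) unfolding gap_cover_def by blast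
  obtain Fs' Gs' where 2: "length Fs' = p'" "length Gs' = q'" "\<forall>F\<in>set Fs'. is_factor m n m F"
      "\<forall>F\<in>set Gs'. is_factor m n n F"
      "\<forall>x<m. \<forall>i<n. \<forall>d\<in>D' x. (x, i, nat ((int i + d) mod int n)) \<in> \<Union>(set Fs' \<union> set Gs')"
    using assms(2) unfolding gap_cover_def by blast
  have "\<forall>F\<in>set (Fs @ Fs'). is_factor m n m F" "\<forall>F\<in>set (Gs @ Gs'). is_factor m n n F"
    using 1(3,4) 2(3,4) by auto
  moreover have "\<forall>x<m. \<forall>i<n. \<forall>d\<in>D x \<union> D' x.
      (x, i, nat ((int i + d) mod int n)) \<in> \<Union>(set (Fs @ Fs') \<union> set (Gs @ Gs'))"
  proof (intro allI impI ballI)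
    fix x i d assume xi: "x < m" "i < n" and "d \<in> D x \<union> D' x"
    then consider "d \<in> D x" | "d \<in> D' x" by blast
    then show "(x, i, nat ((int i + d) mod int n)) \<in> \<Union>(set (Fs @ Fs') \<union> set (Gs @ Gs'))"
    proof cases
      case a: 1
      then have "(x, i, nat ((int i + d) mod int n)) \<in> \<Union>(set Fs \<union> set Gs)"
        using 1(5) xi by blast
      then show ?thesis by auto
    next
      case b: 2
      then have "(x, i, nat ((int i + d) mod int n)) \<in> \<Union>(set Fs' \<union> set Gs')"
        using 2(5) xi by blast
      then show ?thesis by auto
    qed
  qed
  ultimately show ?thesis
    unfolding gap_cover_def using 1(1,2) 2(1,2)
    by (intro exI[of _ "Fs @ Fs'"] exI[of _ "Gs @ Gs'"]) simp
qed

text \<open>Only residues modulo \<open>n\<close> matter, so the tilings below may use any integer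
  representatives.\<close>

lemma gap_cover_mono:
  assumes "gap_cover m n D p q" and "\<And>x d. x < m \<Longrightarrow> d \<in> D' x \<Longrightarrow> \<exists>e\<in>D x. e mod int n = d mod int n"
  shows "gap_cover m n D' p q"
proof -
  obtain Fs Gs where 1: "length Fs = p" "length Gs = q" "\<forall>F\<in>set Fs. is_factor m n m F"
      "\<forall>F\<in>set Gs. is_factor m n n F"
      "\<forall>x<m. \<forall>i<n. \<forall>d\<in>D x. (x, i, nat ((int i + d) mod int n)) \<in> \<Union>(set Fs \<union> set Gs)"
    using assms(1) unfolding gap_cover_def by blast
  have "(x, i, nat ((int i + d) mod int n)) \<in> \<Union>(set Fs \<union> set Gs)" if xid: "x < m" "i < n" "d \<in> D' x" for x i d
  proof -
    obtain e where e: "e \<in> D x" "e mod int n = d mod int n" using assms(2) xid by blast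
    then have "(int i + e) mod int n = (int i + d) mod int n" by (metis mod_add_right_eq)
    then show ?thesis using 1(5) xid e(1) by metis
  qed
  then show ?thesis unfolding gap_cover_def using 1(1-4) by blast
qed

text \<open>Consecutive layers are completely joined, so permuting the rows of each layer
  independently is an automorphism of \<open>C_m[n]\<close> that fixes the layers. It carries cycles
  to cycles of the same length.\<close>

lemma is_factor_relabel:
  assumes F: "is_factor m n k F" and \<sigma>: "\<And>x. x < m \<Longrightarrow> bij_betw (\<sigma> x) {..<n} {..<n}"
  shows "\<exists>F'. is_factor m n k F' \<and> (\<forall>x i j. (x, i, j) \<in> F \<longrightarrow> (x, \<sigma> x i, \<sigma> (Suc x mod m) j) \<in> F')"
proof -
  obtain C :: "nat set" and f where f: "bij_betw (\<lambda>(c, p). f c p) (C \<times> {..<k}) ({..<m} \<times> {..<n})"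
    and adj: "\<forall>c\<in>C. \<forall>p<k. adjacent_layers m (fst (f c p)) (fst (f c (Suc p mod k)))"
    and F: "F = edge_system m n k C f"
    using F unfolding is_factor_def by blast
  define g where "g = (\<lambda>(x, i). (x, \<sigma> x i))"
  have "bij_betw g ({..<m} \<times> {..<n}) ({..<m} \<times> {..<n})"
  proof (rule bij_betwI')
    fix u v assume uv: "u \<in> {..<m} \<times> {..<n}" "v \<in> {..<m} \<times> {..<n}"
    then show "g u = g v \<longleftrightarrow> u = v"
      using \<sigma> by (auto simp: g_def bij_betw_def inj_on_def)
    show "g u \<in> {..<m} \<times> {..<n}" using uv(1) \<sigma> by (auto simp: g_def bij_betw_def)
  next
    fix v assume v: "v \<in> {..<m} \<times> {..<n}"
    then have "snd v \<in> \<sigma> (fst v) ` {..<n}"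
      using \<sigma>[of "fst v"] unfolding bij_betw_def by (auto simp only: mem_Times_iff lessThan_iff)
    then obtain i where "i < n" "snd v = \<sigma> (fst v) i" by blast
    then show "\<exists>u\<in>{..<m} \<times> {..<n}. v = g u"
      using v by (intro bexI[of _ "(fst v, i)"]) (auto simp: g_def)
  qed
  then have "bij_betw (g \<circ> (\<lambda>(c, p). f c p)) (C \<times> {..<k}) ({..<m} \<times> {..<n})"
    using f by (rule bij_betw_trans[rotated])
  moreover have "g \<circ> (\<lambda>(c, p). f c p) = (\<lambda>(c, p). g (f c p))" by auto
  ultimately have bij: "bij_betw (\<lambda>(c, p). g (f c p)) (C \<times> {..<k}) ({..<m} \<times> {..<n})" by simp
  have "\<forall>c\<in>C. \<forall>p<k. adjacent_layers m (fst (g (f c p))) (fst (g (f c (Suc p mod k))))"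
    using adj by (simp add: g_def case_prod_beta)
  with bij have "is_factor m n k (edge_system m n k C (\<lambda>c p. g (f c p)))"
    unfolding is_factor_def by blast
  moreover have "(x, \<sigma> x i, \<sigma> (Suc x mod m) j) \<in> edge_system m n k C (\<lambda>c p. g (f c p))"
    if e: "(x, i, j) \<in> F" for x i j
  proof -
    obtain c p where cp: "x < m" "c \<in> C" "p < k" "f c p = (x, i) \<and> f c (Suc p mod k) = (Suc x mod m, j) \<or>
       f c (Suc p mod k) = (x, i) \<and> f c p = (Suc x mod m, j)"
      using e unfolding F edge_system_def by blast
    have "g (f c p) = (x, \<sigma> x i) \<and> g (f c (Suc p mod k)) = (Suc x mod m, \<sigma> (Suc x mod m) j) \<or>
       g (f c (Suc p mod k)) = (x, \<sigma> x i) \<and> g (f c p) = (Suc x mod m, \<sigma> (Suc x mod m) j)"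
      using cp(4) by (auto simp: g_def)
    then show ?thesis unfolding edge_system_def using cp(1-3) by blast
  qed
  ultimately show ?thesis by blast
qed

text \<open>The assumption \<open>cov\<close> pulls every required edge back to an edge of the given
  cover. Images are chosen factor by factor along the lists, so the numbers of factors do not
  change.\<close>

lemma gap_cover_relabel:
  assumes gap_cover: "gap_cover m n D p q" and \<sigma>: "\<And>x. x < m \<Longrightarrow> bij_betw (\<sigma> x) {..<n} {..<n}"
    and cov: "\<And>x i d. x < m \<Longrightarrow> i < n \<Longrightarrow> d \<in> D' x \<Longrightarrow> \<exists>j<n. \<exists>e\<in>D x. i = \<sigma> x j \<and>
      nat ((int i + d) mod int n) = \<sigma> (Suc x mod m) (nat ((int j + e) mod int n))"
  shows "gap_cover m n D' p q"
proof -
  obtain Fs Gs where 1: "length Fs = p" "length Gs = q" "\<And>F. F \<in> set Fs \<Longrightarrow> is_factor m n m F"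
      "\<And>F. F \<in> set Gs \<Longrightarrow> is_factor m n n F"
      "\<forall>x<m. \<forall>i<n. \<forall>d\<in>D x. (x, i, nat ((int i + d) mod int n)) \<in> \<Union>(set Fs \<union> set Gs)"
    using gap_cover unfolding gap_cover_def by blast
  define R where "R k F F' \<longleftrightarrow> is_factor m n k F' \<and>
      (\<forall>x i j. (x, i, j) \<in> F \<longrightarrow> (x, \<sigma> x i, \<sigma> (Suc x mod m) j) \<in> F')" for k F F'
  define r where "r k F = (SOME F'. R k F F')" for k F
  have r: "R k F (r k F)" if "is_factor m n k F" for k F
  proof -
    have "\<exists>F'. R k F F'" unfolding R_def by (rule is_factor_relabel[OF that \<sigma>])
    then show ?thesis unfolding r_def by (rule someI_ex)
  qed
  then have fac: "is_factor m n k (r k F)" if "is_factor m n k F" for k F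
    using that unfolding R_def by blast
  have "\<forall>F\<in>set (map (r m) Fs). is_factor m n m F" "\<forall>F\<in>set (map (r n) Gs). is_factor m n n F"
    by (simp_all add: 1(3,4) fac)
  moreover have "\<forall>x<m. \<forall>i<n. \<forall>d\<in>D' x.
      (x, i, nat ((int i + d) mod int n)) \<in> \<Union>(set (map (r m) Fs) \<union> set (map (r n) Gs))"
  proof (intro allI impI ballI)
    fix x i d assume *: "x < m" "i < n" "d \<in> D' x"
    then obtain j e where je: "j < n" "e \<in> D x" "i = \<sigma> x j"
        "nat ((int i + d) mod int n) = \<sigma> (Suc x mod m) (nat ((int j + e) mod int n))"
      using cov by blast
    have "(x, j, nat ((int j + e) mod int n)) \<in> \<Union>(set Fs \<union> set Gs)" using 1(5) * je(1,2) by blast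
    then obtain k F where F: "(x, j, nat ((int j + e) mod int n)) \<in> F" "is_factor m n k F"
        "r k F \<in> set (map (r m) Fs) \<union> set (map (r n) Gs)"
    proof -
      consider F where "F \<in> set Fs" "(x, j, nat ((int j + e) mod int n)) \<in> F"
        | F where "F \<in> set Gs" "(x, j, nat ((int j + e) mod int n)) \<in> F"
        using \<open>(x, j, nat ((int j + e) mod int n)) \<in> \<Union>(set Fs \<union> set Gs)\<close> by blast
      then show ?thesis
      proof cases
        case a: (1 F)
        then show ?thesis using that[of F m] 1(3) by simp
      next
        case b: (2 F)
        then show ?thesis using that[of F n] 1(4) by simp
      qed
    qed
    then have "(x, \<sigma> x j, \<sigma> (Suc x mod m) (nat ((int j + e) mod int n))) \<in> r k F"
      using r[OF F(2)] unfolding R_def by blast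
    then show "(x, i, nat ((int i + d) mod int n)) \<in> \<Union>(set (map (r m) Fs) \<union> set (map (r n) Gs))"
      unfolding je(3)[symmetric] je(4)[symmetric] using F(3) by blast
  qed
  ultimately show ?thesis
    unfolding gap_cover_def using 1(1,2)
    by (intro exI[of _ "map (r m) Fs"] exI[of _ "map (r n) Gs"]) simp
qed

lemma bij_betw_add_mod:
  assumes "0 < n"
  shows "bij_betw (\<lambda>i. nat ((int i + c) mod int n)) {..<n} {..<n}"
proof (rule bij_betw_byWitness[where f' = "\<lambda>i. nat ((int i - c) mod int n)"])
  show "\<forall>i\<in>{..<n}. nat ((int (nat ((int i + c) mod int n)) - c) mod int n) = i"
    using assms by (auto simp: mod_diff_left_eq)
  show "\<forall>i\<in>{..<n}. nat ((int (nat ((int i - c) mod int n)) + c) mod int n) = i"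
    using assms by (auto simp: mod_add_left_eq)
qed (use assms in \<open>auto simp: nat_less_iff\<close>)

text \<open>Translating the rows of layer \<open>x\<close> by the sum of \<open>c\<close> over the
  layers below \<open>x\<close> changes the residues in gap \<open>x\<close> by the difference of
  two consecutive partial sums, which is \<open>c x\<close>.\<close>

lemma gap_cover_shift:
  assumes n: "0 < n" and gap_cover: "gap_cover m n D p q" and c: "int n dvd (\<Sum>x<m. c x)"
  shows "gap_cover m n (\<lambda>x. (+) (c x) ` D x) p q"
proof (rule gap_cover_relabel[OF gap_cover, of "\<lambda>x i. nat ((int i + (\<Sum>y<x. c y)) mod int n)"])
  show "bij_betw (\<lambda>i. nat ((int i + (\<Sum>y<x. c y)) mod int n)) {..<n} {..<n}" for x
    using n by (rule bij_betw_add_mod)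
next
  fix x i d assume x: "x < m" and i: "i < n" and d: "d \<in> (+) (c x) ` D x"
  then obtain e where e: "e \<in> D x" "d = c x + e" by blast
  let ?s = "\<lambda>x. \<Sum>y<x. c y"
  define j where "j = nat ((int i - ?s x) mod int n)"
  have j: "j < n" "int j = (int i - ?s x) mod int n" using n by (auto simp: j_def nat_less_iff)
  have "(int j + ?s x) mod int n = int i" unfolding j(2) using i by (simp add: mod_add_left_eq)
  moreover have "(int i + d) mod int n = ((int j + e) mod int n + ?s (Suc x mod m)) mod int n"
  proof -
    \<comment> \<open>Only the last gap, which leads back to layer 0 with its empty partial sum,
      uses the vanishing of the total sum modulo \<open>n\<close>.\<close>
    have "?s (Suc x mod m) mod int n = ?s (Suc x) mod int n"
    proof (cases "Suc x = m")
      case True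
      then show ?thesis using c by (auto simp: dvd_eq_mod_eq_0)
    qed (use x in simp)
    then have "((int j + e) mod int n + ?s (Suc x mod m)) mod int n = (int j + e + ?s (Suc x)) mod int n"
      by (metis mod_add_eq mod_mod_trivial)
    also have "\<dots> = (int i - ?s x + (e + ?s (Suc x))) mod int n"
      unfolding j(2) by (simp add: mod_add_left_eq add.assoc)
    also have "int i - ?s x + (e + ?s (Suc x)) = int i + d" by (simp add: e)
    finally show ?thesis by simp
  qed
  ultimately show "\<exists>j<n. \<exists>e\<in>D x. i = nat ((int j + ?s x) mod int n) \<and> nat ((int i + d) mod int n) =
      nat ((int (nat ((int j + e) mod int n)) + ?s (Suc x mod m)) mod int n)"
    using j(1) e(1) n by (intro exI[of _ j] conjI bexI[of _ e]) simp_all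
qed

lemma bij_betw_mult_mod:
  assumes n: "0 < n" and u: "coprime u (int n)"
  shows "bij_betw (\<lambda>i. nat ((u * int i) mod int n)) {..<n} {..<n}"
proof -
  have "inj_on (\<lambda>i. nat ((u * int i) mod int n)) {..<n}"
  proof (rule inj_onI)
    fix i j assume ij: "i \<in> {..<n}" "j \<in> {..<n}"
      and "nat ((u * int i) mod int n) = nat ((u * int j) mod int n)"
    then have "(u * int i) mod int n = (u * int j) mod int n"
      using n by (metis eq_nat_nat_iff pos_mod_sign of_nat_0_less_iff)
    then have "int n dvd u * (int i - int j)"
      by (simp add: mod_eq_dvd_iff right_diff_distrib)
    then have "int n dvd int i - int j"
      using u by (simp add: coprime_commute coprime_dvd_mult_right_iff)
    then have "int i mod int n = int j mod int n" by (simp add: mod_eq_dvd_iff)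
    then show "i = j" using ij by simp
  qed
  moreover have "(\<lambda>i. nat ((u * int i) mod int n)) ` {..<n} \<subseteq> {..<n}"
    using n by (auto simp: nat_less_iff)
  ultimately show ?thesis by (simp add: bij_betw_def endo_inj_surj)
qed

text \<open>Multiplying the rows of all layers by the same unit multiplies all residues by it. The
  unit 2 turns the block \<open>-2, ..., 2\<close> into the even numbers from -4 to 4, which serve
  the case \<alpha> = 0.\<close>

lemma gap_cover_scale:
  assumes n: "0 < n" and gap_cover: "gap_cover m n D p q" and u: "coprime u (int n)"
  shows "gap_cover m n (\<lambda>x. times u ` D x) p q"
proof (rule gap_cover_relabel[OF gap_cover, of "\<lambda>_ i. nat ((u * int i) mod int n)"])
  show "bij_betw (\<lambda>i. nat ((u * int i) mod int n)) {..<n} {..<n}"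
    by (rule bij_betw_mult_mod[OF n u])
next
  fix x i d assume i: "i < n" and "d \<in> times u ` D x"
  then obtain e where e: "e \<in> D x" "d = u * e" by blast
  obtain j where j: "j < n" "i = nat ((u * int j) mod int n)"
  proof -
    have "i \<in> (\<lambda>j. nat ((u * int j) mod int n)) ` {..<n}"
      using bij_betw_imp_surj_on[OF bij_betw_mult_mod[OF n u]] i by simp
    then show ?thesis using that by blast
  qed
  have "int i = (u * int j) mod int n" using n j(2) by simp
  then have "(int i + d) mod int n = (u * int j + u * e) mod int n"
    by (simp only: e(2) mod_add_left_eq)
  also have "\<dots> = (u * ((int j + e) mod int n)) mod int n"
    by (simp only: mod_mult_right_eq distrib_left)
  finally have "(int i + d) mod int n = (u * ((int j + e) mod int n)) mod int n" .
  then show "\<exists>j<n. \<exists>e\<in>D x. i = nat ((u * int j) mod int n) \<and>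
      nat ((int i + d) mod int n) = nat ((u * int (nat ((int j + e) mod int n))) mod int n)"
    using j(1) j(2)[symmetric] e(1) n by (intro exI[of _ j] conjI bexI[of _ e]) simp_all
qed

section \<open>Constant-row cycles and rotated Hamilton cycles\<close>

lemma gap_cover_zero:
  assumes "0 < n" "0 < m"
  shows "gap_cover m n (\<lambda>_. {0}) 1 0"
proof -
  let ?f = "\<lambda>c p. (p, c)"
  have "bij_betw (\<lambda>(c, p). ?f c p) ({..<n} \<times> {..<m}) ({..<m} \<times> {..<n})"
    by (rule bij_betwI[where g = "\<lambda>(x, i). (i, x)"]) auto
  then have "is_factor m n m (edge_system m n m {..<n} ?f)"
    unfolding is_factor_def by (intro exI[of _ "{..<n}"] exI[of _ ?f]) (auto simp: adjacent_layers_def)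
  moreover have "(x, i, nat ((int i + 0) mod int n)) \<in> edge_system m n m {..<n} ?f" if "x < m" "i < n" for x i
    using that unfolding edge_system_def by auto
  ultimately show ?thesis
    unfolding gap_cover_def by (intro exI[of _ "[edge_system m n m {..<n} ?f]"] exI[of _ "[]"]) simp
qed

text \<open>Row \<open>h p\<close> is visited in a layer shifted by \<open>s p\<close>; the \<open>m\<close> cycles are the rotations of one.\<close>

lemma static_factor:
  assumes m: "0 < m" and h: "bij_betw h {..<n} {..<n}" and s0: "s 0 = (0::int)"
    and s1: "\<And>p. p < n \<Longrightarrow> s (Suc p) = s p + 1 \<or> s (Suc p) = s p - 1" and sn: "int m dvd s n"
  shows "\<exists>F. is_factor m n n F \<and> (\<forall>x<m. \<forall>p<n.
    if s (Suc p) = s p + 1 then (x, h p, h (Suc p mod n)) \<in> F else (x, h (Suc p mod n), h p) \<in> F)"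
proof -
  define f where "f c p = (nat ((int c + s p) mod int m), h p)" for c p :: nat
  have layer: "int (nat (a mod int m)) = a mod int m" for a using m by simp
  have bij: "bij_betw (\<lambda>(c, p). f c p) ({..<m} \<times> {..<n}) ({..<m} \<times> {..<n})"
  proof -
    have "bij_betw (\<lambda>c. nat ((int c + s p) mod int m)) {..<m} {..<m}" for p
      by (rule bij_betw_add_mod[OF m])
    then have 1: "inj_on (\<lambda>c. nat ((int c + s p) mod int m)) {..<m}" for p by (simp add: bij_betw_def)
    have "inj_on (\<lambda>(c, p). f c p) ({..<m} \<times> {..<n})"
    proof (rule inj_onI)
      fix a b assume ab: "a \<in> {..<m} \<times> {..<n}" "b \<in> {..<m} \<times> {..<n}"
        and "(case a of (c, p) \<Rightarrow> f c p) = (case b of (c, p) \<Rightarrow> f c p)"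
      then have e: "h (snd a) = h (snd b)"
          "nat ((int (fst a) + s (snd a)) mod int m) = nat ((int (fst b) + s (snd b)) mod int m)"
        by (auto simp: f_def case_prod_beta)
      have "snd a = snd b" using e(1) h ab by (auto simp: bij_betw_def inj_on_def)
      moreover from this have "fst a = fst b" using inj_onD[OF 1 e(2)[unfolded \<open>snd a = snd b\<close>]] ab by auto
      ultimately show "a = b" by (simp add: prod_eq_iff)
    qed
    moreover have "(\<lambda>(c, p). f c p) ` ({..<m} \<times> {..<n}) \<subseteq> {..<m} \<times> {..<n}"
      using m h by (auto simp: f_def nat_less_iff bij_betw_def)
    ultimately show ?thesis by (simp add: bij_betw_def endo_inj_surj)
  qed
  \<comment> \<open>The last step returns to position 0; the layers match there because
    \<open>s n\<close> and \<open>s 0\<close> agree modulo \<open>m\<close>.\<close>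
  have smod: "s (Suc p mod n) mod int m = s (Suc p) mod int m" if "p < n" for p
  proof (cases "Suc p = n")
    case True
    then show ?thesis using sn s0 by (auto simp: dvd_eq_mod_eq_0)
  qed (use that in simp)
  have nxt: "fst (f c (Suc p mod n)) = nat ((int c + s (Suc p)) mod int m)" if "p < n" for c p
    unfolding f_def using smod[OF that] by (metis fst_conv mod_add_right_eq)
  have sucm: "Suc (nat (a mod int m)) mod m = nat ((a + 1) mod int m)" for a
  proof -
    have "int (Suc (nat (a mod int m))) = a mod int m + 1" using layer by simp
    then have "int (Suc (nat (a mod int m)) mod m) = (a + 1) mod int m"
      by (simp only: zmod_int mod_add_left_eq)
    then show ?thesis by (metis nat_int)
  qed
  have adj: "adjacent_layers m (fst (f c p)) (fst (f c (Suc p mod n)))" if "p < n" for c p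
  proof (cases "s (Suc p) = s p + 1")
    case True
    have "Suc (fst (f c p)) mod m = nat ((int c + s (Suc p)) mod int m)"
      using sucm[of "int c + s p"] by (simp add: f_def True add.assoc)
    then show ?thesis unfolding nxt[OF that] adjacent_layers_def by simp
  next
    case False
    then have "s p = s (Suc p) + 1" using s1[OF that] by linarith
    then have "Suc (nat ((int c + s (Suc p)) mod int m)) mod m = fst (f c p)"
      using sucm[of "int c + s (Suc p)"] by (simp add: f_def add.assoc)
    then show ?thesis unfolding nxt[OF that] adjacent_layers_def by simp
  qed
  have "is_factor m n n (edge_system m n n {..<m} f)"
    unfolding is_factor_def using bij adj by (intro exI[of _ "{..<m}"] exI[of _ f]) simp
  moreover have "if s (Suc p) = s p + 1 then (x, h p, h (Suc p mod n)) \<in> edge_system m n n {..<m} f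
      else (x, h (Suc p mod n), h p) \<in> edge_system m n n {..<m} f" if xp: "x < m" "p < n" for x p
  proof -
    \<comment> \<open>At a fixed position the \<open>m\<close> rotations occupy every layer once, so
      each step of the row cycle occurs in every gap, with the direction prescribed by
      \<open>s\<close>.\<close>
    have ex: "\<exists>c\<in>{..<m}. nat ((int c + a) mod int m) = x" for a
    proof (rule bexI[of _ "nat ((int x - a) mod int m)"])
      show "nat ((int (nat ((int x - a) mod int m)) + a) mod int m) = x"
        using xp by (simp add: layer mod_add_left_eq)
    qed (use m in \<open>simp add: nat_less_iff\<close>)
    show ?thesis
    proof (cases "s (Suc p) = s p + 1")
      case True
      obtain c where c: "c \<in> {..<m}" "nat ((int c + s p) mod int m) = x" using ex by blast
      have "f c p = (x, h p)" using c by (simp add: f_def)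
      moreover have "f c (Suc p mod n) = (Suc x mod m, h (Suc p mod n))"
        using nxt[OF xp(2), of c] True c(2) sucm[of "int c + s p"]
        by (auto simp: prod_eq_iff algebra_simps) (simp add: f_def)
      ultimately show ?thesis using True c(1) xp unfolding edge_system_def by auto
    next
      case False
      then have s: "s (Suc p) = s p - 1" using s1[OF xp(2)] by blast
      obtain c where c: "c \<in> {..<m}" "nat ((int c + s (Suc p)) mod int m) = x" using ex by blast
      have "f c (Suc p mod n) = (x, h (Suc p mod n))"
        using nxt[OF xp(2), of c] c by (auto simp: prod_eq_iff) (simp add: f_def)
      moreover have "f c p = (Suc x mod m, h p)"
        using c(2) sucm[of "int c + s (Suc p)"] s by (simp add: f_def algebra_simps)
      ultimately show ?thesis using False c(1) xp unfolding edge_system_def by auto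
    qed
  qed
  ultimately show ?thesis by blast
qed

text \<open>Of the \<open>n = m + 2 * t\<close> steps, \<open>m + t\<close> go up and
  \<open>t\<close> go down, with net climb \<open>m\<close>. Negating the heights reverses every
  step, so each edge of the row cycle is used upwards in one factor and downwards in the
  other.\<close>

lemma hamilton_two_factors:
  assumes m: "0 < m" and n: "n = m + 2 * t" and h: "bij_betw h {..<n} {..<n}"
  shows "\<exists>F F'. is_factor m n n F \<and> is_factor m n n F' \<and> (\<forall>x<m. \<forall>p<n.
    (x, h p, h (Suc p mod n)) \<in> F \<union> F' \<and> (x, h (Suc p mod n), h p) \<in> F \<union> F')"
proof -
  define s where "s p = (if p \<le> m + t then int p else 2 * int (m + t) - int p)" for p
  have s1: "s (Suc p) = s p + 1 \<or> s (Suc p) = s p - 1" for p by (auto simp: s_def)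
  have s0: "s 0 = 0" by (simp add: s_def)
  have sn: "s n = int m" by (auto simp: s_def n)
  have "int m dvd s n" by (simp add: sn)
  then obtain F where F: "is_factor m n n F" "\<forall>x<m. \<forall>p<n.
      if s (Suc p) = s p + 1 then (x, h p, h (Suc p mod n)) \<in> F else (x, h (Suc p mod n), h p) \<in> F"
    using static_factor[where s = s, OF m h s0 s1] by blast
  have s1': "- s (Suc p) = - s p + 1 \<or> - s (Suc p) = - s p - 1" for p using s1[of p] by linarith
  have "- s 0 = 0" "int m dvd - s n" by (simp_all add: s0 sn)
  then obtain F' where F': "is_factor m n n F'" "\<forall>x<m. \<forall>p<n.
      if - s (Suc p) = - s p + 1 then (x, h p, h (Suc p mod n)) \<in> F' else (x, h (Suc p mod n), h p) \<in> F'"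
    using static_factor[where s = "\<lambda>p. - s p", OF m h _ s1'] by blast
  have "(x, h p, h (Suc p mod n)) \<in> F \<union> F' \<and> (x, h (Suc p mod n), h p) \<in> F \<union> F'" if "x < m" "p < n" for x p
  proof (cases "s (Suc p) = s p + 1")
    case True
    then have "\<not> - s (Suc p) = - s p + 1" by linarith
    then show ?thesis using F(2) F'(2) that True by auto
  next
    case False
    then have "- s (Suc p) = - s p + 1" using s1[of p] by linarith
    then show ?thesis using F(2) F'(2) that False by auto
  qed
  then show ?thesis using F(1) F'(1) by blast
qed

text \<open>The row cycle consists of the successive multiples of \<open>g\<close>. Each of its
  steps contributes residue \<open>g\<close> when taken upwards and \<open>- g\<close> when taken
  downwards.\<close>

lemma gap_cover_pair:
  assumes m: "0 < m" and n: "n = m + 2 * t" and g: "coprime g (int n)"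
  shows "gap_cover m n (\<lambda>_. {g, - g}) 0 2"
proof -
  define h where "h p = nat ((g * int p) mod int n)" for p
  have n0: "0 < n" using m n by simp
  have h: "bij_betw h {..<n} {..<n}" unfolding h_def by (rule bij_betw_mult_mod[OF n0 g])
  obtain F F' where F: "is_factor m n n F" "is_factor m n n F'" "\<And>x p. x < m \<Longrightarrow> p < n \<Longrightarrow>
      (x, h p, h (Suc p mod n)) \<in> F \<union> F' \<and> (x, h (Suc p mod n), h p) \<in> F \<union> F'"
    using hamilton_two_factors[OF m n h] by blast
  have hi: "int (h p) = (g * int p) mod int n" for p using n0 by (simp add: h_def)
  have step: "h (Suc p mod n) = nat ((int (h p) + g) mod int n)" for p
  proof -
    have "int (h (Suc p mod n)) = (g * int (Suc p)) mod int n"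
      by (simp add: hi zmod_int mod_mult_right_eq)
    also have "g * int (Suc p) = g * int p + g" by (simp add: algebra_simps)
    also have "(g * int p + g) mod int n = (int (h p) + g) mod int n"
      by (simp only: hi mod_add_left_eq)
    finally show ?thesis by (metis nat_int)
  qed
  have "(x, i, nat ((int i + d) mod int n)) \<in> F \<union> F'" if xi: "x < m" "i < n" and d: "d = g \<or> d = - g" for x i d
  proof -
    have surj: "\<exists>p<n. h p = i" if "i < n" for i
      using h that unfolding bij_betw_def by (metis imageE lessThan_iff)
    show ?thesis
    proof (cases "d = g")
      case True
      obtain p where "p < n" "h p = i" using surj xi by blast
      then show ?thesis using F(3)[OF xi(1), of p] step[of p] True by simp
    next
      case False
      obtain p where p: "p < n" "h p = nat ((int i - g) mod int n)"
        using surj[of "nat ((int i - g) mod int n)"] n0 by (auto simp: nat_less_iff)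
      have "h (Suc p mod n) = i" unfolding step using p(2) n0 xi by (simp add: mod_add_left_eq)
      then show ?thesis using F(3)[OF xi(1) p(1)] p(2) False d by simp
    qed
  qed
  then show ?thesis
    unfolding gap_cover_def using F(1,2) by (intro exI[of _ "[]"] exI[of _ "[F, F']"]) auto
qed

section \<open>Five factors for the residues -2, ..., 2\<close>

text \<open>The edges of residues \<open>0\<close>, \<open>1\<close>, \<open>2\<close>, modified on the rows \<open>a \<ge> m\<close> in such a way that the unmodified
  rows carry cycles of length \<open>m\<close> which can be extended to length \<open>n\<close>.\<close>

definition letter_edge :: "nat \<Rightarrow> nat \<Rightarrow> nat \<Rightarrow> nat \<Rightarrow> nat \<times> nat" where
  "letter_edge m n l a =
    (if l = 0 then (if m \<le> a \<and> odd a then (a + 1, a - 1) else (a, a))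
     else if l = 1 then (if m \<le> a \<and> odd a then (a, a - 1) else ((a + n - 1) mod n, a))
     else (if m \<le> a \<and> even a then (a - 1, a - 1) else ((a + n - 2) mod n, a)))"

lemma sub_mod_cases:
  fixes a d n :: nat
  assumes "d \<le> a" "a < n"
  shows "(a + n - d) mod n = a - d"
proof -
  have "(a + n - d) mod n = ((a - d) + n) mod n" using assms by simp
  also have "\<dots> = (a - d) mod n" by (rule mod_add_self2)
  also have "\<dots> = a - d" using assms by (intro mod_less) arith
  finally show ?thesis .
qed

text \<open>The exchanges concern only edges with second row at least \<open>m\<close>. Below that a
  letter is an ordinary residue, and the parts of the cycles before and after the crossing need no
  change.\<close>

lemma letter_edge_plain:
  assumes "i + l < m" "l \<le> 2" "m \<le> n"
  shows "(i, i + l) \<in> letter_edge m n l ` {..<n}"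
proof (rule image_eqI[of _ _ "i + l"])
  consider "l = 0" | "l = 1" | "l = 2" using assms(2) by linarith
  then show "(i, i + l) = letter_edge m n l (i + l)"
    using assms sub_mod_cases[of l "i + l" n] by cases (auto simp: letter_edge_def)
qed (use assms in simp)

text \<open>These edges bring a cycle back to the small rows. For \<open>n = m\<close> such an edge
  is the crossing itself; for larger \<open>n\<close> it ends the detour, leaving row
  \<open>n - 1\<close> here and row \<open>n - 2\<close> in the next lemma.\<close>

lemma letter_edge_wrap:
  assumes "3 \<le> m" "m \<le> n" "l = 1 \<or> l = 2"
  shows "(n - 1, l - 1) \<in> letter_edge m n l ` {..<n}"
  using assms by (intro image_eqI[of _ _ "l - 1"]) (auto simp: letter_edge_def)

lemma letter_edge_wrap2:
  assumes "3 \<le> m" "m \<le> n"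
  shows "(n - 2, 0) \<in> letter_edge m n 2 ` {..<n}"
  using assms by (intro image_eqI[of _ _ 0]) (auto simp: letter_edge_def)

text \<open>Following the residues \<open>w 0, \<dots>, w (m - 1)\<close>, of sum \<open>m\<close>, around \<open>\<int>\<^sub>m\<close> in both coordinates gives
  cycles of length \<open>m\<close>, each of which exceeds row \<open>m - 1\<close> exactly once, at step \<open>c j\<close>. That crossing edge is
  replaced by a path through \<open>2 * t\<close> vertices in the rows from \<open>m\<close> on.\<close>

lemma word_factor:
  assumes m: "odd m" "3 \<le> m" and n: "n = m + 2 * t"
    and w2: "\<And>x. x < m \<Longrightarrow> w x \<le> 2"
    and w20: "\<And>x. x < m \<Longrightarrow> w x = 2 \<longleftrightarrow> w (Suc x mod m) = 0"
    and sum: "(\<Sum>x<m. w x) = m"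
  shows "\<exists>F. is_factor m n n F \<and> (\<forall>x<m. \<forall>a<n. \<forall>i j. letter_edge m n (w x) a = (i, j) \<longrightarrow> (x, i, j) \<in> F)"
proof -
  define W where "W x = (\<Sum>y<x. w y)" for x
  define c where "c j = (LEAST x. m \<le> j + W (Suc x))" for j
  define prv where "prv x = (x + m - 1) mod m" for x
  \<comment> \<open>Cycle \<open>j\<close> starts in layer 0 and row \<open>j\<close>. A crossing
    from row \<open>m - 1\<close> is replaced by a zigzag between the layers
    \<open>prv (c j)\<close> and \<open>c j\<close>, a crossing from row \<open>m - 2\<close> by one
    between \<open>c j\<close> and the next layer. Each round of two steps moves up two rows;
    afterwards the original cycle is resumed with positions delayed by \<open>2 * t\<close>.\<close>
  define f where "f j p =
    (if p \<le> c j then (p, j + W p)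
     else if p \<le> c j + 2 * t then
       (let q = p - Suc (c j); r = q div 2 in
        if j + W (c j) = m - 1
        then if even q then (prv (c j), if w (prv (c j)) = 1 then m + 2 * r else m + 2 * r + 1)
             else (c j, m + 2 * r + 1)
        else if even q then (Suc (c j) mod m, m + 2 * r) else (c j, m + 2 * r))
     else ((p - 2 * t) mod m, j + W (p - 2 * t) - m))" for j p
  have W0: "W 0 = 0" and WS: "W (Suc x) = W x + w x" for x by (simp_all add: W_def)
  have Wmono: "W x \<le> W y" if "x \<le> y" for x y
    unfolding W_def using that by (intro sum_mono2) auto
  have Wm: "W m = m" using sum by (simp add: W_def)
  have Wle: "W x \<le> m" if "x \<le> m" for x using Wmono[OF that] Wm by simp
  have mn: "m \<le> n" by (simp add: n)
  have prv: "prv x < m" "Suc (prv x) mod m = x" if "x < m" for x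
    using that m by (cases x; simp add: prv_def)+
  have prvS: "prv (Suc x mod m) = x" if "x < m" for x
    using that m by (cases "Suc x = m") (simp_all add: prv_def)
  have cI: "c j = x" if "j + W x < m" "m \<le> j + W (Suc x)" for j x
    unfolding c_def
  proof (rule Least_equality)
    show "m \<le> j + W (Suc x)" by (rule that(2))
    fix y assume "m \<le> j + W (Suc y)"
    then show "x \<le> y" using Wmono[of "Suc y" x] that(1) by (cases "Suc y \<le> x") auto
  qed
  have c: "c j < m" "j + W (c j) < m" "m \<le> j + W (c j) + w (c j)" if "j < m" for j
  proof -
    have ex: "m \<le> j + W (Suc (m - 1))" using Wm m by simp
    then have "c j \<le> m - 1" unfolding c_def by (rule Least_le)
    then show "c j < m" using m by simp
    have "m \<le> j + W (Suc (c j))" unfolding c_def by (rule LeastI[of "\<lambda>x. m \<le> j + W (Suc x)", OF ex])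
    then show "m \<le> j + W (c j) + w (c j)" by (simp add: WS)
    show "j + W (c j) < m"
    proof (cases "c j")
      case 0
      then show ?thesis using that W0 by simp
    next
      case (Suc y)
      then have "\<not> m \<le> j + W (Suc y)" using not_less_Least[of y "\<lambda>x. m \<le> j + W (Suc x)"] by (simp add: c_def)
      then show ?thesis using Suc by simp
    qed
  qed
  \<comment> \<open>Letters are at most 2, so a crossing starts in row \<open>m - 1\<close> or
    \<open>m - 2\<close>, and from \<open>m - 2\<close> only the letter 2 reaches
    \<open>m\<close>.\<close>
  have cross: "j + W (c j) = m - 1 \<and> (w (c j) = 1 \<or> w (c j) = 2) \<or> j + W (c j) = m - 2 \<and> w (c j) = 2"
    if "j < m" for j
    using c[OF that] w2[OF c(1)[OF that]] m by arith
  \<comment> \<open>A letter 2 is always followed by 0. Hence the letter before a nonzero one is 0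
    or 1, and its value selects the row used in layer \<open>prv (c j)\<close> of the
    zigzag.\<close>
  have prvw: "w (prv x) \<noteq> 2" "w (prv x) \<le> 2" if "x < m" "w x \<noteq> 0" for x
    using w20[OF prv(1)[OF that(1)]] prv(2)[OF that(1)] that(2) w2[OF prv(1)[OF that(1)]] by auto
  have pre: "f j p = (p, j + W p)" if "p \<le> c j" for j p using that by (simp add: f_def)
  have post: "f j p = ((p - 2 * t) mod m, j + W (p - 2 * t) - m)" if "c j + 2 * t < p" for j p
    using that by (simp add: f_def)
  have inner: "f j (Suc (c j) + (2 * r + b)) =
      (if j + W (c j) = m - 1
        then if b = 0 then (prv (c j), if w (prv (c j)) = 1 then m + 2 * r else m + 2 * r + 1)
             else (c j, m + 2 * r + 1)
        else if b = 0 then (Suc (c j) mod m, m + 2 * r) else (c j, m + 2 * r))"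
    if "r < t" "b = 0 \<or> b = 1" for j r b
    using that by (auto simp: f_def Let_def)
  have wrap: "f j (Suc p mod n) = f j (Suc p)" if "j < m" "p < n" for j p
  proof (cases "Suc p = n")
    case True
    then have "c j + 2 * t < Suc p" using c(1)[OF that(1)] n by simp
    then show ?thesis using True post[of j "Suc p"] pre[of 0 j] Wm W0 by (simp add: n)
  qed (use that in simp)
  \<comment> \<open>Each step, read upwards, is one of the letter edges prescribed for its gap. Only
    this inclusion is proved step by step.\<close>
  have link: "fst (f j (Suc p)) = Suc (fst (f j p)) mod m \<and>
        (snd (f j p), snd (f j (Suc p))) \<in> letter_edge m n (w (fst (f j p))) ` {..<n} \<or>
      fst (f j p) = Suc (fst (f j (Suc p))) mod m \<and>
        (snd (f j (Suc p)), snd (f j p)) \<in> letter_edge m n (w (fst (f j (Suc p)))) ` {..<n}"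
    (is "?fwd p \<or> ?bwd p") if j: "j < m" and p: "p < n" for j p
  proof -
    note cj = c[OF j] and cr = cross[OF j]
    let ?x = "c j"
    have last: "f j (Suc (?x + 2 * t)) = (Suc ?x mod m, j + W ?x + w ?x - m)"
      using post[of j "Suc (?x + 2 * t)"] by (simp add: WS)
    consider (a) "p < ?x" | (b) "p = ?x" "t = 0" | (c) "p = ?x" "0 < t"
      | (d) r where "r < t" "p = Suc ?x + (2 * r + 0)"
      | (e) r where "Suc r < t" "p = Suc ?x + (2 * r + 1)"
      | (f) r where "Suc r = t" "p = Suc ?x + (2 * r + 1)"
      | (g) "?x + 2 * t < p"
    proof -
      assume H: "p < ?x \<Longrightarrow> thesis" "p = ?x \<Longrightarrow> t = 0 \<Longrightarrow> thesis" "p = ?x \<Longrightarrow> 0 < t \<Longrightarrow> thesis"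
        "\<And>r. r < t \<Longrightarrow> p = Suc ?x + (2 * r + 0) \<Longrightarrow> thesis"
        "\<And>r. Suc r < t \<Longrightarrow> p = Suc ?x + (2 * r + 1) \<Longrightarrow> thesis"
        "\<And>r. Suc r = t \<Longrightarrow> p = Suc ?x + (2 * r + 1) \<Longrightarrow> thesis"
        "?x + 2 * t < p \<Longrightarrow> thesis"
      show thesis
      proof (cases "?x < p \<and> p \<le> ?x + 2 * t")
        case True
        define q where "q = p - Suc ?x"
        have q: "p = Suc ?x + q" "q < 2 * t" using True by (auto simp: q_def)
        show thesis
        proof (cases "even q")
          case True
          then show thesis using q H(4)[of "q div 2"] by auto
        next
          case False
          then have "q = 2 * (q div 2) + 1" by presburger
          then show thesis using q H(5)[of "q div 2"] H(6)[of "q div 2"] by (cases "Suc (q div 2) = t") auto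
        qed
      next
        case False
        then show thesis using H(1-3,7) by linarith
      qed
    qed
    then show ?thesis
    proof cases
      case a
      have "j + W (Suc p) < m" using a cj(2) Wmono[of "Suc p" ?x] by simp
      then have "(j + W p, j + W p + w p) \<in> letter_edge m n (w p) ` {..<n}"
        using a cj(1) w2[of p] mn by (intro letter_edge_plain) (simp_all add: WS)
      then show ?thesis using a cj(1) pre[of p j] pre[of "Suc p" j] by (simp add: WS add.assoc)
    next
      case b
      then have "(j + W ?x, j + W ?x + w ?x - m) \<in> letter_edge m n (w ?x) ` {..<n}"
        using cr letter_edge_wrap[OF m(2) mn, of "w ?x"] letter_edge_wrap2[OF m(2) mn] m by (auto simp: n)
      then show ?thesis using b last pre[of ?x j] by simp
    next
      case c
      have i0: "f j (Suc p) = (if j + W ?x = m - 1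
          then (prv ?x, if w (prv ?x) = 1 then m else m + 1) else (Suc ?x mod m, m))"
        using inner[OF c(2), of 0 j] c(1) by simp
      show ?thesis
      proof (cases "j + W ?x = m - 1")
        case True
        then have "w ?x \<noteq> 0" using cr by auto
        then have "w (prv ?x) = 0 \<or> w (prv ?x) = 1" using prvw[OF cj(1)] by auto
        then have "(if w (prv ?x) = 1 then m else m + 1, m - 1) \<in> letter_edge m n (w (prv ?x)) ` {..<n}"
          using m c(2) by (intro image_eqI[of _ _ m]) (auto simp: letter_edge_def n)
        then show ?thesis using c True i0 pre[of ?x j] prv(2)[OF cj(1)] by simp
      next
        case False
        then have "j + W ?x = m - 2" "w ?x = 2" using cr by auto
        moreover have "(m - 2, m) \<in> letter_edge m n 2 ` {..<n}"
          using m c(2) sub_mod_cases[of 2 m n] by (intro image_eqI[of _ _ m]) (auto simp: letter_edge_def n)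
        ultimately show ?thesis using c False i0 pre[of ?x j] by simp
      qed
    next
      case (d r)
      have s: "Suc p = Suc ?x + (2 * r + 1)" using d by simp
      show ?thesis
      proof (cases "j + W ?x = m - 1")
        case True
        then have "w ?x \<noteq> 0" using cr by auto
        then have "w (prv ?x) = 0 \<or> w (prv ?x) = 1" using prvw[OF cj(1)] by auto
        then have "(if w (prv ?x) = 1 then m + 2 * r else m + 2 * r + 1, m + 2 * r + 1)
            \<in> letter_edge m n (w (prv ?x)) ` {..<n}"
          using m d sub_mod_cases[of 1 "m + 2 * r + 1" n]
          by (intro image_eqI[of _ _ "m + 2 * r + 1"]) (auto simp: letter_edge_def n)
        then have "?fwd p"
          unfolding s unfolding d(2) inner[OF d(1) disjI1[OF refl]] inner[OF d(1) disjI2[OF refl]]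
          using True prv(2)[OF cj(1)] by simp
        then show ?thesis ..
      next
        case False
        then have "w ?x = 2" using cr by auto
        moreover have "(m + 2 * r, m + 2 * r) \<in> letter_edge m n 2 ` {..<n}"
          using m d by (intro image_eqI[of _ _ "m + 2 * r + 1"]) (auto simp: letter_edge_def n)
        ultimately have "?bwd p"
          unfolding s unfolding d(2) inner[OF d(1) disjI1[OF refl]] inner[OF d(1) disjI2[OF refl]]
          using False by simp
        then show ?thesis ..
      qed
    next
      case (e r)
      have r: "r < t" using e by simp
      have s: "Suc p = Suc ?x + (2 * Suc r + 0)" using e by simp
      show ?thesis
      proof (cases "j + W ?x = m - 1")
        case True
        then have "w ?x \<noteq> 0" using cr by auto
        then have "w (prv ?x) = 0 \<or> w (prv ?x) = 1" using prvw[OF cj(1)] by auto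
        then have "(if w (prv ?x) = 1 then m + 2 * Suc r else m + 2 * Suc r + 1, m + 2 * r + 1)
            \<in> letter_edge m n (w (prv ?x)) ` {..<n}"
          using m e by (intro image_eqI[of _ _ "m + 2 * Suc r"]) (auto simp: letter_edge_def n)
        then have "?bwd p"
          unfolding s unfolding e(2) inner[OF e(1) disjI1[OF refl]] inner[OF r disjI2[OF refl]]
          using True prv(2)[OF cj(1)] by simp
        then show ?thesis ..
      next
        case False
        then have "w ?x = 2" using cr by auto
        moreover have "(m + 2 * r, m + 2 * Suc r) \<in> letter_edge m n 2 ` {..<n}"
          using m e sub_mod_cases[of 2 "m + 2 * Suc r" n]
          by (intro image_eqI[of _ _ "m + 2 * Suc r"]) (auto simp: letter_edge_def n)
        ultimately have "?fwd p"
          unfolding s unfolding e(2) inner[OF e(1) disjI1[OF refl]] inner[OF r disjI2[OF refl]]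
          using False by simp
        then show ?thesis ..
      qed
    next
      case (f r)
      have r: "r < t" using f by simp
      have s: "Suc p = Suc (?x + 2 * t)" using f by simp
      have "(snd (f j p), j + W ?x + w ?x - m) \<in> letter_edge m n (w ?x) ` {..<n}"
      proof (cases "j + W ?x = m - 1")
        case True
        then have "snd (f j p) = n - 1" "j + W ?x + w ?x - m = w ?x - 1" "w ?x = 1 \<or> w ?x = 2"
          using cr f(1) m unfolding f(2) inner[OF r disjI2[OF refl]] by (auto simp: n)
        then show ?thesis using letter_edge_wrap[OF m(2) mn] by simp
      next
        case False
        then have "snd (f j p) = n - 2" "j + W ?x + w ?x - m = 0" "w ?x = 2"
          using cr f(1) m unfolding f(2) inner[OF r disjI2[OF refl]] by (auto simp: n)
        then show ?thesis using letter_edge_wrap2[OF m(2) mn] by simp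
      qed
      moreover have "fst (f j p) = ?x" unfolding f(2) inner[OF r disjI2[OF refl]] by simp
      ultimately have "?fwd p" unfolding s last by simp
      then show ?thesis ..
    next
      case g
      define x where "x = p - 2 * t"
      have x: "x < m" "Suc p - 2 * t = Suc x" using g p by (auto simp: x_def n)
      have ge: "m \<le> j + W x"
      proof -
        have "Suc ?x \<le> x" using g by (simp add: x_def)
        then show ?thesis using Wmono[of "Suc ?x" x] cj(3) by (simp add: WS)
      qed
      have "j + W (Suc x) - m < m" using j Wle[of "Suc x"] x by simp
      then have "(j + W x - m, (j + W x - m) + w x) \<in> letter_edge m n (w x) ` {..<n}"
        using x w2[of x] mn ge by (intro letter_edge_plain) (simp_all add: WS)
      then have "?fwd p" using post[OF g] post[of j "Suc p"] g x ge by (simp add: x_def[symmetric] WS add.assoc)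
      then show ?thesis ..
    qed
  qed
  have range: "f j p \<in> {..<m} \<times> {..<n}" if jp: "j < m" "p < n" for j p
  proof -
    consider "p \<le> c j" | "c j + 2 * t < p" | r b where "r < t" "b = 0 \<or> b = 1" "p = Suc (c j) + (2 * r + b)"
    proof -
      assume H: "p \<le> c j \<Longrightarrow> thesis" "c j + 2 * t < p \<Longrightarrow> thesis"
        "\<And>r b. r < t \<Longrightarrow> b = 0 \<or> b = 1 \<Longrightarrow> p = Suc (c j) + (2 * r + b) \<Longrightarrow> thesis"
      show thesis
      proof (cases "c j < p \<and> p \<le> c j + 2 * t")
        case True
        define q where "q = p - Suc (c j)"
        have q: "q div 2 < t" "p = Suc (c j) + (2 * (q div 2) + q mod 2)" using True by (auto simp: q_def)
        have "q mod 2 = 0 \<or> q mod 2 = 1" by presburger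
        then show thesis by (rule H(3)[OF q(1) _ q(2)])
      qed (use H(1,2) in linarith)
    qed
    then show ?thesis
    proof cases
      case 1
      then show ?thesis using pre[OF 1] c[OF jp(1)] Wmono[OF 1] mn by auto
    next
      case 2
      then have "p - 2 * t < m" using jp(2) by (auto simp: n)
      then show ?thesis using post[OF 2] Wle[of "p - 2 * t"] jp(1) m mn by auto
    next
      case (3 r b)
      then show ?thesis
        unfolding 3(3) inner[OF 3(1,2)] using c(1)[OF jp(1)] prv(1)[OF c(1)[OF jp(1)]] m
        by (auto simp: n)
    qed
  qed
  \<comment> \<open>Surjectivity gives bijectivity, as both sides have \<open>m * n\<close>
    elements. A vertex in a row below \<open>m\<close> is traced back to layer 0 by means of
    \<open>W\<close>; it lies before or after the crossing according to whether
    \<open>W y \<le> r\<close>.\<close>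
  have surj: "\<exists>j<m. \<exists>p<n. f j p = (y, r)" if yr: "y < m" "r < n" for y r
  proof (cases "r < m")
    case True
    show ?thesis
    proof (cases "W y \<le> r")
      case le: True
      define j where "j = r - W y"
      have j: "j < m" "j + W y = r" using le True by (auto simp: j_def)
      have "y \<le> c j"
      proof (rule ccontr)
        assume "\<not> y \<le> c j"
        then have "W (Suc (c j)) \<le> W y" by (intro Wmono) simp
        then show False using c(3)[OF j(1)] j True by (simp add: WS)
      qed
      then show ?thesis using pre[of y j] j yr mn by (intro exI[of _ j] conjI exI[of _ y]) simp_all
    next
      case gt: False
      define j where "j = r + m - W y"
      have j: "j < m" "j + W y = r + m" using gt True Wle[of y] yr(1) by (auto simp: j_def)
      have "c j < y"
      proof (rule ccontr)
        assume "\<not> c j < y"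
        then have "W y \<le> W (c j)" by (intro Wmono) simp
        then show False using c(2)[OF j(1)] j by simp
      qed
      then show ?thesis using post[of j "y + 2 * t"] j yr by (intro exI[of _ j] conjI exI[of _ "y + 2 * t"]) (simp_all add: n)
    qed
  next
    case False
    define i where "i = (r - m) div 2"
    have i: "i < t" "r = m + 2 * i \<or> r = m + 2 * i + 1" using False yr(2) by (auto simp: i_def n)
    have one: "\<exists>j<m. j + W x = m - 1 \<and> c j = x" if "x < m" "w x \<noteq> 0" for x
    proof -
      have "W x + w x \<le> m" using Wle[of "Suc x"] that(1) by (simp add: WS)
      then have "W x \<le> m - 1" using that(2) m by simp
      then have "m - 1 - W x + W x = m - 1" by simp
      moreover have "c (m - 1 - W x) = x" using \<open>W x \<le> m - 1\<close> that(2) m by (intro cI) (simp_all add: WS)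
      ultimately show ?thesis using m by (intro exI[of _ "m - 1 - W x"]) simp
    qed
    have two: "\<exists>j<m. j + W x = m - 2 \<and> c j = x" if "x < m" "w x = 2" for x
    proof -
      have "W x \<le> m - 2" using Wle[of "Suc x"] that m by (simp add: WS)
      then have "m - 2 - W x + W x = m - 2" by simp
      moreover have "c (m - 2 - W x) = x" using \<open>W x \<le> m - 2\<close> that(2) m by (intro cI) (simp_all add: WS)
      ultimately show ?thesis using m by (intro exI[of _ "m - 2 - W x"]) simp
    qed
    have bound: "Suc x + (2 * i + b) < n" if "x < m" "b = 0 \<or> b = 1" for x b
      using that i(1) by (auto simp: n)
    have m12: "m - 2 \<noteq> m - 1" using m by simp
    have sy: "Suc y mod m < m" using m by simp
    have wsy: "w (Suc y mod m) \<noteq> 0" if "w y \<noteq> 2" using w20[OF yr(1)] that by simp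
    \<comment> \<open>The new rows are distributed by the letter in gap \<open>y\<close>, with gaps
      taken modulo \<open>m\<close>. Row \<open>m + 2 * i + 1\<close> belongs to a crossing in gap
      \<open>y\<close>, or in gap \<open>y + 1\<close> if the letter is 0. Row
      \<open>m + 2 * i\<close> belongs to a crossing in gap \<open>y\<close>, \<open>y + 1\<close>
      or \<open>y - 1\<close> for letter 2, 1 or 0; the last case relies on a 0 being preceded by a
      2.\<close>
    consider (u1) "r = m + 2 * i + 1" "w y \<noteq> 0" | (u0) "r = m + 2 * i + 1" "w y = 0"
      | (v2) "r = m + 2 * i" "w y = 2" | (v1) "r = m + 2 * i" "w y = 1" | (v0) "r = m + 2 * i" "w y = 0"
      using i(2) w2[OF yr(1)] by linarith
    then show ?thesis
    proof cases
      case u1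
      obtain j where "j < m" "j + W y = m - 1" "c j = y" using one[OF yr(1) u1(2)] by blast
      then show ?thesis using inner[OF i(1), of 1 j] u1 bound[of y 1] yr
        by (intro exI[of _ j] conjI exI[of _ "Suc y + (2 * i + 1)"]) auto
    next
      case u0
      obtain j where "j < m" "j + W (Suc y mod m) = m - 1" "c j = Suc y mod m"
        using one[OF sy wsy] u0 by auto
      then show ?thesis using inner[OF i(1), of 0 j] u0 bound[of "Suc y mod m" 0] sy prvS[OF yr(1)]
        by (intro exI[of _ j] conjI exI[of _ "Suc (Suc y mod m) + (2 * i + 0)"]) auto
    next
      case v2
      obtain j where "j < m" "j + W y = m - 2" "c j = y" using two[OF yr(1) v2(2)] by blast
      then show ?thesis using inner[OF i(1), of 1 j] v2 bound[of y 1] yr m12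
        by (intro exI[of _ j] conjI exI[of _ "Suc y + (2 * i + 1)"]) auto
    next
      case v1
      obtain j where "j < m" "j + W (Suc y mod m) = m - 1" "c j = Suc y mod m"
        using one[OF sy wsy] v1 by auto
      then show ?thesis using inner[OF i(1), of 0 j] v1 bound[of "Suc y mod m" 0] sy prvS[OF yr(1)]
        by (intro exI[of _ j] conjI exI[of _ "Suc (Suc y mod m) + (2 * i + 0)"]) auto
    next
      case v0
      have "w (prv y) = 2" using w20[OF prv(1)[OF yr(1)]] prv(2)[OF yr(1)] v0 by simp
      then obtain j where "j < m" "j + W (prv y) = m - 2" "c j = prv y"
        using two[OF prv(1)[OF yr(1)]] by blast
      then show ?thesis using inner[OF i(1), of 0 j] v0 bound[of "prv y" 0] prv[OF yr(1)] m12
        by (intro exI[of _ j] conjI exI[of _ "Suc (prv y) + (2 * i + 0)"]) auto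
    qed
  qed
  have bij: "bij_betw (\<lambda>(j, p). f j p) ({..<m} \<times> {..<n}) ({..<m} \<times> {..<n})"
  proof -
    have "(\<lambda>(j, p). f j p) ` ({..<m} \<times> {..<n}) = {..<m} \<times> {..<n}"
    proof
      show "(\<lambda>(j, p). f j p) ` ({..<m} \<times> {..<n}) \<subseteq> {..<m} \<times> {..<n}"
      proof (rule image_subsetI)
        fix u assume "u \<in> {..<m} \<times> {..<n}"
        then have "f (fst u) (snd u) \<in> {..<m} \<times> {..<n}" by (intro range) (simp_all add: mem_Times_iff)
        then show "(case u of (j, p) \<Rightarrow> f j p) \<in> {..<m} \<times> {..<n}" by (simp only: case_prod_beta)
      qed
      show "{..<m} \<times> {..<n} \<subseteq> (\<lambda>(j, p). f j p) ` ({..<m} \<times> {..<n})"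
      proof
        fix v assume "v \<in> {..<m} \<times> {..<n}"
        then obtain j p where "j < m" "p < n" "f j p = v"
          using surj[of "fst v" "snd v"] by (simp only: mem_Times_iff lessThan_iff prod.collapse) blast
        then show "v \<in> (\<lambda>(j, p). f j p) ` ({..<m} \<times> {..<n})"
          by (intro image_eqI[of _ _ "(j, p)"]) simp_all
      qed
    qed
    then show ?thesis by (simp add: bij_betw_def eq_card_imp_inj_on)
  qed
  define F where "F = edge_system m n n {..<m} f"
  have facF: "is_factor m n n F"
  proof -
    have "adjacent_layers m (fst (f j p)) (fst (f j (Suc p mod n)))" if "j < m" "p < n" for j p
      using link[OF that] unfolding wrap[OF that] adjacent_layers_def by blast
    then show ?thesis
      unfolding is_factor_def F_def using bij by (intro exI[of _ "{..<m}"] exI[of _ f]) simp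
  qed
  \<comment> \<open>\<open>L\<close> consists of all edges that the word asks for, at most
    \<open>m * n\<close> many. As \<open>F\<close> lies in \<open>L\<close> and has exactly this
    size, the two agree, and no edge of \<open>L\<close> has to be located on a cycle.\<close>
  define L where "L = (\<lambda>(x, a). (x, letter_edge m n (w x) a)) ` ({..<m} \<times> {..<n})"
  have "F \<subseteq> L"
  proof
    fix e assume "e \<in> F"
    then obtain x i i' j p where e: "e = (x, i, i')" "x < m" "j < m" "p < n"
        "f j p = (x, i) \<and> f j (Suc p) = (Suc x mod m, i') \<or> f j (Suc p) = (x, i) \<and> f j p = (Suc x mod m, i')"
    proof -
      obtain x i i' j p where e: "e = (x, i, i')" "x < m" "j < m" "p < n"
          "f j p = (x, i) \<and> f j (Suc p mod n) = (Suc x mod m, i') \<or>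
           f j (Suc p mod n) = (x, i) \<and> f j p = (Suc x mod m, i')"
        using \<open>e \<in> F\<close> unfolding F_def edge_system_def by blast
      then show ?thesis using that wrap[OF e(3,4)] by simp
    qed
    have ne: "x \<noteq> Suc (Suc x mod m) mod m" using suc_mod_neq[OF m(2) e(2) _ refl] m by simp
    have "(i, i') \<in> letter_edge m n (w x) ` {..<n}"
    proof -
      show ?thesis using e(5)
      proof (elim disjE conjE)
        assume f: "f j p = (x, i)" "f j (Suc p) = (Suc x mod m, i')"
        show ?thesis using link[OF e(3,4)] ne unfolding f fst_conv snd_conv by metis
      next
        assume f: "f j (Suc p) = (x, i)" "f j p = (Suc x mod m, i')"
        show ?thesis using link[OF e(3,4)] ne unfolding f fst_conv snd_conv by metis
      qed
    qed
    then obtain a where "a < n" "(i, i') = letter_edge m n (w x) a" by blast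
    then show "e \<in> L" using e(1,2) unfolding L_def by (intro image_eqI[of _ _ "(x, a)"]) simp_all
  qed
  moreover have "card L \<le> m * n"
    unfolding L_def using card_image_le[of "{..<m} \<times> {..<n}"] by simp
  moreover have "finite L" unfolding L_def by simp
  moreover have "card F = m * n" using is_factor_props(2)[OF m(2) _ facF] m mn by simp
  ultimately have "F = L" by (intro card_seteq) simp_all
  have "(x, i, j) \<in> F" if "x < m" "a < n" "letter_edge m n (w x) a = (i, j)" for x a i j
    using that unfolding \<open>F = L\<close> L_def by (intro image_eqI[of _ _ "(x, a)"]) simp_all
  then show ?thesis using facF by blast
qed

text \<open>For odd \<open>a \<ge> m\<close> the letter 1 takes \<open>(a, a - 1)\<close> instead of
  \<open>(a - 1, a)\<close>. In each gap the residues 1 and -1 thus leave over one edge between any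
  two neighbouring rows. These edges form the rotations of the cycle \<open>0, 1, ..., n - 1\<close>
  with \<open>t\<close> steps up and \<open>m + t\<close> down.\<close>

lemma step_one_factor:
  assumes m: "odd m" "3 \<le> m" and n: "n = m + 2 * t"
  shows "\<exists>F. is_factor m n n F \<and> (\<forall>x<m. \<forall>a<n.
    if m \<le> a \<and> odd a then (x, a - 1, a) \<in> F else (x, a, (a + n - 1) mod n) \<in> F)"
proof -
  \<comment> \<open>The height falls to \<open>1 - m\<close>, then alternates between
    \<open>2 - m\<close> and \<open>1 - m\<close> from row \<open>m\<close> on, and the closing step
    brings it to \<open>- m\<close>.\<close>
  define s where "s p = (if p < m then - int p else if p = n then - int m
      else 1 - int m + (if odd p then 1 else 0))" for p
  have up: "s (Suc p) = (if m \<le> Suc p \<and> odd (Suc p) \<and> Suc p < n then s p + 1 else s p - 1)" if "p < n" for p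
  proof -
    consider "Suc p < m" | "Suc p = m" | "m \<le> p" "Suc p < n" | "m \<le> p" "Suc p = n"
      using \<open>p < n\<close> by linarith
    moreover have "even p" if "Suc p = n" using that m(1) n by presburger
    ultimately show ?thesis
      using m n by cases (auto simp: s_def)
  qed
  then have s1: "s (Suc p) = s p + 1 \<or> s (Suc p) = s p - 1" if "p < n" for p
    using that by presburger
  have b: "bij_betw id {..<n} {..<n}" by simp
  have s0: "s 0 = 0" using m by (simp add: s_def)
  have "0 < m" "int m dvd s n" using m by (simp_all add: s_def n)
  then obtain F where F: "is_factor m n n F" "\<forall>x<m. \<forall>p<n. if s (Suc p) = s p + 1
      then (x, id p, id (Suc p mod n)) \<in> F else (x, id (Suc p mod n), id p) \<in> F"
    using static_factor[OF _ b s0 s1] by blast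
  have Fp: "if m \<le> Suc p \<and> odd (Suc p) \<and> Suc p < n then (x, p, Suc p mod n) \<in> F else (x, Suc p mod n, p) \<in> F"
    if "x < m" "p < n" for x p
    using F(2)[rule_format, OF that] up[OF that(2)] by (auto split: if_splits)
  have "if m \<le> a \<and> odd a then (x, a - 1, a) \<in> F else (x, a, (a + n - 1) mod n) \<in> F"
    if xa: "x < m" "a < n" for x a
  proof (cases "a = 0")
    case True
    have "n - 1 < n" "Suc (n - 1) = n" "(0 + n - 1) mod n = n - 1" using xa by simp_all
    then show ?thesis using Fp[OF xa(1), of "n - 1"] True m by simp
  next
    case False
    then have "Suc (a - 1) = a" "(a + n - 1) mod n = a - 1" using xa sub_mod_cases[of 1 a n] by simp_all
    then show ?thesis using Fp[OF xa(1), of "a - 1"] xa by (cases "m \<le> a \<and> odd a") auto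
  qed
  then show ?thesis using F(1) by blast
qed

text \<open>For even \<open>a \<ge> m\<close> the letter 2 gives up \<open>(a - 2, a)\<close> and
  takes \<open>(a - 1, a - 1)\<close>, which the letter 0 gives up in favour of
  \<open>(a, a - 2)\<close>. One edge between rows at distance 2 is left over each time. The
  doubling cycle \<open>h\<close> runs through these edges, again with \<open>t\<close> steps up and
  \<open>m + t\<close> down.\<close>

lemma step_two_factor:
  assumes m: "odd m" "3 \<le> m" and n: "n = m + 2 * t"
  shows "\<exists>F. is_factor m n n F \<and> (\<forall>x<m. \<forall>a<n.
    if m \<le> a \<and> even a then (x, a - 2, a) \<in> F else (x, a, (a + n - 2) mod n) \<in> F)"
proof -
  obtain l where l: "m = 2 * l + 1" using m(1) by (rule oddE)
  define s where "s p = (if p \<le> l then - int p else if p \<le> l + t then int p - 2 * int l else 2 * int t - int p)" for p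
  define h where "h p = 2 * p mod n" for p
  have n1: "n = 2 * (l + t) + 1" by (simp add: n l)
  have up: "s (Suc p) = (if l \<le> p \<and> p < l + t then s p + 1 else s p - 1)" for p
    by (auto simp: s_def)
  have h: "bij_betw h {..<n} {..<n}"
  proof -
    have "coprime 2 (int n)" by (simp add: n1)
    then have "bij_betw (\<lambda>i. nat ((2 * int i) mod int n)) {..<n} {..<n}"
      using n1 by (intro bij_betw_mult_mod) simp_all
    moreover have "nat ((2 * int i) mod int n) = h i" for i
      by (metis h_def nat_int of_nat_mult of_nat_numeral zmod_int)
    ultimately show ?thesis by simp
  qed
  have s0: "s 0 = 0" by (simp add: s_def)
  have s1: "s (Suc p) = s p + 1 \<or> s (Suc p) = s p - 1" for p using up[of p] by presburger
  have "s n = - int m" by (simp add: s_def n1 l)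
  then have "0 < m" "int m dvd s n" using m by simp_all
  then obtain F where F: "is_factor m n n F" "\<forall>x<m. \<forall>p<n. if s (Suc p) = s p + 1
      then (x, h p, h (Suc p mod n)) \<in> F else (x, h (Suc p mod n), h p) \<in> F"
    using static_factor[OF _ h s0 s1] by blast
  have Fp: "if l \<le> p \<and> p < l + t then (x, h p, h (Suc p mod n)) \<in> F else (x, h (Suc p mod n), h p) \<in> F"
    if "x < m" "p < n" for x p
    using F(2)[rule_format, OF that] up[of p] by (auto split: if_splits)
  have "if m \<le> a \<and> even a then (x, a - 2, a) \<in> F else (x, a, (a + n - 2) mod n) \<in> F"
    if xa: "x < m" "a < n" for x a
  proof -
    \<comment> \<open>The step of \<open>h\<close> that ends in row \<open>a\<close>:
      \<open>Suc p\<close> is half of \<open>a\<close>, of \<open>a + n\<close> if \<open>a\<close>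
      is odd, and of \<open>2 * n\<close> if \<open>a\<close> is 0.\<close>
    define p where "p = (if a = 0 then n - 1 else if even a then a div 2 - 1 else (a + n) div 2 - 1)"
    have p: "p < n" using xa m n by (auto simp: p_def)
    have hS: "h (Suc p mod n) = 2 * Suc p mod n" by (simp add: h_def mod_mult_right_eq)
    consider (0) "a = 0" | (e) b where "a = 2 * Suc b" | (o) b where "a = 2 * b + 1"
      by (metis add.commute even_two_times_div_two odd_two_times_div_two_succ mult_0_right not0_implies_Suc plus_1_eq_Suc Suc_eq_plus1)
    then show ?thesis
    proof cases
      case 0
      have "2 * p = n + (n - 2)" using 0 n m by (simp add: p_def)
      then have "h p = (n + (n - 2)) mod n" by (simp only: h_def)
      also have "\<dots> = (n - 2) mod n" by (rule mod_add_self1)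
      also have "\<dots> = n - 2" using n1 by (intro mod_less) simp
      finally have "h p = n - 2" .
      moreover have "h (Suc p mod n) = 0" using 0 n1 by (simp add: p_def h_def)
      moreover have "\<not> (l \<le> p \<and> p < l + t)" "(a + n - 2) mod n = n - 2" using 0 n1 by (simp_all add: p_def)
      ultimately show ?thesis using Fp[OF xa(1) p] 0 m by auto
    next
      case (e b)
      then have pb: "p = b" by (simp add: p_def)
      have "h p = a - 2" "h (Suc p mod n) = a" unfolding hS using e xa by (simp_all add: pb h_def)
      moreover have "(a + n - 2) mod n = a - 2" using sub_mod_cases[of 2 a n] e xa by simp
      moreover have "l \<le> p \<and> p < l + t \<longleftrightarrow> m \<le> a" using e xa by (auto simp: pb l n1)
      ultimately show ?thesis using Fp[OF xa(1) p] e by auto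
    next
      case (o b)
      then have pb: "p = b + l + t" using n1 by (simp add: p_def)
      have "2 * Suc p = a + n" using o by (simp add: pb n1)
      then have "h (Suc p mod n) = a" unfolding hS using xa by simp
      moreover have "2 * p = a + n - 2" using o by (simp add: pb n1)
      then have "h p = (a + n - 2) mod n" by (simp add: h_def)
      ultimately show ?thesis using Fp[OF xa(1) p] o by (auto simp: pb)
    qed
  qed
  then show ?thesis using F(1) by blast
qed

lemma sum_period_two: "(\<Sum>x<2 * k. if even x then a else b) = k * (a + b :: nat)"
  by (induction k) (simp_all add: algebra_simps)

text \<open>The words \<open>(02)\<^sup>k012\<close>, \<open>(20)\<^sup>k120\<close> and \<open>1\<^sup>2\<^sup>k201\<close> use each letter once at each position.\<close>

lemma gap_cover_five:
  assumes m: "odd m" "3 \<le> m" and n: "n = m + 2 * t"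
  shows "gap_cover m n (\<lambda>_. {-2..2}) 0 5"
proof -
  obtain k where k: "m = 2 * k + 3"
  proof -
    obtain l where "m = 2 * l + 1" using m(1) by (rule oddE)
    then show thesis using that[of "l - 1"] m(2) by simp
  qed
  define wa where "wa x = (if x < 2 * k + 1 then if even x then 0 else 2 else if x = 2 * k + 1 then 1 else 2 :: nat)" for x
  define wb where "wb x = (if x < 2 * k then if even x then 2 else 0
      else if x = 2 * k then 1 else if x = 2 * k + 1 then 2 else 0 :: nat)" for x
  define wc where "wc x = (if x < 2 * k then 1 else if x = 2 * k then 2 else if x = 2 * k + 1 then 0 else 1 :: nat)" for x
  have S3: "(\<Sum>x<m. g x) = (\<Sum>x<2 * k. g x) + g (2 * k) + g (2 * k + 1) + g (2 * k + 2)" for g :: "nat \<Rightarrow> nat"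
  proof -
    have "m = Suc (Suc (Suc (2 * k)))" by (simp add: k)
    then show ?thesis by simp
  qed
  have "(\<Sum>x<2 * k. wa x) = (\<Sum>x<2 * k. if even x then 0 else 2)" by (rule sum.cong) (auto simp: wa_def)
  then have sa: "(\<Sum>x<m. wa x) = m" unfolding S3 sum_period_two by (simp add: wa_def k)
  have "(\<Sum>x<2 * k. wb x) = (\<Sum>x<2 * k. if even x then 2 else 0)" by (rule sum.cong) (auto simp: wb_def)
  then have sb: "(\<Sum>x<m. wb x) = m" unfolding S3 sum_period_two by (simp add: wb_def k)
  have "(\<Sum>x<2 * k. wc x) = (\<Sum>x<2 * k. 1)" by (rule sum.cong) (auto simp: wc_def)
  then have sc: "(\<Sum>x<m. wc x) = m" unfolding S3 by (simp add: wc_def k)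
  have le: "wa x \<le> 2" "wb x \<le> 2" "wc x \<le> 2" for x by (auto simp: wa_def wb_def wc_def)
  have nxt: "wa x = 2 \<longleftrightarrow> wa (Suc x mod m) = 0" "wb x = 2 \<longleftrightarrow> wb (Suc x mod m) = 0"
    "wc x = 2 \<longleftrightarrow> wc (Suc x mod m) = 0" if "x < m" for x
  proof -
    have y: "Suc x mod m = (if x = 2 * k + 2 then 0 else Suc x)"
      using suc_mod_cases[OF that] k by simp
    consider "Suc x < 2 * k" | "Suc x = 2 * k" | "x = 2 * k" | "x = 2 * k + 1" | "x = 2 * k + 2"
      using \<open>x < m\<close> k by linarith
    note cs = this
    have od: "odd x" if "Suc x = 2 * k" using that by presburger
    show "wa x = 2 \<longleftrightarrow> wa (Suc x mod m) = 0"
      unfolding y using cs by cases (use od in \<open>simp_all add: wa_def\<close>)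
    show "wb x = 2 \<longleftrightarrow> wb (Suc x mod m) = 0"
    proof (cases "Suc x = 2 * k")
      case True
      then have "odd x" by presburger
      then show ?thesis unfolding y using True by (simp add: wb_def)
    next
      case False
      from cs show ?thesis unfolding y by cases (use False in \<open>simp_all add: wb_def\<close>)
    qed
    show "wc x = 2 \<longleftrightarrow> wc (Suc x mod m) = 0" unfolding y using cs by cases (simp_all add: wc_def)
  qed
  obtain Fa where Fa: "is_factor m n n Fa"
      "\<forall>x<m. \<forall>a<n. \<forall>i j. letter_edge m n (wa x) a = (i, j) \<longrightarrow> (x, i, j) \<in> Fa"
    using word_factor[OF m n, of wa] le nxt sa by blast
  obtain Fb where Fb: "is_factor m n n Fb"
      "\<forall>x<m. \<forall>a<n. \<forall>i j. letter_edge m n (wb x) a = (i, j) \<longrightarrow> (x, i, j) \<in> Fb"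
    using word_factor[OF m n, of wb] le nxt sb by blast
  obtain Fc where Fc: "is_factor m n n Fc"
      "\<forall>x<m. \<forall>a<n. \<forall>i j. letter_edge m n (wc x) a = (i, j) \<longrightarrow> (x, i, j) \<in> Fc"
    using word_factor[OF m n, of wc] le nxt sc by blast
  obtain F1 where F1: "is_factor m n n F1" "\<forall>x<m. \<forall>a<n.
      if m \<le> a \<and> odd a then (x, a - 1, a) \<in> F1 else (x, a, (a + n - 1) mod n) \<in> F1"
    using step_one_factor[OF m n] by blast
  obtain F2 where F2: "is_factor m n n F2" "\<forall>x<m. \<forall>a<n.
      if m \<le> a \<and> even a then (x, a - 2, a) \<in> F2 else (x, a, (a + n - 2) mod n) \<in> F2"
    using step_two_factor[OF m n] by blast
  have F1v: "(x, a - 1, a) \<in> F1" if "x < m" "a < n" "m \<le> a \<and> odd a" for x a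
    using F1(2)[rule_format, OF that(1,2)] unfolding if_P[OF that(3)] .
  have F1p: "(x, a, (a + n - 1) mod n) \<in> F1" if "x < m" "a < n" "\<not> (m \<le> a \<and> odd a)" for x a
    using F1(2)[rule_format, OF that(1,2)] unfolding if_not_P[OF that(3)] .
  have F2v: "(x, a - 2, a) \<in> F2" if "x < m" "a < n" "m \<le> a \<and> even a" for x a
    using F2(2)[rule_format, OF that(1,2)] unfolding if_P[OF that(3)] .
  have F2p: "(x, a, (a + n - 2) mod n) \<in> F2" if "x < m" "a < n" "\<not> (m \<le> a \<and> even a)" for x a
    using F2(2)[rule_format, OF that(1,2)] unfolding if_not_P[OF that(3)] .
  let ?U = "Fa \<union> Fb \<union> Fc \<union> F1 \<union> F2"
  have letters: "(x, letter_edge m n l a) \<in> ?U" if xal: "x < m" "a < n" "l \<le> 2" for x a l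
  proof -
    obtain i j where ij: "letter_edge m n l a = (i, j)" by (metis surj_pair)
    have "wa x = l \<or> wb x = l \<or> wc x = l"
    proof -
      consider "x < 2 * k" | "x = 2 * k" | "x = 2 * k + 1" | "x = 2 * k + 2" using xal(1) k by linarith
      then show ?thesis using xal(3) by cases (auto simp: wa_def wb_def wc_def)
    qed
    then have "(x, i, j) \<in> Fa \<union> Fb \<union> Fc"
      using Fa(2) Fb(2) Fc(2) xal(1,2) ij by blast
    then show ?thesis unfolding ij by blast
  qed
  have nodd: "odd n" "m \<le> n" using m n by simp_all
  have addm: "nat ((int i + int d) mod int n) = (i + d) mod n" for i d
  proof -
    have "(int i + int d) mod int n = int ((i + d) mod n)" by (simp add: zmod_int)
    then show ?thesis by simp
  qed
  have subm: "nat ((int i - int d) mod int n) = (i + n - d) mod n" if "d \<le> n" for i d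
  proof -
    have e: "int (i + n - d) = int i - int d + int n" using that by linarith
    have "int ((i + n - d) mod n) = (int i - int d) mod int n"
      by (simp only: zmod_int e mod_add_self2)
    then show ?thesis by (simp only: nat_int flip: \<open>int ((i + n - d) mod n) = (int i - int d) mod int n\<close>)
  qed
  have wrap: "((i + d) mod n + n - d) mod n = i" if "i < n" "d \<le> n" for i d
  proof -
    have "((i + d) mod n + n - d) mod n = ((i + d) mod n + (n - d)) mod n" using that by simp
    also have "\<dots> = (i + d + (n - d)) mod n" by (simp add: mod_add_left_eq)
    also have "i + d + (n - d) = i + n" using that by simp
    finally show ?thesis using that by simp
  qed
  \<comment> \<open>Balance of the exchanges: residue 0 comes from letter 0 or 2, residues 1 and -1
    from letter 1 or \<open>F1\<close>, residue 2 from letter 2 or \<open>F2\<close>, and residue -2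
    from letter 0 or \<open>F2\<close>.\<close>
  have cov: "(x, i, nat ((int i + d) mod int n)) \<in> ?U" if xi: "x < m" "i < n" and d: "d \<in> {-2..2}" for x i d
  proof -
    have n2: "2 \<le> n" using m nodd by simp
    consider "d = 0" | "d = int 1" | "d = - int 1" | "d = int 2" | "d = - int 2" using d by force
    then show ?thesis
    proof cases
      case 1
      show ?thesis
      proof (cases "m \<le> i \<and> odd i")
        case True
        \<comment> \<open>\<open>i\<close> and \<open>n\<close> are both odd, so row
          \<open>i\<close> is not the last one.\<close>
        then have "i + 1 < n" using xi nodd by (metis Suc_eq_plus1 Suc_lessI even_Suc)
        then show ?thesis using letters[OF xi(1), of "i + 1" 2] True xi 1 by (simp add: letter_edge_def)
      next
        case False
        then have "letter_edge m n 0 i = (i, i)" by (auto simp: letter_edge_def)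
        then show ?thesis using letters[OF xi, of 0] xi 1 by simp
      qed
    next
      case 2
      define a where "a = (i + 1) mod n"
      have a: "a < n" "(a + n - 1) mod n = i" using wrap[OF xi(2), of 1] n2 by (simp_all add: a_def)
      have e: "nat ((int i + d) mod int n) = a" unfolding 2 addm a_def ..
      show ?thesis
      proof (cases "m \<le> a \<and> odd a")
        case True
        then have "i = a - 1" using a sub_mod_cases[of 1 a n] m by simp
        then show ?thesis unfolding e using F1v[OF xi(1) a(1) True] by simp
      next
        case False
        then have "letter_edge m n 1 a = (i, a)" using a(2) by (auto simp: letter_edge_def)
        then show ?thesis unfolding e using letters[OF xi(1) a(1), of 1] by simp
      qed
    next
      case 3
      have e: "nat ((int i + d) mod int n) = (i + n - 1) mod n" unfolding 3 using subm[of 1 i] n2 by simp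
      show ?thesis
      proof (cases "m \<le> i \<and> odd i")
        case True
        then have "(i + n - 1) mod n = i - 1" using xi sub_mod_cases[of 1 i n] m by simp
        then show ?thesis unfolding e using letters[OF xi, of 1] True by (simp add: letter_edge_def)
      next
        case False
        then show ?thesis unfolding e using F1p[OF xi False] by simp
      qed
    next
      case 4
      define a where "a = (i + 2) mod n"
      have a: "a < n" "(a + n - 2) mod n = i" using wrap[OF xi(2), of 2] n2 by (simp_all add: a_def)
      have e: "nat ((int i + d) mod int n) = a" unfolding 4 addm a_def ..
      show ?thesis
      proof (cases "m \<le> a \<and> even a")
        case True
        then have "i = a - 2" using a sub_mod_cases[of 2 a n] m by simp
        then show ?thesis unfolding e using F2v[OF xi(1) a(1) True] by simp
      next
        case False
        then have "letter_edge m n 2 a = (i, a)" using a(2) by (auto simp: letter_edge_def)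
        then show ?thesis unfolding e using letters[OF xi(1) a(1), of 2] by simp
      qed
    next
      case 5
      have e: "nat ((int i + d) mod int n) = (i + n - 2) mod n" unfolding 5 using subm[of 2 i] n2 by simp
      show ?thesis
      proof (cases "m \<le> i \<and> even i")
        case True
        then have "m \<noteq> i" using m by auto
        then have i1: "m \<le> i - 1" "i - 1 < n" "i - 1 + 1 = i" "i - 1 - 1 = i - 2"
          using \<open>m \<noteq> i\<close> True xi m by linarith+
        have "odd (i - 1)" using True m by simp
        moreover have "(i + n - 2) mod n = i - 2" using True xi sub_mod_cases[of 2 i n] m by simp
        ultimately have "letter_edge m n 0 (i - 1) = (i, (i + n - 2) mod n)"
          unfolding letter_edge_def using i1 by simp
        then show ?thesis unfolding e using letters[OF xi(1) i1(2), of 0] by simp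
      next
        case False
        then show ?thesis unfolding e using F2p[OF xi False] by simp
      qed
    qed
  qed
  show ?thesis
    unfolding gap_cover_def
    using Fa(1) Fb(1) Fc(1) F1(1) F2(1) cov
    by (intro exI[of _ "[]"] exI[of _ "[Fa, Fb, Fc, F1, F2]"]) (simp add: Un_assoc)
qed

section \<open>Tilings in three gaps\<close>

text \<open>Beyond the first three gaps the centres alternate between \<open>x\<close> and \<open>- x\<close>, which does not affect their sum.\<close>

definition triple_cover :: "nat \<Rightarrow> nat \<Rightarrow> int set \<Rightarrow> int set \<Rightarrow> int set \<Rightarrow> nat \<Rightarrow> nat \<Rightarrow> bool" where
  "triple_cover m n X Y Z p q \<longleftrightarrow> gap_cover m n (\<lambda>x. if x = 0 then X else if x = 1 then Y else if x = 2 then Z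
     else if odd x then X else uminus ` X) p q"

lemma triple_cover_union:
  assumes "triple_cover m n X Y Z p q" "triple_cover m n X' Y' Z' p' q'"
  shows "triple_cover m n (X \<union> X') (Y \<union> Y') (Z \<union> Z') (p + p') (q + q')"
proof -
  note u = gap_cover_union[OF assms[unfolded triple_cover_def]]
  show ?thesis unfolding triple_cover_def by (rule gap_cover_mono[OF u]) (auto split: if_splits)
qed

lemma triple_cover_empty: "triple_cover m n {} {} {} 0 0"
  unfolding triple_cover_def gap_cover_def by (intro exI[of _ "[]"]) auto

lemma triple_cover_mono:
  assumes a: "triple_cover m n X Y Z p q" and X: "\<And>v. v \<in> X' \<Longrightarrow> \<exists>e\<in>X. e mod int n = v mod int n"
    and Y: "\<And>v. v \<in> Y' \<Longrightarrow> \<exists>e\<in>Y. e mod int n = v mod int n"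
    and Z: "\<And>v. v \<in> Z' \<Longrightarrow> \<exists>e\<in>Z. e mod int n = v mod int n"
  shows "triple_cover m n X' Y' Z' p q"
proof -
  have "\<exists>e\<in>uminus ` X. e mod int n = d mod int n" if d: "d \<in> uminus ` X'" for d
  proof -
    obtain v where v: "v \<in> X'" "d = - v" using d by blast
    obtain e where e: "e \<in> X" "e mod int n = v mod int n" using X[OF v(1)] by blast
    have "(- e) mod int n = (- v) mod int n" using e(2) by (metis mod_minus_eq)
    then show ?thesis using e(1) v(2) by blast
  qed
  then show ?thesis
    unfolding triple_cover_def by (intro gap_cover_mono[OF a[unfolded triple_cover_def]]) (use X Y Z in \<open>auto split: if_splits\<close>)
qed

lemma sum_alternating:
  fixes m :: nat
  assumes "odd m" "3 \<le> m"
  shows "(\<Sum>i<m. if i = 0 then x else if i = 1 then y else if i = 2 then z else if odd i then x else - x) = (x + y + z :: int)"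
    (is "sum ?f _ = _")
proof -
  obtain k where m: "m = 3 + 2 * k"
  proof -
    obtain l where "m = 2 * l + 1" using assms(1) by (rule oddE)
    then show thesis using that[of "l - 1"] assms(2) by simp
  qed
  have "sum ?f {..<3 + 2 * k} = x + y + z" for k
  proof (induction k)
    case 0
    show ?case by (simp add: eval_nat_numeral)
  next
    case (Suc k)
    have "?f (3 + 2 * k) = x" "?f (Suc (3 + 2 * k)) = - x" by simp_all
    moreover have "3 + 2 * Suc k = Suc (Suc (3 + 2 * k))" by simp
    ultimately show ?case using Suc.IH by (simp only: sum.lessThan_Suc)
  qed
  then show ?thesis by (simp add: m)
qed

text \<open>Symmetry of \<open>B\<close> makes the reflected translates in the later even gaps
  translates again: the negative of \<open>x + B\<close> is \<open>- x + B\<close>.\<close>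

lemma triple_cover_block:
  assumes m: "odd m" "3 \<le> m" and n: "0 < n" and B: "gap_cover m n (\<lambda>_. B) p q" "uminus ` B = B"
    and xyz: "int n dvd x + y + z"
  shows "triple_cover m n ((+) x ` B) ((+) y ` B) ((+) z ` B) p q"
proof -
  let ?c = "\<lambda>i :: nat. if i = 0 then x else if i = 1 then y else if i = 2 then z else if odd i then x else - x :: int"
  have "int n dvd (\<Sum>i<m. ?c i)" unfolding sum_alternating[OF m] by (rule xyz)
  then have s: "gap_cover m n (\<lambda>i. (+) (?c i) ` B) p q" by (rule gap_cover_shift[OF n B(1)])
  have "uminus ` (+) x ` B = (+) (- x) ` uminus ` B" by (auto simp: image_iff)
  then have "uminus ` (+) x ` B = (+) (- x) ` B" using B(2) by simp
  then have "(\<lambda>i :: nat. (+) (?c i) ` B) = (\<lambda>i :: nat. if i = 0 then (+) x ` B else if i = 1 then (+) y ` B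
      else if i = 2 then (+) z ` B else if odd i then (+) x ` B else uminus ` (+) x ` B)"
    by (auto simp: fun_eq_iff)
  then show ?thesis using s unfolding triple_cover_def by simp
qed

lemma triple_cover_UN:
  assumes "finite K" "\<And>s. s \<in> K \<Longrightarrow> triple_cover m n (X s) (Y s) (Z s) p q"
  shows "triple_cover m n (\<Union>s\<in>K. X s) (\<Union>s\<in>K. Y s) (\<Union>s\<in>K. Z s) (card K * p) (card K * q)"
  using assms
proof (induction K)
  case empty
  then show ?case by (simp add: triple_cover_empty)
next
  case (insert s K)
  then have "triple_cover m n (X s) (Y s) (Z s) p q"
    "triple_cover m n (\<Union>s\<in>K. X s) (\<Union>s\<in>K. Y s) (\<Union>s\<in>K. Z s) (card K * p) (card K * q)" by auto
  from triple_cover_union[OF this] show ?case using insert by simp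
qed

lemma triple_cover_list:
  assumes "\<And>r. r \<in> set L \<Longrightarrow> triple_cover m n (X r) (Y r) (Z r) p q"
  shows "triple_cover m n (\<Union>r\<in>set L. X r) (\<Union>r\<in>set L. Y r) (\<Union>r\<in>set L. Z r) (length L * p) (length L * q)"
  using assms
proof (induction L)
  case Nil
  then show ?case by (simp add: triple_cover_empty)
next
  case (Cons r L)
  then have "triple_cover m n (X r) (Y r) (Z r) p q"
    "triple_cover m n (\<Union>r\<in>set L. X r) (\<Union>r\<in>set L. Y r) (\<Union>r\<in>set L. Z r) (length L * p) (length L * q)" by auto
  from triple_cover_union[OF this] show ?case by simp
qed

lemma triple_cover_HWP:
  assumes mn: "3 \<le> m" "3 \<le> n" and a: "triple_cover m n X Y Z \<alpha> \<beta>" and sum: "\<alpha> + \<beta> = n"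
    and XYZ: "\<And>d. \<exists>e\<in>X. e mod int n = d mod int n" "\<And>d. \<exists>e\<in>Y. e mod int n = d mod int n"
      "\<And>d. \<exists>e\<in>Z. e mod int n = d mod int n"
  shows "(\<alpha>, \<beta>) \<in> HWP (lex_cycle_graph m n) m n"
proof -
  have "triple_cover m n UNIV UNIV UNIV \<alpha> \<beta>" by (rule triple_cover_mono[OF a XYZ])
  then have "gap_cover m n (\<lambda>x. if x = 0 then UNIV else if x = 1 then UNIV else if x = 2 then UNIV
     else if odd x then UNIV else uminus ` UNIV) \<alpha> \<beta>" unfolding triple_cover_def .
  then have "gap_cover m n (\<lambda>_. UNIV) \<alpha> \<beta>" by (rule gap_cover_mono) (auto simp: image_iff intro: exI[of _ "- _"])
  then show ?thesis by (rule gap_cover_imp_HWP[OF mn _ sum]) auto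
qed

text \<open>The lists contain the centres of singletons, of pairs with radius \<open>g\<close> and of five-element blocks; an entry
  of \<open>R\<close> stands for the \<open>t\<close> singletons \<open>(x + 2 * s, y - s, z - s)\<close> with \<open>s < t\<close>.\<close>

lemma triple_cover_rows:
  fixes S :: "(int \<times> int \<times> int) list" and P :: "(int \<times> int \<times> int \<times> int) list" and Q R :: "(int \<times> int \<times> int) list"
  assumes m: "odd m" "3 \<le> m" and n: "n = m + 2 * t'"
    and S: "\<forall>(x, y, z)\<in>set S. int n dvd x + y + z"
    and P: "\<forall>(g, x, y, z)\<in>set P. coprime g (int n) \<and> int n dvd x + y + z"
    and Q: "\<forall>(x, y, z)\<in>set Q. int n dvd x + y + z"
    and R: "\<forall>(x, y, z)\<in>set R. int n dvd x + y + z"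
    and X: "\<And>v. v \<in> X \<Longrightarrow> (\<exists>(x, y, z)\<in>set S. v = x) \<or> (\<exists>(g, x, y, z)\<in>set P. v = x + g \<or> v = x - g) \<or>
      (\<exists>(x, y, z)\<in>set Q. x - 2 \<le> v \<and> v \<le> x + 2) \<or> (\<exists>(x, y, z)\<in>set R. x \<le> v \<and> v < x + 2 * int t \<and> even (v - x))"
    and Y: "\<And>v. v \<in> Y \<Longrightarrow> (\<exists>(x, y, z)\<in>set S. v = y) \<or> (\<exists>(g, x, y, z)\<in>set P. v = y + g \<or> v = y - g) \<or>
      (\<exists>(x, y, z)\<in>set Q. y - 2 \<le> v \<and> v \<le> y + 2) \<or> (\<exists>(x, y, z)\<in>set R. y - int t < v \<and> v \<le> y)"
    and Z: "\<And>v. v \<in> Z \<Longrightarrow> (\<exists>(x, y, z)\<in>set S. v = z) \<or> (\<exists>(g, x, y, z)\<in>set P. v = z + g \<or> v = z - g) \<or>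
      (\<exists>(x, y, z)\<in>set Q. z - 2 \<le> v \<and> v \<le> z + 2) \<or> (\<exists>(x, y, z)\<in>set R. z - int t < v \<and> v \<le> z)"
    and p: "p = length S + length R * t" and q: "q = 2 * length P + 5 * length Q"
  shows "triple_cover m n X Y Z p q"
proof -
  have n0: "0 < n" "0 < m" using m n by simp_all
  let ?b = "\<lambda>B \<pi> r. (+) (\<pi> r :: int) ` B"
  define x1 where "x1 = (\<lambda>(x :: int, y :: int, z :: int). x)"
  define y1 where "y1 = (\<lambda>(x :: int, y :: int, z :: int). y)"
  define z1 where "z1 = (\<lambda>(x :: int, y :: int, z :: int). z)"
  note d1 = x1_def y1_def z1_def
  have blk: "triple_cover m n (?b B x1 r) (?b B y1 r) (?b B z1 r) p' q'"
    if "gap_cover m n (\<lambda>_. B) p' q'" "uminus ` B = B" "case r of (x, y, z) \<Rightarrow> int n dvd x + y + z" for B p' q' r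
    using that by (intro triple_cover_block[OF m n0(1)]) (auto simp: d1)
  have s: "triple_cover m n (\<Union>r\<in>set S. ?b {0} x1 r) (\<Union>r\<in>set S. ?b {0} y1 r) (\<Union>r\<in>set S. ?b {0} z1 r)
      (length S * 1) (length S * 0)"
    by (rule triple_cover_list, rule blk[OF gap_cover_zero[OF n0]]) (use S in auto)
  have pr: "triple_cover m n (\<Union>r\<in>set P. ?b {fst r, - fst r} (x1 \<circ> snd) r) (\<Union>r\<in>set P. ?b {fst r, - fst r} (y1 \<circ> snd) r)
      (\<Union>r\<in>set P. ?b {fst r, - fst r} (z1 \<circ> snd) r) (length P * 0) (length P * 2)"
  proof (rule triple_cover_list)
    fix r assume r: "r \<in> set P"
    obtain g c where gc: "r = (g, c)" by (cases r)
    have "coprime g (int n)" "case c of (x, y, z) \<Rightarrow> int n dvd x + y + z" using P r gc by auto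
    then have "triple_cover m n (?b {g, - g} x1 c) (?b {g, - g} y1 c) (?b {g, - g} z1 c) 0 2"
      by (intro blk[OF gap_cover_pair[OF n0(2) n]]) auto
    then show "triple_cover m n (?b {fst r, - fst r} (x1 \<circ> snd) r) (?b {fst r, - fst r} (y1 \<circ> snd) r)
        (?b {fst r, - fst r} (z1 \<circ> snd) r) 0 2" by (simp add: gc)
  qed
  have qr: "triple_cover m n (\<Union>r\<in>set Q. ?b {-2..2} x1 r) (\<Union>r\<in>set Q. ?b {-2..2} y1 r) (\<Union>r\<in>set Q. ?b {-2..2} z1 r)
      (length Q * 0) (length Q * 5)"
    by (rule triple_cover_list, rule blk[OF gap_cover_five[OF m n]]) (use Q in auto)
  have rr: "triple_cover m n (\<Union>r\<in>set R. \<Union>s\<in>{..<t}. {x1 r + 2 * int s}) (\<Union>r\<in>set R. \<Union>s\<in>{..<t}. {y1 r - int s})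
      (\<Union>r\<in>set R. \<Union>s\<in>{..<t}. {z1 r - int s}) (length R * (card {..<t} * 1)) (length R * (card {..<t} * 0))"
  proof (rule triple_cover_list, rule triple_cover_UN)
    fix r s assume "r \<in> set R" "s \<in> {..<t}"
    then have "case r of (x, y, z) \<Rightarrow> int n dvd x + y + z" using R by blast
    \<comment> \<open>The increments 2, -1 and -1 along a progression cancel.\<close>
    then have "int n dvd (x1 r + 2 * int s) + (y1 r - int s) + (z1 r - int s)"
      by (cases r) (simp add: d1 add.assoc)
    then have "triple_cover m n (?b {0} (\<lambda>_. x1 r + 2 * int s) r) (?b {0} (\<lambda>_. y1 r - int s) r) (?b {0} (\<lambda>_. z1 r - int s) r) 1 0"
      by (intro triple_cover_block[OF m n0(1) gap_cover_zero[OF n0]]) auto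
    then show "triple_cover m n {x1 r + 2 * int s} {y1 r - int s} {z1 r - int s} 1 0" by simp
  qed simp
  have single: "v \<in> (\<Union>r\<in>set S. ?b {0} \<pi> r)" if "\<exists>r\<in>set S. v = \<pi> r" for v \<pi>
    using that by auto
  have pair: "v \<in> (\<Union>r\<in>set P. ?b {fst r, - fst r} (\<pi> \<circ> snd) r)"
    if "\<exists>r\<in>set P. v = \<pi> (snd r) + fst r \<or> v = \<pi> (snd r) - fst r" for v \<pi>
    using that by auto
  have five: "v \<in> (\<Union>r\<in>set Q. ?b {-2..2} \<pi> r)" if ex: "\<exists>r\<in>set Q. \<pi> r - 2 \<le> v \<and> v \<le> \<pi> r + 2" for v \<pi>
  proof -
    obtain r where r: "r \<in> set Q" "\<pi> r - 2 \<le> v \<and> v \<le> \<pi> r + 2" using ex by blast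
    have "v \<in> ?b {-2..2} \<pi> r" using r(2) by (intro image_eqI[of _ _ "v - \<pi> r"]) auto
    then show ?thesis using r(1) by (rule UN_I[rotated])
  qed
  have line2: "v \<in> (\<Union>r\<in>set R. \<Union>s\<in>{..<t}. {\<pi> r + 2 * int s})"
    if ex: "\<exists>r\<in>set R. \<pi> r \<le> v \<and> v < \<pi> r + 2 * int t \<and> even (v - \<pi> r)" for v \<pi>
  proof -
    obtain r where r: "r \<in> set R" "\<pi> r \<le> v" "v < \<pi> r + 2 * int t" "even (v - \<pi> r)" using ex by blast
    obtain w where w: "v - \<pi> r = 2 * w" using r(4) by (rule evenE)
    show ?thesis using r w by (intro UN_I[of r] UN_I[of "nat w"]) auto
  qed
  have line1: "v \<in> (\<Union>r\<in>set R. \<Union>s\<in>{..<t}. {\<pi> r - int s})"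
    if ex: "\<exists>r\<in>set R. \<pi> r - int t < v \<and> v \<le> \<pi> r" for v \<pi>
  proof -
    obtain r where r: "r \<in> set R" "\<pi> r - int t < v" "v \<le> \<pi> r" using ex by blast
    then show ?thesis by (intro UN_I[of r] UN_I[of "nat (\<pi> r - v)"]) auto
  qed
  note all = triple_cover_union[OF triple_cover_union[OF triple_cover_union[OF s pr] qr] rr]
  have "triple_cover m n X Y Z (length S * 1 + length P * 0 + length Q * 0 + length R * (card {..<t} * 1))
      (length S * 0 + length P * 2 + length Q * 5 + length R * (card {..<t} * 0))"
  proof (rule triple_cover_mono[OF all])
    fix v assume "v \<in> X"
    from X[OF this] have "(\<exists>r\<in>set S. v = x1 r) \<or> (\<exists>r\<in>set P. v = x1 (snd r) + fst r \<or> v = x1 (snd r) - fst r) \<or>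
        (\<exists>r\<in>set Q. x1 r - 2 \<le> v \<and> v \<le> x1 r + 2) \<or>
        (\<exists>r\<in>set R. x1 r \<le> v \<and> v < x1 r + 2 * int t \<and> even (v - x1 r))"
      unfolding d1 case_prod_unfold .
    then have "v \<in> (\<Union>r\<in>set S. ?b {0} x1 r) \<union> (\<Union>r\<in>set P. ?b {fst r, - fst r} (x1 \<circ> snd) r) \<union>
        (\<Union>r\<in>set Q. ?b {-2..2} x1 r) \<union> (\<Union>r\<in>set R. \<Union>s\<in>{..<t}. {x1 r + 2 * int s})" (is "_ \<in> ?U")
    proof (elim disjE, goal_cases)
      case 1 then show ?case by (rule single[THEN UnI1, THEN UnI1, THEN UnI1])
    next
      case 2 then show ?case by (rule pair[THEN UnI2, THEN UnI1, THEN UnI1])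
    next
      case 3 then show ?case by (rule five[THEN UnI2, THEN UnI1])
    next
      case 4 then show ?case by (rule line2[THEN UnI2])
    qed
    then show "\<exists>e\<in>?U. e mod int n = v mod int n" by (rule rev_bexI) (rule refl)
  next
    fix v assume "v \<in> Y"
    from Y[OF this] have "(\<exists>r\<in>set S. v = y1 r) \<or> (\<exists>r\<in>set P. v = y1 (snd r) + fst r \<or> v = y1 (snd r) - fst r) \<or>
        (\<exists>r\<in>set Q. y1 r - 2 \<le> v \<and> v \<le> y1 r + 2) \<or>
        (\<exists>r\<in>set R. y1 r - int t < v \<and> v \<le> y1 r)"
      unfolding d1 case_prod_unfold .
    then have "v \<in> (\<Union>r\<in>set S. ?b {0} y1 r) \<union> (\<Union>r\<in>set P. ?b {fst r, - fst r} (y1 \<circ> snd) r) \<union>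
        (\<Union>r\<in>set Q. ?b {-2..2} y1 r) \<union> (\<Union>r\<in>set R. \<Union>s\<in>{..<t}. {y1 r - int s})" (is "_ \<in> ?U")
    proof (elim disjE, goal_cases)
      case 1 then show ?case by (rule single[THEN UnI1, THEN UnI1, THEN UnI1])
    next
      case 2 then show ?case by (rule pair[THEN UnI2, THEN UnI1, THEN UnI1])
    next
      case 3 then show ?case by (rule five[THEN UnI2, THEN UnI1])
    next
      case 4 then show ?case by (rule line1[THEN UnI2])
    qed
    then show "\<exists>e\<in>?U. e mod int n = v mod int n" by (rule rev_bexI) (rule refl)
  next
    fix v assume "v \<in> Z"
    from Z[OF this] have "(\<exists>r\<in>set S. v = z1 r) \<or> (\<exists>r\<in>set P. v = z1 (snd r) + fst r \<or> v = z1 (snd r) - fst r) \<or>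
        (\<exists>r\<in>set Q. z1 r - 2 \<le> v \<and> v \<le> z1 r + 2) \<or>
        (\<exists>r\<in>set R. z1 r - int t < v \<and> v \<le> z1 r)"
      unfolding d1 case_prod_unfold .
    then have "v \<in> (\<Union>r\<in>set S. ?b {0} z1 r) \<union> (\<Union>r\<in>set P. ?b {fst r, - fst r} (z1 \<circ> snd) r) \<union>
        (\<Union>r\<in>set Q. ?b {-2..2} z1 r) \<union> (\<Union>r\<in>set R. \<Union>s\<in>{..<t}. {z1 r - int s})" (is "_ \<in> ?U")
    proof (elim disjE, goal_cases)
      case 1 then show ?case by (rule single[THEN UnI1, THEN UnI1, THEN UnI1])
    next
      case 2 then show ?case by (rule pair[THEN UnI2, THEN UnI1, THEN UnI1])
    next
      case 3 then show ?case by (rule five[THEN UnI2, THEN UnI1])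
    next
      case 4 then show ?case by (rule line1[THEN UnI2])
    qed
    then show "\<exists>e\<in>?U. e mod int n = v mod int n" by (rule rev_bexI) (rule refl)
  qed
  then show ?thesis by (simp add: p q mult.commute)
qed

text \<open>\<open>x\<close> runs through the interval in order, while \<open>y s\<close> is
  congruent to \<open>- s / 2\<close> and \<open>z s\<close> to \<open>l - s / 2\<close> modulo the
  odd number \<open>2 * l + 1\<close>. The representatives are chosen so that the sum is 0 as an
  integer.\<close>

lemma zero_sum_interval:
  obtains x y z :: "nat \<Rightarrow> int" where "\<And>s. x s + y s + z s = 0"
    and "{- int l..int l} \<subseteq> x ` {..<2 * l + 1}" "{- int l..int l} \<subseteq> y ` {..<2 * l + 1}"
      "{- int l..int l} \<subseteq> z ` {..<2 * l + 1}"
proof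
  define x where "x s = int s - int l" for s
  define y where "y s = (if even s then - int (s div 2) else int l - int (s div 2))" for s
  define z where "z s = - x s - y s" for s
  show "x s + y s + z s = 0" for s by (simp add: z_def)
  show "{- int l..int l} \<subseteq> x ` {..<2 * l + 1}"
  proof
    fix j assume "j \<in> {- int l..int l}"
    then show "j \<in> x ` {..<2 * l + 1}" by (intro image_eqI[of _ _ "nat (j + int l)"]) (auto simp: x_def)
  qed
  show "{- int l..int l} \<subseteq> y ` {..<2 * l + 1}"
  proof
    fix j assume j: "j \<in> {- int l..int l}"
    show "j \<in> y ` {..<2 * l + 1}"
    proof (cases "j \<le> 0")
      case True
      then show ?thesis using j by (intro image_eqI[of _ _ "2 * nat (- j)"]) (auto simp: y_def)
    next
      case False
      then show ?thesis using j by (intro image_eqI[of _ _ "2 * nat (int l - j) + 1"]) (auto simp: y_def)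
    qed
  qed
  show "{- int l..int l} \<subseteq> z ` {..<2 * l + 1}"
  proof
    fix j assume j: "j \<in> {- int l..int l}"
    show "j \<in> z ` {..<2 * l + 1}"
    proof (cases "0 \<le> j")
      case True
      then show ?thesis using j by (intro image_eqI[of _ _ "2 * nat (int l - j)"]) (auto simp: z_def x_def y_def)
    next
      case False
      then show ?thesis using j by (intro image_eqI[of _ _ "2 * nat (- j - 1) + 1"]) (auto simp: z_def x_def y_def)
    qed
  qed
qed

lemma triple_cover_interval:
  assumes m: "odd m" "3 \<le> m" and n: "0 < n"
  shows "triple_cover m n {- int l..int l} {- int l..int l} {- int l..int l} (2 * l + 1) 0"
proof -
  obtain x y z where s: "\<And>s. x s + y s + z s = (0 :: int)"
    and c: "{- int l..int l} \<subseteq> x ` {..<2 * l + 1}" "{- int l..int l} \<subseteq> y ` {..<2 * l + 1}"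
      "{- int l..int l} \<subseteq> z ` {..<2 * l + 1}"
    using zero_sum_interval[of l] by blast
  have "0 < m" using m by simp
  then have "triple_cover m n ((+) (x s) ` {0}) ((+) (y s) ` {0}) ((+) (z s) ` {0}) 1 0" for s
    by (intro triple_cover_block[OF m n gap_cover_zero[OF n]]) (simp_all add: s)
  then have "triple_cover m n (\<Union>s\<in>{..<2 * l + 1}. {x s}) (\<Union>s\<in>{..<2 * l + 1}. {y s}) (\<Union>s\<in>{..<2 * l + 1}. {z s})
      (card {..<2 * l + 1} * 1) (card {..<2 * l + 1} * 0)"
    by (intro triple_cover_UN) simp_all
  then have "triple_cover m n (x ` {..<2 * l + 1}) (y ` {..<2 * l + 1}) (z ` {..<2 * l + 1}) (2 * l + 1) 0"
    by (simp add: UNION_singleton_eq_range)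
  then show ?thesis by (rule triple_cover_mono) (use c in blast)+
qed

text \<open>The two elements of the pair with centre \<open>2 * j\<close> and radius \<open>(n + 1) div 2\<close> are adjacent modulo \<open>n\<close>.\<close>

lemma triple_cover_middle:
  assumes m: "odd m" "3 \<le> m" and n: "n = m + 2 * t" "n = 2 * N + 2 * L + 1" and L: "odd L"
  shows "triple_cover m n {int N + 1..int N + 2 * int L} {int N + 1..int N + 2 * int L} {int N + 1..int N + 2 * int L} 0 (2 * L)"
proof -
  obtain l where l: "L = 2 * l + 1" using L by (rule oddE)
  define g where "g = int N + int L + 1"
  have "2 * g = int n + 1" by (simp add: g_def n(2))
  then have "coprime g (int n)" by (intro coprimeI) (metis dvd_add_right_iff dvd_mult)
  have n0: "0 < n" "0 < m" using n m by auto
  obtain x y z where s: "\<And>s. x s + y s + z s = (0 :: int)"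
    and c: "{- int l..int l} \<subseteq> x ` {..<2 * l + 1}" "{- int l..int l} \<subseteq> y ` {..<2 * l + 1}"
      "{- int l..int l} \<subseteq> z ` {..<2 * l + 1}"
    using zero_sum_interval[of l] by blast
  have s2: "2 * x s + 2 * y s + 2 * z s = 0" for s using s[of s] by linarith
  have "triple_cover m n ((+) (2 * x s) ` {g, - g}) ((+) (2 * y s) ` {g, - g}) ((+) (2 * z s) ` {g, - g}) 0 2" for s
    using gap_cover_pair[OF n0(2) n(1) \<open>coprime g (int n)\<close>] s2[of s] by (intro triple_cover_block[OF m n0(1)]) auto
  then have a: "triple_cover m n (\<Union>s\<in>{..<2 * l + 1}. (+) (2 * x s) ` {g, - g}) (\<Union>s\<in>{..<2 * l + 1}. (+) (2 * y s) ` {g, - g})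
      (\<Union>s\<in>{..<2 * l + 1}. (+) (2 * z s) ` {g, - g}) (card {..<2 * l + 1} * 0) (card {..<2 * l + 1} * 2)"
    by (intro triple_cover_UN) simp_all
  have cov: "\<exists>e\<in>(\<Union>s\<in>{..<2 * l + 1}. (+) (2 * w s) ` {g, - g}). e mod int n = v mod int n"
    if w: "{- int l..int l} \<subseteq> w ` {..<2 * l + 1}" and v: "v \<in> {int N + 1..int N + 2 * int L}" for w v
  proof -
    define b where "b = v - (int N + int L)"
    define j where "j = b div 2"
    have "j \<in> {- int l..int l}" using v unfolding j_def b_def l by auto
    then obtain s where s: "s < 2 * l + 1" "w s = j" using w by auto
    consider "b = 2 * j + 1" | "b = 2 * j" unfolding j_def by linarith
    then show ?thesis
    proof cases
      case 1
      then have "v = 2 * w s + g" by (simp add: s b_def g_def)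
      then show ?thesis using s(1) by (intro bexI[of _ v] UN_I[of s]) auto
    next
      case 2
      then have "v = (2 * w s + - g) + int n" by (simp add: s b_def g_def n(2))
      then have "(2 * w s + - g) mod int n = v mod int n" by simp
      then show ?thesis using s(1) by (intro bexI[of _ "2 * w s + - g"] UN_I[of s]) auto
    qed
  qed
  have "triple_cover m n {int N + 1..int N + 2 * int L} {int N + 1..int N + 2 * int L} {int N + 1..int N + 2 * int L}
      (card {..<2 * l + 1} * 0) (card {..<2 * l + 1} * 2)"
    by (rule triple_cover_mono[OF a]) (use cov c in blast)+
  then show ?thesis by (simp add: l mult.commute)
qed

text \<open>Since \<open>n = 2 * N + 2 * L + 1\<close>, the outer pairs complete
  \<open>{-N..N}\<close> to all residues. What remains is to tile intervals, with the freedom to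
  place some pairs inside.\<close>

lemma triple_cover_interval_HWP:
  assumes m: "odd m" "3 \<le> m" and n: "n = m + 2 * t" "n = 2 * N + 2 * L + 1" and L: "L = 0 \<or> odd L"
    and a: "triple_cover m n {- int N..int N} {- int N..int N} {- int N..int N} \<alpha> q"
    and q: "\<beta> = q + 2 * L" "\<alpha> + \<beta> = n"
  shows "(\<alpha>, \<beta>) \<in> HWP (lex_cycle_graph m n) m n"
proof -
  let ?A = "{- int N..int N} \<union> {int N + 1..int N + 2 * int L}"
  have "triple_cover m n {int N + 1..int N + 2 * int L} {int N + 1..int N + 2 * int L} {int N + 1..int N + 2 * int L} 0 (2 * L)"
    using triple_cover_middle[OF m n] triple_cover_empty[of m n] L by (cases "L = 0") auto
  from triple_cover_union[OF a this] have "triple_cover m n ?A ?A ?A \<alpha> \<beta>" by (simp add: q)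
  moreover have "\<exists>e\<in>?A. e mod int n = d mod int n" for d
  proof -
    define r where "r = d mod int n"
    have r: "0 \<le> r" "r < int n" "r mod int n = r" using n by (simp_all add: r_def)
    show ?thesis
    proof (cases "r \<le> int N + 2 * int L")
      case True
      then show ?thesis using r by (intro bexI[of _ r]) (auto simp: r_def)
    next
      case False
      have "(r - int n) mod int n = d mod int n" by (simp add: r_def)
      moreover have "int n = 2 * int N + 2 * int L + 1" by (simp add: n(2))
      then have "r - int n \<in> ?A" using False r(1,2) by simp
      ultimately show ?thesis by (rule bexI)
    qed
  qed
  ultimately show ?thesis using m n by (intro triple_cover_HWP[of m n ?A ?A ?A] q(2)) simp_all
qed

section \<open>Tilings of intervals\<close>

text \<open>The explicit tilings were found by computer search. A tiling of \<open>{-N..N}\<close> grows to one of \<open>{-N-2..N+2}\<close>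
  by cutting each column at four places, where the four progressions of \<open>R\<close> are inserted.\<close>

lemma triple_cover_pair_even:
  assumes "odd m" "3 \<le> m" "n = m + 2 * t'" and "N = 4 + 2 * k"
  shows "triple_cover m n {- int N..int N} {- int N..int N} {- int N..int N} (2 * N - 1) 2"
proof -
  define t where "t = int k"
  have N: "int N = 4 + 2 * t" "0 \<le> t" "int k = t" by (simp_all add: assms t_def)
  show ?thesis
  \<comment> \<open>At \<open>t = 0\<close> the lists \<open>S\<close> and \<open>P\<close> alone
    tile \<open>{-4..4}\<close>. In the first column the progressions have step 2 and interleave in
    twos, filling \<open>{-2 * t - 1..-2}\<close> and \<open>{3..2 * t + 2}\<close>; in the other
    columns each of the four fills \<open>t\<close> consecutive values.\<close>
  proof (rule triple_cover_rows[OF assms(1-3), where t = k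
        and S = "[(-2 * t - 4, t + 3, t + 1), (-2 * t - 3, 0, 2 * t + 3), (-2 * t - 2, t + 2, t), (0, 2 * t + 4, -2 * t - 4), (2, t + 1, - t - 3), (2 * t + 3, - t - 1, - t - 2), (2 * t + 4, -2 * t - 3, -1)]"
        and P = "[(1, 0, -2 * t - 3, 2 * t + 3)]"
        and Q = "[]"
        and R = "[(-2 * t - 1, 2 * t + 3, -2), (-2 * t, -1, 2 * t + 1), (4, t, - t - 4), (3, - t - 2, t - 1)]"],
      goal_cases)
    case (5 v)
    then show ?case using N(2) by (simp add: N) presburger
  next
    case (6 v)
    then show ?case using N(2) by (simp add: N) presburger
  next
    case (7 v)
    then show ?case using N(2) by (simp add: N) presburger
  next
    case 8
    show ?case by (simp add: assms(4))
  qed (auto simp: N)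
qed

lemma triple_cover_pair_odd:
  assumes "odd m" "3 \<le> m" "n = m + 2 * t'" and "N = 5 + 2 * k"
  shows "triple_cover m n {- int N..int N} {- int N..int N} {- int N..int N} (2 * N - 1) 2"
proof -
  define t where "t = int k"
  have N: "int N = 5 + 2 * t" "0 \<le> t" "int k = t" by (simp_all add: assms t_def)
  show ?thesis
  proof (rule triple_cover_rows[OF assms(1-3), where t = k
        and S = "[(-2 * t - 4, t + 2, t + 2), (-2, - t - 2, t + 4), (-1, 2 * t + 5, -2 * t - 4), (0, -2 * t - 5, 2 * t + 5), (1, 2 * t + 4, -2 * t - 5), (2, t, - t - 2), (3, - t - 3, t), (2 * t + 4, -1, -2 * t - 3), (2 * t + 5, -2 * t - 4, -1)]"
        and P = "[(1, -2 * t - 4, t + 2, t + 2)]"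
        and Q = "[]"
        and R = "[(-2 * t - 1, 2 * t + 3, -2), (-2 * t - 2, -2, 2 * t + 4), (5, - t - 4, t - 1), (4, t - 1, - t - 3)]"],
      goal_cases)
    case (5 v)
    then show ?case using N(2) by (simp add: N) presburger
  next
    case (6 v)
    then show ?case using N(2) by (simp add: N) presburger
  next
    case (7 v)
    then show ?case using N(2) by (simp add: N) presburger
  next
    case 8
    show ?case by (simp add: assms(4))
  qed (auto simp: N)
qed

lemma triple_cover_five_odd:
  assumes "odd m" "3 \<le> m" "n = m + 2 * t'" and "N = 7 + 2 * k"
  shows "triple_cover m n {- int N..int N} {- int N..int N} {- int N..int N} (2 * N - 4) 5"
proof -
  define t where "t = int k"
  have N: "int N = 7 + 2 * t" "0 \<le> t" "int k = t" by (simp_all add: assms t_def)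
  show ?thesis
  proof (rule triple_cover_rows[OF assms(1-3), where t = k
        and S = "[(-2 * t - 7, t + 3, t + 4), (-6, t + 4, - t + 2), (-5, - t, t + 5), (-4, 1, 3), (-3, t + 2, - t + 1), (-2, 2 * t + 7, -2 * t - 5), (-1, -2 * t - 6, 2 * t + 7), (0, 2 * t + 6, -2 * t - 6), (1, -2 * t - 7, 2 * t + 6), (2, 2 * t + 5, -2 * t - 7)]"
        and P = "[]"
        and Q = "[(2 * t + 5, - t - 3, - t - 2)]"
        and R = "[(-2 * t - 6, 2 * t + 4, 2), (-2 * t - 5, 0, 2 * t + 5), (3, - t - 6, t + 3), (4, t + 1, - t - 5)]"],
      goal_cases)
    case (5 v)
    then show ?case using N(2) by (simp add: N) presburger
  next
    case (6 v)
    then show ?case using N(2) by (simp add: N) presburger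
  next
    case (7 v)
    then show ?case using N(2) by (simp add: N) presburger
  next
    case 8
    show ?case by (simp add: assms(4))
  qed (auto simp: N)
qed

lemma triple_cover_five_even:
  assumes "odd m" "3 \<le> m" "n = m + 2 * t'" and "N = 8 + 2 * k"
  shows "triple_cover m n {- int N..int N} {- int N..int N} {- int N..int N} (2 * N - 4) 5"
proof -
  define t where "t = int k"
  have N: "int N = 8 + 2 * t" "0 \<le> t" "int k = t" by (simp_all add: assms t_def)
  show ?thesis
  proof (rule triple_cover_rows[OF assms(1-3), where t = k
        and S = "[(-2 * t - 8, t + 2, t + 6), (-2 * t - 7, t + 3, t + 4), (-2 * t - 6, -1, 2 * t + 7), (-5, t + 4, - t + 1), (-4, 1, 3), (-3, 2 * t + 8, -2 * t - 5), (-2, 0, 2), (-1, 2 * t + 7, -2 * t - 6), (0, -2 * t - 8, 2 * t + 8), (1, 2 * t + 6, -2 * t - 7), (2, - t - 7, t + 5), (3, 2 * t + 5, -2 * t - 8)]"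
        and P = "[]"
        and Q = "[(2 * t + 6, - t - 4, - t - 2)]"
        and R = "[(-2 * t - 4, -2, 2 * t + 6), (-2 * t - 5, 2 * t + 4, 1), (5, - t - 8, t + 3), (4, t + 1, - t - 5)]"],
      goal_cases)
    case (5 v)
    then show ?case using N(2) by (simp add: N) presburger
  next
    case (6 v)
    then show ?case using N(2) by (simp add: N) presburger
  next
    case (7 v)
    then show ?case using N(2) by (simp add: N) presburger
  next
    case 8
    show ?case by (simp add: assms(4))
  qed (auto simp: N)
qed

text \<open>Serves odd \<beta> when the number of outer pairs would be even and nonzero: one pair of
  radius 1 joins the five-element block inside.\<close>

lemma triple_cover_five_pair_odd:
  assumes "odd m" "3 \<le> m" "n = m + 2 * t'" and "N = 7 + 2 * k"
  shows "triple_cover m n {- int N..int N} {- int N..int N} {- int N..int N} (2 * N - 6) 7"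
proof -
  define t where "t = int k"
  have N: "int N = 7 + 2 * t" "0 \<le> t" "int k = t" by (simp_all add: assms t_def)
  show ?thesis
  proof (rule triple_cover_rows[OF assms(1-3), where t = k
        and S = "[(-2, -2 * t - 4, 2 * t + 6), (0, 2 * t + 7, -2 * t - 7), (2, -2 * t - 6, 2 * t + 4), (3, t + 1, - t - 4), (4, - t - 2, t - 2), (2 * t + 5, 0, -2 * t - 5), (2 * t + 6, -2 * t - 3, -3), (2 * t + 7, -1, -2 * t - 6)]"
        and P = "[(1, 0, -2 * t - 6, 2 * t + 6)]"
        and Q = "[(-2 * t - 5, t + 4, t + 1)]"
        and R = "[(-2 * t - 1, -2, 2 * t + 3), (-2 * t - 2, 2 * t + 6, -4), (5, t, - t - 5), (6, - t - 3, t - 3)]"],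
      goal_cases)
    case (5 v)
    then show ?case using N(2) by (simp add: N) presburger
  next
    case (6 v)
    then show ?case using N(2) by (simp add: N) presburger
  next
    case (7 v)
    then show ?case using N(2) by (simp add: N) presburger
  next
    case 8
    show ?case by (simp add: assms(4))
  qed (auto simp: N)
qed

lemma triple_cover_five_pair_even:
  assumes "odd m" "3 \<le> m" "n = m + 2 * t'" and "N = 8 + 2 * k"
  shows "triple_cover m n {- int N..int N} {- int N..int N} {- int N..int N} (2 * N - 6) 7"
proof -
  define t where "t = int k"
  have N: "int N = 8 + 2 * t" "0 \<le> t" "int k = t" by (simp_all add: assms t_def)
  show ?thesis
  proof (rule triple_cover_rows[OF assms(1-3), where t = k
        and S = "[(-2 * t - 3, -5, 2 * t + 8), (-2, 2 * t + 8, -2 * t - 6), (-1, 2 * t + 5, -2 * t - 4), (1, 2 * t + 7, -2 * t - 8), (3, t - 2, - t - 1), (4, - t - 6, t + 2), (5, t - 3, - t - 2), (6, - t - 7, t + 1), (7, t - 4, - t - 3), (2 * t + 8, -2 * t - 8, 0)]"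
        and P = "[(1, 1, 2 * t + 5, -2 * t - 6)]"
        and Q = "[(-2 * t - 6, t + 1, t + 5)]"
        and R = "[(-2 * t - 2, 2 * t + 3, -1), (-2 * t - 1, -6, 2 * t + 7), (9, t - 5, - t - 4), (8, - t - 8, t)]"],
      goal_cases)
    case (5 v)
    then show ?case using N(2) by (simp add: N) presburger
  next
    case (6 v)
    then show ?case using N(2) by (simp add: N) presburger
  next
    case (7 v)
    then show ?case using N(2) by (simp add: N) presburger
  next
    case 8
    show ?case by (simp add: assms(4))
  qed (auto simp: N)
qed

section \<open>Small intervals\<close>

lemma triple_cover_pair_1:
  assumes "odd m" "3 \<le> m" "n = m + 2 * t"
  shows "triple_cover m n {-1..1} {-1..1} {-1..1} 1 2"
proof (rule triple_cover_rows[OF assms(1-3), where t = 0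
      and S = "[(0, 0, 0)]"
      and P = "[(1, 0, 0, 0)]" and Q = "[]" and R = "[]"], goal_cases)
  case (5 v)
  then show ?case by simp presburger
next
  case (6 v)
  then show ?case by simp presburger
next
  case (7 v)
  then show ?case by simp presburger
qed simp_all

lemma triple_cover_pair_2:
  assumes "odd m" "3 \<le> m" "n = m + 2 * t"
  shows "triple_cover m n {-2..2} {-2..2} {-2..2} 3 2"
proof (rule triple_cover_rows[OF assms(1-3), where t = 0
      and S = "[(-2, 2, 0), (-1, -1, 2), (1, 1, -2)]"
      and P = "[(1, 1, -1, 0)]" and Q = "[]" and R = "[]"], goal_cases)
  case (5 v)
  then show ?case by simp presburger
next
  case (6 v)
  then show ?case by simp presburger
next
  case (7 v)
  then show ?case by simp presburger
qed simp_all

lemma triple_cover_pair_3: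
  assumes "odd m" "3 \<le> m" "n = m + 2 * t"
  shows "triple_cover m n {-3..3} {-3..3} {-3..3} 5 2"
proof (rule triple_cover_rows[OF assms(1-3), where t = 0
      and S = "[(-3, 1, 2), (-2, -1, 3), (-1, 2, -1), (0, 3, -3), (2, -3, 1)]"
      and P = "[(1, 2, -1, -1)]" and Q = "[]" and R = "[]"], goal_cases)
  case (5 v)
  then show ?case by simp presburger
next
  case (6 v)
  then show ?case by simp presburger
next
  case (7 v)
  then show ?case by simp presburger
qed simp_all

lemma triple_cover_five_2:
  assumes "odd m" "3 \<le> m" "n = m + 2 * t"
  shows "triple_cover m n {-2..2} {-2..2} {-2..2} 0 5"
proof (rule triple_cover_rows[OF assms(1-3), where t = 0
      and S = "[]"
      and P = "[]" and Q = "[(0, 0, 0)]" and R = "[]"])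
qed simp_all

text \<open>With 6 singletons and one five-element block alone, \<open>N\<close> would be 5, outside
  the range of the families. Each inner pair raises \<open>N\<close> by 1, and moving two of them
  inside keeps an odd number of outer pairs odd.\<close>

lemma triple_cover_five_two_pairs_7:
  assumes "odd m" "3 \<le> m" "n = m + 2 * t"
  shows "triple_cover m n {-7..7} {-7..7} {-7..7} 6 9"
proof (rule triple_cover_rows[OF assms(1-3), where t = 0
      and S = "[(-7, 5, 2), (-6, 7, -1), (-4, 3, 1), (3, 2, -5), (4, -1, -3), (6, 1, -7)]"
      and P = "[(1, -4, 5, -1), (1, 6, -1, -5)]" and Q = "[(0, -5, 5)]" and R = "[]"], goal_cases)
  case (5 v)
  then show ?case by simp presburger
next
  case (6 v)
  then show ?case by simp presburger
next
  case (7 v)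
  then show ?case by simp presburger
qed simp_all

text \<open>The analogue for 8 singletons, where \<open>N\<close> grows from 6 to 8.\<close>

lemma triple_cover_five_two_pairs_8:
  assumes "odd m" "3 \<le> m" "n = m + 2 * t"
  shows "triple_cover m n {-8..8} {-8..8} {-8..8} 8 9"
proof (rule triple_cover_rows[OF assms(1-3), where t = 0
      and S = "[(-3, -5, 8), (-2, 7, -5), (-1, 8, -7), (0, -6, 6), (1, -8, 7), (2, -7, 5), (3, 0, -3), (4, -3, -1)]"
      and P = "[(1, 6, -3, -3), (1, 7, 0, -7)]" and Q = "[(-6, 4, 2)]" and R = "[]"], goal_cases)
  case (5 v)
  then show ?case by simp presburger
next
  case (6 v)
  then show ?case by simp presburger
next
  case (7 v)
  then show ?case by simp presburger
qed simp_all

text \<open>Again 6 singletons; moving three pairs inside turns an even number of outer pairs into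
  an odd one.\<close>

lemma triple_cover_five_three_pairs_8:
  assumes "odd m" "3 \<le> m" "n = m + 2 * t"
  shows "triple_cover m n {-8..8} {-8..8} {-8..8} 6 11"
proof (rule triple_cover_rows[OF assms(1-3), where t = 0
      and S = "[(-8, 2, 6), (-7, 0, 7), (-6, -2, 8), (0, -4, 4), (2, -7, 5), (4, 3, -7)]"
      and P = "[(1, 2, -4, 2), (1, 6, -7, 1), (1, 7, 0, -7)]" and Q = "[(-3, 6, -3)]" and R = "[]"], goal_cases)
  case (5 v)
  then show ?case by simp presburger
next
  case (6 v)
  then show ?case by simp presburger
next
  case (7 v)
  then show ?case by simp presburger
qed simp_all

section \<open>Small cases\<close>

text \<open>Only one pair accompanies the five-element block here, too few for the tilings of
  \<open>{-7..7}\<close> and \<open>{-8..8}\<close> with 6 singletons. All residues modulo 13 are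
  tiled directly, with sums that vanish only modulo 13 and a pair of radius 5.\<close>

lemma HWP_13_6:
  assumes "odd m" "3 \<le> m" "13 = m + 2 * t"
  shows "(6, 7) \<in> HWP (lex_cycle_graph m 13) m 13"
proof (rule triple_cover_HWP)
  \<comment> \<open>The lists contain the integers produced by the tiling; each is a complete
    residue system modulo 13.\<close>
  show "triple_cover m 13 {-6, -5, -4, -2, -1, 1, 0, 10, 2, 3, 4, 5, 6}
      {0, -3, -1, 4, 2, 3, 1, 11, -8, -7, -6, -5, -4}
      {6, -5, 5, -2, -1, -4, -3, 7, 0, 1, 2, 3, 4} 6 7"
  proof (rule triple_cover_rows[OF assms(1-3), where t = 0
      and S = "[(-6, 0, 6), (-5, -3, -5), (-4, -1, 5), (-2, 4, -2), (-1, 2, -1), (1, 3, -4)]"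
      and P = "[(5, 5, 6, 2)]" and Q = "[(4, -6, 2)]" and R = "[]"], goal_cases)
    case 2
    show ?case by (simp add: coprime_iff_gcd_eq_1 gcd_non_0_int)
  next
    case (5 v)
    then show ?case by simp presburger
  next
    case (6 v)
    then show ?case by simp presburger
  next
    case (7 v)
    then show ?case by simp presburger
  qed simp_all
next
  fix d :: int
  show "\<exists>e\<in>{-6, -5, -4, -2, -1, 1, 0, 10, 2, 3, 4, 5, 6}. e mod int 13 = d mod int 13"
    by simp presburger
next
  fix d :: int
  show "\<exists>e\<in>{0, -3, -1, 4, 2, 3, 1, 11, -8, -7, -6, -5, -4}. e mod int 13 = d mod int 13"
    by simp presburger
next
  fix d :: int
  show "\<exists>e\<in>{6, -5, 5, -2, -1, -4, -3, 7, 0, 1, 2, 3, 4}. e mod int 13 = d mod int 13"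
    by simp presburger
qed (use assms in simp_all)

text \<open>The same for two pairs; their radii 4 and 7 have to be prime to 15.\<close>

lemma HWP_15_6:
  assumes "odd m" "3 \<le> m" "15 = m + 2 * t"
  shows "(6, 9) \<in> HWP (lex_cycle_graph m 15) m 15"
proof (rule triple_cover_HWP)
  show "triple_cover m 15 {-3, -2, 1, 2, 3, 5, -4, 4, 0, 14, -9, -8, -7, -6, -5}
      {-4, -6, -7, -1, 0, 1, 2, 10, -2, 12, 3, 4, 5, 6, 7}
      {7, -7, 6, -1, -3, -6, -10, -2, -4, 10, 0, 1, 2, 3, 4} 6 9"
  proof (rule triple_cover_rows[OF assms(1-3), where t = 0
      and S = "[(-3, -4, 7), (-2, -6, -7), (1, -7, 6), (2, -1, -1), (3, 0, -3), (5, 1, -6)]"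
      and P = "[(4, 0, 6, -6), (7, 7, 5, 3)]" and Q = "[(-7, 5, 2)]" and R = "[]"], goal_cases)
    case 2
    show ?case by (simp add: coprime_iff_gcd_eq_1 gcd_non_0_int)
  next
    case (5 v)
    then show ?case by simp presburger
  next
    case (6 v)
    then show ?case by simp presburger
  next
    case (7 v)
    then show ?case by simp presburger
  qed simp_all
next
  fix d :: int
  show "\<exists>e\<in>{-3, -2, 1, 2, 3, 5, -4, 4, 0, 14, -9, -8, -7, -6, -5}. e mod int 15 = d mod int 15"
    by simp presburger
next
  fix d :: int
  show "\<exists>e\<in>{-4, -6, -7, -1, 0, 1, 2, 10, -2, 12, 3, 4, 5, 6, 7}. e mod int 15 = d mod int 15"
    by simp presburger
next
  fix d :: int
  show "\<exists>e\<in>{7, -7, 6, -1, -3, -6, -10, -2, -4, 10, 0, 1, 2, 3, 4}. e mod int 15 = d mod int 15"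
    by simp presburger
qed (use assms in simp_all)

text \<open>Dilated by 2, the five-element block covers the even numbers of \<open>{-5..5}\<close>.
  The odd ones split into pairs of radius 1 with centres -4, 0 and 4, whose cyclic shifts over the
  three columns have sum 0.\<close>

lemma triple_cover_five_three_pairs_5:
  assumes m: "odd m" "3 \<le> m" and n: "n = m + 2 * t"
  shows "triple_cover m n {-5..5} {-5..5} {-5..5} 0 11"
proof -
  have n0: "0 < n" using m n by simp
  have "coprime 2 (int n)" using m n by simp
  then have "gap_cover m n (\<lambda>_. times 2 ` {-2..2}) 0 5" by (rule gap_cover_scale[OF n0 gap_cover_five[OF m n]])
  moreover have "{-2..2} = {-2, -1, 0, 1, 2 :: int}" by auto
  ultimately have B: "gap_cover m n (\<lambda>_. {-4, -2, 0, 2, 4}) 0 5" by simp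
  have "triple_cover m n ((+) 0 ` {-4, -2, 0, 2, 4}) ((+) 0 ` {-4, -2, 0, 2, 4}) ((+) 0 ` {-4, -2, 0, 2, 4}) 0 5"
    by (rule triple_cover_block[OF m n0 B]) auto
  moreover have "triple_cover m n {-5, -3, -1, 1, 3, 5} {-5, -3, -1, 1, 3, 5} {-5, -3, -1, 1, 3, 5} 0 6"
    by (rule triple_cover_rows[OF m n, where t = 0 and S = "[]" and Q = "[]" and R = "[]"
          and P = "[(1, -4, 0, 4), (1, 0, 4, -4), (1, 4, -4, 0)]"]) auto
  ultimately have "triple_cover m n ({-4, -2, 0, 2, 4} \<union> {-5, -3, -1, 1, 3, 5}) ({-4, -2, 0, 2, 4} \<union> {-5, -3, -1, 1, 3, 5})
      ({-4, -2, 0, 2, 4} \<union> {-5, -3, -1, 1, 3, 5}) (0 + 0) (5 + 6)"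
    by (intro triple_cover_union) simp_all
  moreover have "{-4, -2, 0, 2, 4} \<union> {-5, -3, -1, 1, 3, 5} = {-5..5::int}"
    by (rule set_eqI) (simp, presburger)
  ultimately show ?thesis by simp
qed

text \<open>Beside the five-element block the residues 3, -3, 4 and -4 remain, and 3 is no unit
  modulo 9. The lists \<open>?h\<close> and \<open>?h'\<close> are Hamilton cycles that together use
  every edge of difference 3 or 4 on nine points exactly once, mixing the two differences.\<close>

lemma gap_cover_nine:
  assumes m: "odd m" "3 \<le> m" and n: "9 = m + 2 * t"
  shows "gap_cover m 9 (\<lambda>_. {-4..4}) 0 9"
proof -
  have m0: "0 < m" using m by simp
  have pair: "\<exists>F F'. is_factor m 9 9 F \<and> is_factor m 9 9 F' \<and>
      (\<forall>x<m. \<forall>p<9. (x, h ! p, h ! (Suc p mod 9)) \<in> F \<union> F' \<and> (x, h ! (Suc p mod 9), h ! p) \<in> F \<union> F')"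
    if h: "set h = {..<9}" "length h = 9" for h
  proof -
    have "distinct h" using h by (simp add: card_distinct)
    then have "bij_betw ((!) h) {..<9} {..<9}" using h by (intro bij_betw_nth) simp_all
    then show ?thesis by (rule hamilton_two_factors[OF m0 n])
  qed
  have nine: "P 0 \<and> P 1 \<and> P 2 \<and> P 3 \<and> P 4 \<and> P 5 \<and> P 6 \<and> P 7 \<and> P 8" if "\<forall>p<9. P p" for P :: "nat \<Rightarrow> bool"
    using that by simp
  let ?h = "[0, 3, 6, 1, 4, 7, 2, 8, 5 :: nat]" and ?h' = "[0, 4, 8, 3, 7, 1, 5, 2, 6 :: nat]"
  have "set ?h = {..<9}" "set ?h' = {..<9}" by (auto simp: eval_nat_numeral less_Suc_eq)
  then obtain F1 F2 F3 F4 where F: "is_factor m 9 9 F1" "is_factor m 9 9 F2" "is_factor m 9 9 F3" "is_factor m 9 9 F4"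
    and F12: "\<forall>x<m. \<forall>p<9. (x, ?h ! p, ?h ! (Suc p mod 9)) \<in> F1 \<union> F2 \<and> (x, ?h ! (Suc p mod 9), ?h ! p) \<in> F1 \<union> F2"
    and F34: "\<forall>x<m. \<forall>p<9. (x, ?h' ! p, ?h' ! (Suc p mod 9)) \<in> F3 \<union> F4 \<and> (x, ?h' ! (Suc p mod 9), ?h' ! p) \<in> F3 \<union> F4"
    using pair[of ?h] pair[of ?h'] by auto
  define U where "U = F1 \<union> F2 \<union> F3 \<union> F4"
  have "(x, i, nat ((int i + d) mod int 9)) \<in> U" if x: "x < m" and "i < 9" and "d \<in> {-4, -3, 3, 4}" for x i d
  proof -
    have "\<forall>p<9. (x, ?h ! p, ?h ! (Suc p mod 9)) \<in> U \<and> (x, ?h ! (Suc p mod 9), ?h ! p) \<in> U"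
      "\<forall>p<9. (x, ?h' ! p, ?h' ! (Suc p mod 9)) \<in> U \<and> (x, ?h' ! (Suc p mod 9), ?h' ! p) \<in> U"
      using F12 F34 x unfolding U_def by blast+
    note e = this[THEN nine]
    have "i \<in> {0, 1, 2, 3, 4, 5, 6, 7, 8}" using \<open>i < 9\<close> by auto
    then show ?thesis using \<open>d \<in> _\<close> e by (elim insertE emptyE) simp_all
  qed
  then have "gap_cover m 9 (\<lambda>_. {-4, -3, 3, 4}) 0 4"
    unfolding gap_cover_def U_def using F
    by (intro exI[of _ "[]"] exI[of _ "[F1, F2, F3, F4]"]) (simp add: Un_assoc)
  from gap_cover_union[OF gap_cover_five[OF m n] this] have "gap_cover m 9 (\<lambda>_. {-2..2} \<union> {-4, -3, 3, 4}) 0 9" by simp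
  moreover have "{-2..2} \<union> {-4, -3, 3, 4} = {-4..4 :: int}" by auto
  ultimately show ?thesis by simp
qed

section \<open>Five free gaps\<close>

lemma sum_alternating_five:
  fixes m :: nat
  assumes "odd m" "5 \<le> m"
  shows "(\<Sum>i<m. if i < 5 then r ! i else if odd i then r ! 0 else - r ! 0) = (r ! 0 + r ! 1 + r ! 2 + r ! 3 + r ! 4 :: int)"
    (is "sum ?f _ = _")
proof -
  obtain k where m: "m = 5 + 2 * k"
  proof -
    obtain l where "m = 2 * l + 1" using assms(1) by (rule oddE)
    then show thesis using that[of "l - 2"] assms(2) by simp
  qed
  have "sum ?f {..<5 + 2 * k} = r ! 0 + r ! 1 + r ! 2 + r ! 3 + r ! 4" for k
  proof (induction k)
    case 0
    show ?case by (simp add: eval_nat_numeral)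
  next
    case (Suc k)
    have "?f (5 + 2 * k) = r ! 0" "?f (Suc (5 + 2 * k)) = - r ! 0" by simp_all
    moreover have "5 + 2 * Suc k = Suc (Suc (5 + 2 * k))" by simp
    ultimately show ?case using Suc.IH by (simp only: sum.lessThan_Suc)
  qed
  then show ?thesis by (simp add: m)
qed

text \<open>Five gaps may be filled independently once \<open>m \<ge> 5\<close>; the further gaps
  alternate between the entry of column 0 and its negative, which is harmless because
  \<open>B\<close> is symmetric.\<close>

lemma gap_cover_five_columns:
  assumes m: "odd m" "5 \<le> m" and n: "0 < n"
    and R: "\<And>r. r \<in> set R \<Longrightarrow> int n dvd r ! 0 + r ! 1 + r ! 2 + r ! 3 + r ! 4"
    and B: "\<And>i. i < 5 \<Longrightarrow> B \<subseteq> (\<lambda>r. r ! i) ` set R" "uminus ` B = B"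
  shows "gap_cover m n (\<lambda>_. B) (length R) 0"
proof -
  define c :: "int list \<Rightarrow> nat \<Rightarrow> int" where "c r i = (if i < 5 then r ! i else if odd i then r ! 0 else - r ! 0)" for r i
  have n0: "0 < m" using m by simp
  have "gap_cover m n (\<lambda>i. (\<lambda>r. c r i) ` set R) (length R) 0" if "\<And>r. r \<in> set R \<Longrightarrow> int n dvd r ! 0 + r ! 1 + r ! 2 + r ! 3 + r ! 4" for R
    using that
  proof (induction R)
    case Nil
    show ?case unfolding gap_cover_def by simp
  next
    case (Cons r R)
    have "int n dvd (\<Sum>i<m. c r i)" unfolding c_def sum_alternating_five[OF m] using Cons.prems by simp
    then have "gap_cover m n (\<lambda>i. (+) (c r i) ` {0}) 1 0" by (rule gap_cover_shift[OF n gap_cover_zero[OF n n0]])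
    moreover have "gap_cover m n (\<lambda>i. (\<lambda>r. c r i) ` set R) (length R) 0" using Cons by simp
    ultimately have "gap_cover m n (\<lambda>i. (+) (c r i) ` {0} \<union> (\<lambda>r. c r i) ` set R) (1 + length R) (0 + 0)"
      by (rule gap_cover_union)
    then show ?case by simp
  qed
  then have d: "gap_cover m n (\<lambda>i. (\<lambda>r. c r i) ` set R) (length R) 0" using R by blast
  have "d \<in> (\<lambda>r. c r i) ` set R" if "d \<in> B" for d i
  proof -
    consider "i < 5" | "\<not> i < 5" "odd i" | "\<not> i < 5" "even i" by blast
    then show ?thesis
    proof cases
      case 1
      then show ?thesis using B(1)[OF 1] \<open>d \<in> B\<close> by (auto simp: c_def)
    next
      case 2
      then show ?thesis using B(1)[of 0] \<open>d \<in> B\<close> by (auto simp: c_def)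
    next
      case 3
      have "- d \<in> B" using B(2) \<open>d \<in> B\<close> by blast
      then have "- d \<in> (\<lambda>r. r ! 0) ` set R" using B(1)[of 0] by auto
      then obtain r where "r \<in> set R" "- d = r ! 0" by blast
      then show ?thesis using 3 by (intro image_eqI[of _ _ r]) (auto simp: c_def)
    qed
  qed
  then show ?thesis by (intro gap_cover_mono[OF d]) blast
qed

text \<open>Only the singletons are arranged in columns. The five-element block and \<open>C\<close>
  occupy the same residues in every gap, so \<open>B\<close> can be what they leave over.\<close>

lemma HWP_five_columns:
  assumes m: "odd m" "5 \<le> m" and n: "n = m + 2 * t" "5 \<le> n" and R: "\<forall>r\<in>set R. int n dvd r ! 0 + r ! 1 + r ! 2 + r ! 3 + r ! 4"
    and B: "\<forall>i\<in>{0, 1, 2, 3, 4}. B \<subseteq> set (map (\<lambda>r. r ! i) R)" "uminus ` B = B"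
    and C: "gap_cover m n (\<lambda>_. C) p q"
    and cov: "\<And>d. \<exists>e\<in>B \<union> {-2..2} \<union> C. e mod int n = d mod int n"
    and sum: "length R + p + (5 + q) = n"
  shows "(length R + p, 5 + q) \<in> HWP (lex_cycle_graph m n) m n"
proof -
  have col: "B \<subseteq> (\<lambda>r. r ! i) ` set R" if "i < 5" for i
  proof -
    have "i \<in> {0, 1, 2, 3, 4}" using that by auto
    from bspec[OF B(1) this] show ?thesis by simp
  qed
  have "gap_cover m n (\<lambda>_. B) (length R) 0"
    using n R by (intro gap_cover_five_columns[OF m _ _ col B(2)]) auto
  moreover have "gap_cover m n (\<lambda>_. {-2..2}) 0 5" using m by (intro gap_cover_five[OF _ _ n(1)]) simp_all
  ultimately have "gap_cover m n (\<lambda>_. B \<union> {-2..2}) (length R + 0) (0 + 5)" by (rule gap_cover_union)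
  from gap_cover_union[OF this C] have "gap_cover m n (\<lambda>_. B \<union> {-2..2} \<union> C) (length R + p) (5 + q)" by simp
  then show ?thesis by (rule gap_cover_imp_HWP[rotated 2]) (use m n sum cov in simp_all)
qed

lemma gap_cover_empty: "gap_cover m n (\<lambda>_. {}) 0 0"
  by (simp add: gap_cover_def)

lemma HWP_11_6:
  assumes "odd m" "5 \<le> m" "11 = m + 2 * t"
  shows "(6, 5) \<in> HWP (lex_cycle_graph m 11) m 11"
proof -
  have "\<exists>e\<in>{-5, -4, -3, 3, 4, 5} \<union> {-2..2} \<union> {}. e mod int 11 = d mod int 11" for d
  proof -
    have "\<exists>e. - 5 \<le> e \<and> e \<le> 5 \<and> e mod 11 = d mod 11" by presburger
    then obtain e where e: "- 5 \<le> e" "e \<le> 5" "e mod int 11 = d mod int 11" by auto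
    then have "e \<in> {-5, -4, -3, 3, 4, 5} \<union> {-2..2} \<union> {}" by simp presburger
    with e(3) show ?thesis by (rule bexI)
  qed
  note cov = this
  \<comment> \<open>Each column is a permutation of the six residues outside \<open>{-2..2}\<close>,
    and every row sum is a multiple of 11.\<close>
  let ?R = "[[3, -3, -5, -3, -3], [-3, -4, -4, 4, -4], [4, 5, 3, 5, 5], [-4, 4, 5, 3, 3], [5, 3, 4, -5, 4],
    [-5, -5, -3, -4, -5 :: int]]"
  have "(length ?R + 0, 5 + 0) \<in> HWP (lex_cycle_graph m 11) m 11"
    by (rule HWP_five_columns[OF assms _ _ _ _ gap_cover_empty cov]) auto
  moreover have "length ?R + 0 = 6" by simp
  ultimately show ?thesis by (simp only: add_0_right)
qed

lemma
  assumes "odd m" "5 \<le> m"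
  shows HWP_13_8: "13 = m + 2 * t \<Longrightarrow> (8, 5) \<in> HWP (lex_cycle_graph m 13) m 13"
    and HWP_15_8: "15 = m + 2 * t \<Longrightarrow> (8, 7) \<in> HWP (lex_cycle_graph m 15) m 15"
proof -
  let ?B = "{-6, -5, -4, -3, 3, 4, 5, 6 :: int}"
  \<comment> \<open>The row sums are 0 as integers, so one table serves both moduli. For
    \<open>n = 15\<close> the residues 7 and -7 remain and form a pair.\<close>
  let ?R = "[[3, -5, -6, 3, 5], [-3, 6, 6, -4, -5], [4, -6, 4, 4, -6], [-4, -4, -3, 5, 6], [5, -3, -4, 6, -4],
    [-5, 4, 3, -5, 3], [6, 5, -5, -3, -3], [-6, 3, 5, -6, 4 :: int]]"
  have len: "length ?R + 0 = 8" by simp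
  have cov: "\<exists>e\<in>?B \<union> {-2..2} \<union> {}. e mod int 13 = d mod int 13" for d
  proof -
    have "\<exists>e. - 6 \<le> e \<and> e \<le> 6 \<and> e mod 13 = d mod 13" by presburger
    then obtain e where e: "- 6 \<le> e" "e \<le> 6" "e mod int 13 = d mod int 13" by auto
    then have "e \<in> ?B \<union> {-2..2} \<union> {}" by simp presburger
    with e(3) show ?thesis by (rule bexI)
  qed
  show "(8, 5) \<in> HWP (lex_cycle_graph m 13) m 13" if n: "13 = m + 2 * t"
  proof -
    have "(length ?R + 0, 5 + 0) \<in> HWP (lex_cycle_graph m 13) m 13"
      by (rule HWP_five_columns[OF assms n _ _ _ _ gap_cover_empty cov]) auto
    then show ?thesis unfolding len by simp
  qed
  have cov: "\<exists>e\<in>?B \<union> {-2..2} \<union> {7, -7}. e mod int 15 = d mod int 15" for d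
  proof -
    have "\<exists>e. - 7 \<le> e \<and> e \<le> 7 \<and> e mod 15 = d mod 15" by presburger
    then obtain e where e: "- 7 \<le> e" "e \<le> 7" "e mod int 15 = d mod int 15" by auto
    then have "e \<in> ?B \<union> {-2..2} \<union> {7, -7}" by simp presburger
    with e(3) show ?thesis by (rule bexI)
  qed
  show "(8, 7) \<in> HWP (lex_cycle_graph m 15) m 15" if n: "15 = m + 2 * t"
  proof -
    have "0 < m" "coprime 7 (int 15)" using assms by (simp_all add: coprime_iff_gcd_eq_1 gcd_non_0_int)
    then have "(length ?R + 0, 5 + 2) \<in> HWP (lex_cycle_graph m 15) m 15"
      by (intro HWP_five_columns[OF assms n _ _ _ _ gap_cover_pair[OF _ n] cov]) auto
    then show ?thesis unfolding len by simp
  qed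
qed

section \<open>The theorem\<close>

text \<open>Needed for positive \<beta> divisible by 4: the inner pair leaves an odd number of outer
  ones.\<close>

lemma triple_cover_pair:
  assumes "odd m" "3 \<le> m" "n = m + 2 * t" "1 \<le> N"
  shows "triple_cover m n {- int N..int N} {- int N..int N} {- int N..int N} (2 * N - 1) 2"
proof -
  consider "N = 1" | "N = 2" | "N = 3" | k where "N = 4 + 2 * k" | k where "N = 5 + 2 * k"
  proof -
    have "N = 1 \<or> N = 2 \<or> N = 3 \<or> (\<exists>k. N = 4 + 2 * k) \<or> (\<exists>k. N = 5 + 2 * k)"
      using assms(4) by presburger
    then show thesis using that by blast
  qed
  then show ?thesis
    using triple_cover_pair_1[OF assms(1-3)] triple_cover_pair_2[OF assms(1-3)] triple_cover_pair_3[OF assms(1-3)]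
      triple_cover_pair_even[OF assms(1-3)] triple_cover_pair_odd[OF assms(1-3)] by cases auto
qed

text \<open>The missing values 3, 4, 5 and 6 of \<open>N\<close> correspond to 2, 4, 6 and 8
  singletons. The first two are excluded from the theorem, the others receive separate
  tilings.\<close>

lemma triple_cover_five:
  assumes "odd m" "3 \<le> m" "n = m + 2 * t" "N = 2 \<or> 7 \<le> N"
  shows "triple_cover m n {- int N..int N} {- int N..int N} {- int N..int N} (2 * N - 4) 5"
proof -
  consider "N = 2" | k where "N = 7 + 2 * k" | k where "N = 8 + 2 * k"
  proof -
    have "N = 2 \<or> (\<exists>k. N = 7 + 2 * k) \<or> (\<exists>k. N = 8 + 2 * k)" using assms(4) by presburger
    then show thesis using that by blast
  qed
  then show ?thesis
    using triple_cover_five_2[OF assms(1-3)] triple_cover_five_odd[OF assms(1-3)] triple_cover_five_even[OF assms(1-3)] by cases auto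
qed

lemma triple_cover_five_pair:
  assumes "odd m" "3 \<le> m" "n = m + 2 * t" "7 \<le> N"
  shows "triple_cover m n {- int N..int N} {- int N..int N} {- int N..int N} (2 * N - 6) 7"
proof -
  consider k where "N = 7 + 2 * k" | k where "N = 8 + 2 * k"
  proof -
    have "(\<exists>k. N = 7 + 2 * k) \<or> (\<exists>k. N = 8 + 2 * k)" using assms(4) by presburger
    then show thesis using that by blast
  qed
  then show ?thesis
    using triple_cover_five_pair_odd[OF assms(1-3)] triple_cover_five_pair_even[OF assms(1-3)] by cases auto
qed

lemma HWP_even:
  assumes m: "odd m" "3 \<le> m" and n: "n = m + 2 * t" and \<beta>: "even \<beta>" "\<alpha> + \<beta> = n"
  shows "(\<alpha>, \<beta>) \<in> HWP (lex_cycle_graph m n) m n"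
proof -
  obtain L where L: "\<beta> = 2 * L" using \<beta>(1) by (rule evenE)
  have "odd \<alpha>" using m n \<beta> by presburger
  then obtain N where N: "\<alpha> = 2 * N + 1" by (rule oddE)
  have n0: "0 < n" using m n by simp
  show ?thesis
  proof (cases "L = 0 \<or> odd L")
    case True
    have "triple_cover m n {- int N..int N} {- int N..int N} {- int N..int N} \<alpha> 0"
      unfolding N by (rule triple_cover_interval[OF m n0])
    then show ?thesis using N L \<beta>(2) by (intro triple_cover_interval_HWP[OF m n _ True]) auto
  next
    case False
    then have "odd (L - 1)" "1 \<le> L" by simp_all
    have "triple_cover m n {- int (N + 1)..int (N + 1)} {- int (N + 1)..int (N + 1)} {- int (N + 1)..int (N + 1)} \<alpha> 2"
      using triple_cover_pair[OF m n, of "N + 1"] by (simp add: N)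
    then show ?thesis using N L \<beta>(2) \<open>odd (L - 1)\<close> \<open>1 \<le> L\<close>
      by (intro triple_cover_interval_HWP[OF m n, of "N + 1" "L - 1" _ 2]) auto
  qed
qed

lemma HWP_odd:
  assumes m: "odd m" "3 \<le> m" and n: "n = m + 2 * t" and \<beta>: "odd \<beta>" "5 \<le> \<beta>" "\<alpha> + \<beta> = n"
    and \<alpha>: "\<alpha> \<notin> {2, 4}" "(m, n, \<alpha>) \<notin> {(3, 11, 6), (3, 13, 8), (3, 15, 8)}"
  shows "(\<alpha>, \<beta>) \<in> HWP (lex_cycle_graph m n) m n"
proof -
  obtain L where L: "\<beta> = 2 * L + 5"
  proof -
    obtain l where "\<beta> = 2 * l + 1" using \<beta>(1) by (rule oddE)
    then show thesis using that[of "l - 2"] \<beta>(2) by simp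
  qed
  have "even \<alpha>" using m n \<beta> by presburger
  have m5: "5 \<le> m" if "m \<noteq> 3" using m that by presburger
  note interval = triple_cover_interval_HWP[OF m n]
  have five: ?thesis if "N = 2 \<or> 7 \<le> N" "\<alpha> = 2 * N - 4" "L = 0 \<or> odd L" for N
    using triple_cover_five[OF m n that(1)] that L \<beta>(3) by (intro interval[of N L \<alpha> 5]) auto
  have five_pair: ?thesis if "7 \<le> N" "\<alpha> = 2 * N - 6" "L \<noteq> 0" "even L" for N
  proof -
    have "odd (L - 1)" "1 \<le> L" using that by simp_all
    then show ?thesis
      using triple_cover_five_pair[OF m n that(1)] that(1,2) L \<beta>(3) by (intro interval[of N "L - 1" \<alpha> 7]) auto
  qed
  \<comment> \<open>\<open>L - 2\<close> and \<open>L - 3\<close> count the outer pairs that are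
    left when two or three of the \<open>L\<close> pairs are moved inside.\<close>
  have small: "L = 0 \<or> L = 1 \<or> L = 2 \<or> 3 \<le> L \<and> odd (L - 2) \<or> 4 \<le> L \<and> odd (L - 3)" by presburger
  have "\<alpha> \<noteq> 2" "\<alpha> \<noteq> 4" using \<alpha>(1) by simp_all
  then have "\<alpha> = 0 \<or> \<alpha> = 6 \<or> \<alpha> = 8 \<or> 10 \<le> \<alpha>" using \<open>even \<alpha>\<close> by presburger
  then consider "\<alpha> = 0" | "\<alpha> = 6" | "\<alpha> = 8" | "10 \<le> \<alpha>" by blast
  then show ?thesis
  proof cases
    case 1
    \<comment> \<open>Two pairs accompany the block, fewer than the three needed inside
      \<open>{-5..5}\<close>, and \<open>n\<close> is 9.\<close>
    have nine: ?thesis if "L = 2"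
    proof -
      have n9: "n = 9" "\<beta> = 9" using 1 that L \<beta>(3) by simp_all
      have "\<exists>e\<in>{-4..4}. e mod int 9 = d mod int 9" for d
      proof -
        have "\<exists>e. - 4 \<le> e \<and> e \<le> 4 \<and> e mod 9 = d mod 9" by presburger
        then show ?thesis by auto
      qed
      then show ?thesis using gap_cover_nine[OF m n[unfolded n9(1)]] unfolding n9 1
        by (intro gap_cover_imp_HWP[OF m(2), of 9 "\<lambda>_. {-4..4}"]) simp_all
    qed
    have large: ?thesis if "4 \<le> L" "odd (L - 3)"
      using triple_cover_five_three_pairs_5[OF m n] that 1 L \<beta>(3) by (intro interval[of 5 "L - 3" \<alpha> 11]) auto
    consider "L = 0 \<or> odd L" | "L = 2" | "4 \<le> L" "odd (L - 3)" using small by fastforce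
    then show ?thesis using five[of 2] nine large 1 by cases simp_all
  next
    case 2
    have n: "n = 2 * L + 11" using 2 L \<beta>(3) by simp
    from small consider "L = 0" | "L = 1" | "L = 2" | "3 \<le> L" "odd (L - 2)" | "4 \<le> L" "odd (L - 3)" by blast
    then show ?thesis
    proof cases
      case 1
      then have "n = 11" "\<beta> = 5" using n L by simp_all
      then show ?thesis using HWP_11_6[OF m(1) m5] \<alpha>(2) assms(3) 2 by auto
    next
      case inner: 2
      then have "n = 13" "\<beta> = 7" using n L by simp_all
      then show ?thesis using HWP_13_6[OF m] assms(3) 2 by simp
    next
      case 3
      then have "n = 15" "\<beta> = 9" using n L by simp_all
      then show ?thesis using HWP_15_6[OF m] assms(3) 2 by simp
    next
      case 4
      then show ?thesis using triple_cover_five_two_pairs_7[OF m assms(3)] n 2 L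
        by (intro interval[of 7 "L - 2" \<alpha> 9]) auto
    next
      case 5
      then show ?thesis using triple_cover_five_three_pairs_8[OF m assms(3)] n 2 L
        by (intro interval[of 8 "L - 3" \<alpha> 11]) auto
    qed
  next
    case 3
    have n: "n = 2 * L + 13" using 3 L \<beta>(3) by simp
    from small consider "L = 0" | "L = 1" | "3 \<le> L" "odd (L - 2)" | "L \<noteq> 0" "even L" by fastforce
    then show ?thesis
    proof cases
      case 1
      then have "n = 13" "\<beta> = 5" using n L by simp_all
      then show ?thesis using HWP_13_8[OF m(1) m5] \<alpha>(2) assms(3) 3 by auto
    next
      case 2
      then have "n = 15" "\<beta> = 7" using n L by simp_all
      then show ?thesis using HWP_15_8[OF m(1) m5] \<alpha>(2) assms(3) 3 by auto
    next
      case inner: 3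
      then show ?thesis using triple_cover_five_two_pairs_8[OF m assms(3)] n 3 L
        by (intro interval[of 8 "L - 2" \<alpha> 9]) auto
    next
      case 4
      \<comment> \<open>One inner pair suffices, raising \<open>N\<close> from 6 to 7.\<close>
      then show ?thesis using five_pair[of 7] 3 by simp
    qed
  next
    case 4
    obtain a where a: "\<alpha> = 2 * a" using \<open>even \<alpha>\<close> by (rule evenE)
    consider "L = 0 \<or> odd L" | "L \<noteq> 0" "even L" by blast
    then show ?thesis
    proof cases
      case 1
      then show ?thesis using five[of "a + 2"] 4 a by simp
    next
      case 2
      then show ?thesis using five_pair[of "a + 3"] 4 a by simp
    qed
  qed
qed

theorem theorem1p6:
  fixes m n \<alpha> \<beta> :: nat
  assumes "odd n" and "odd m" and "n \<ge> m" and "m \<ge> 3"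
    and "\<alpha> \<le> n"
    and "\<not> (\<alpha> \<in> {2, 4} \<or> \<beta> \<in> {1, 3} \<or> (m, n, \<alpha>) \<in> {(3, 11, 6), (3, 13, 8), (3, 15, 8)})"
  shows "(\<alpha>, \<beta>) \<in> HWP (lex_cycle_graph m n) m n \<longleftrightarrow> \<beta> = n - \<alpha>"
proof
  assume "(\<alpha>, \<beta>) \<in> HWP (lex_cycle_graph m n) m n"
  then have "\<alpha> + \<beta> = n" using assms by (intro HWP_imp_sum) simp_all
  then show "\<beta> = n - \<alpha>" by simp
next
  assume "\<beta> = n - \<alpha>"
  then have sum: "\<alpha> + \<beta> = n" using assms by simp
  have "even (n - m)" using assms by simp
  then obtain t where "n - m = 2 * t" by (rule evenE)
  then have t: "n = m + 2 * t" using assms by simp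
  show "(\<alpha>, \<beta>) \<in> HWP (lex_cycle_graph m n) m n"
  proof (cases "even \<beta>")
    case True
    then show ?thesis using assms sum by (intro HWP_even[OF _ _ t]) simp_all
  next
    case False
    have "5 \<le> \<beta>" using False assms(6) by simp presburger
    then show ?thesis using False assms sum by (intro HWP_odd[OF _ _ t]) simp_all
  qed
qed

end
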